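(* Let $\lambda$ be a partition of $N$ and $H_T$ a connected component of $H_\lambda$. (1) For each vertex $(\tau,v)$ of $H_T$, $J_{v,\tau}\mathcal{S}$ is a scalar multiple of $J_{\lambda_T,\mathrm{std}(T)}\mathcal{S}$. (2) $J_{\lambda_T,\mathrm{std}(T)}\mathcal{S}\ne0$ if and only if $H_T$ is $1$-compatible. (3) If $H_T$ is $1$-compatible, then $J_T=\sum_{(\tau,v)\text{ vertex of }H_T}\mathcal{E}_{v,\tau}J_{v,\tau}$ is symmetric, i.e. $J_T(s_i\otimes s_i)=J_T$ for all $1\le i<N$.
   Context: Partitions in French convention (rows numbered bottom to top). An RST of shape $\lambda\vdash N$ is a bijective filling with $1,\dots,N$ strictly decreasing along rows (left to right) and columns (bottom to top); $\mathrm{CT}_\tau[i]=c-r$ if $i$ is in column $c$, row $r$; $\tau_\lambda$ fills the columns left to right, each bottom to top, with $N,\dots,1$. For $v\in\mathbb{N}^N$: $v^+$ decreasing rearrangement; $\sigma_v$ labels positions by $1,\dots,N$ in order of decreasing entries, ties left to right; $vs_i$ swaps entries $i,i+1$; $v\Psi=[v[2],\dots,v[N],v[1]+1]$. $\alpha$ indeterminate; $\zeta_{v,\tau}[i]=\alpha v[i]+\mathrm{CT}_\tau[\sigma_v[i]]$. Graph $G_\lambda$: vertices are pairs $(\tau,v)$ reachable from $(\tau_\lambda,0^N)$ plus $\varnothing$; from $(\tau,v)$: edge $\Psi$ to $(\tau,v\Psi)$; edge $s_i$ to $(\tau,vs_i)$ if $v[i]<v[i+1]$; if $v[i]=v[i+1]$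 and $\mathrm{CT}_\tau[\sigma_v[i]]-\mathrm{CT}_\tau[\sigma_v[i]+1]\ge2$, edge $s_i$ to $(\tau',v)$, $\tau'$ obtained by interchanging $\sigma_v[i],\sigma_v[i]+1$; if $v[i]=v[i+1]$ and this interchange is not an RST, edge $s_i$ to $\varnothing$. $H_\lambda$: remove from $G_\lambda$ the $\Psi$-edges, $\varnothing$ and edges into it. $T(\tau,v)$: replace each entry $i$ of $\tau$ by $v^+[i]$; the vertices $(\tau,v)$ with $T(\tau,v)=T$ form a connected component $H_T$. $H_T$ is $1$-compatible if $T$ is strictly increasing up each column. $\lambda_T\in\mathbb{N}^N$ is the decreasing arrangement of the entries of $T$. $\mathrm{std}(T)$ is the RST obtained from $T$ as follows: for each value $k$, with $n_j$ the number of entries of $T$ equal to $j$, the entries equal to $k$, read row by row from bottom to top and left to right in each row, are replaced successively by $N-\sum_{j<k}n_j,\ N-\sum_{j<k}n_j-1,\dots,N-\sum_{j\le k}n_j+1$. Coefficients $\mathcal{E}_{v,\tau}$ on vertices of $H_T$: $\mathcal{E}=1$ at the vertex with no incoming edge in $H_T$; if $H_T$ has an edge labeled $s_i$ from $(\tau',v')$ to $(\tau,v)$, then $\mathcal{E}_{v,\tau}=\frac{\zeta'[i]-\zeta'[i+1]}{\zeta'[i]-\zeta'[i+1]+1}\mathcal{E}_{v',\tau'}$ with $\zeta'=\zeta_{v',\tau'}$ (these rules define $\mathcal{E}$ consistently). $V_\lambda$: $\mathbb{Q}(\alpha)$-space with basis the RSTs of shape $\lambda$, right action: with $b=1/(\mathrm{CT}_\tau[i]-\mathrm{CT}_\tau[i+1])$,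 $\tau s_i=b\tau$ if $b=\pm1$; $b\tau+\tau^{(i,i+1)}$ if $0<b\le\frac12$; $b\tau+(1-b^2)\tau^{(i,i+1)}$ otherwise. $M_\lambda=\mathbb{Q}(\alpha)[x_1,\dots,x_N]\otimes V_\lambda$, operators on the right, $(f\otimes t)(\omega\otimes\omega)=(f\omega)\otimes(t\omega)$ where $f\omega$ permutes variables; $P\Psi=x_N\cdot(P(\theta\otimes\theta))$, $\theta=s_1\cdots s_{N-1}$. $\mathcal{S}=\sum_{\omega\in\mathfrak{S}_N}\omega\otimes\omega$. Polynomials $J_{v,\tau}$: $J_{0^N,\tau_\lambda}=1\otimes\tau_\lambda$ and along each edge from $(\tau,v)$: an $s_i$-edge to $w$ gives $J_w=J_{v,\tau}\big(s_i\otimes s_i+\frac1{\zeta_{v,\tau}[i+1]-\zeta_{v,\tau}[i]}\big)$, a $\Psi$-edge gives $J_{v\Psi,\tau}=J_{v,\tau}\Psi$ (path-independent; $J_\varnothing=0$). *)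

theory Defs
  imports
    "HOL-Library.Poly_Mapping"
    "HOL-Library.Multiset"
    "HOL-Computational_Algebra.Computational_Algebra"
    "HOL-Combinatorics.Permutations"
begin

section \<open>Partitions and tableaux\<close>

definition partition_of :: "nat list \<Rightarrow> nat \<Rightarrow> bool" where
  "partition_of lam N \<longleftrightarrow> sorted_wrt (\<ge>) lam \<and> (\<forall>x\<in>set lam. 0 < x) \<and> sum_list lam = N"

text \<open>A cell is a pair (row, column), both counted from 1; rows are numbered bottom to top.
  Fillings of a diagram are functions on all cells, with value 0 outside the diagram.\<close>

type_synonym tab = "nat \<times> nat \<Rightarrow> nat"

definition cells :: "nat list \<Rightarrow> (nat \<times> nat) set" where
  "cells lam = {(r, c). 1 \<le> r \<and> r \<le> length lam \<and> 1 \<le> c \<and> c \<le> lam ! (r - 1)}"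

definition is_rst :: "nat list \<Rightarrow> tab \<Rightarrow> bool" where
  "is_rst lam \<tau> \<longleftrightarrow>
     bij_betw \<tau> (cells lam) {1..sum_list lam} \<and>
     (\<forall>p. p \<notin> cells lam \<longrightarrow> \<tau> p = 0) \<and>
     (\<forall>r c c'. (r, c) \<in> cells lam \<and> (r, c') \<in> cells lam \<and> c < c' \<longrightarrow> \<tau> (r, c) > \<tau> (r, c')) \<and>
     (\<forall>r r' c. (r, c) \<in> cells lam \<and> (r', c) \<in> cells lam \<and> r < r' \<longrightarrow> \<tau> (r, c) > \<tau> (r', c))"

definition CT :: "tab \<Rightarrow> nat \<Rightarrow> int" where
  "CT \<tau> i = (case (THE p. \<tau> p = i) of (r, c) \<Rightarrow> int c - int r)"

definition tau_shape :: "nat list \<Rightarrow> tab" where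
  "tau_shape lam = (\<lambda>(r, c). if (r, c) \<in> cells lam
     then sum_list lam - card {(r', c') \<in> cells lam. c' < c \<or> (c' = c \<and> r' < r)}
     else 0)"

definition interchange :: "nat \<Rightarrow> tab \<Rightarrow> tab" where
  "interchange a \<tau> = transpose a (a + 1) \<circ> \<tau>"


section \<open>Vectors\<close>

text \<open>Elements of $\mathbb{N}^N$ are lists of length $N$; positions are counted from 1.\<close>

abbreviation entry :: "nat list \<Rightarrow> nat \<Rightarrow> nat" where
  "entry v i \<equiv> v ! (i - 1)"

definition vplus :: "nat list \<Rightarrow> nat list" where
  "vplus v = rev (sort v)"

definition sigma :: "nat list \<Rightarrow> nat \<Rightarrow> nat" where
  "sigma v i = card {j \<in> {1..length v}. entry v j > entry v i}
             + card {j \<in> {1..i}. entry v j = entry v i}"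

definition vswap :: "nat \<Rightarrow> nat list \<Rightarrow> nat list" where
  "vswap i v = v[i - 1 := entry v (i + 1), i := entry v i]"

definition vpsi :: "nat list \<Rightarrow> nat list" where
  "vpsi v = tl v @ [hd v + 1]"


section \<open>The ground field and spectral vectors\<close>

type_synonym qalpha = "rat poly fract"

definition rat_const :: "rat \<Rightarrow> qalpha" where
  "rat_const q = Fract [:q:] 1"

definition alpha :: qalpha where
  "alpha = Fract [:0, 1:] 1"

definition zeta :: "tab \<Rightarrow> nat list \<Rightarrow> nat \<Rightarrow> qalpha" where
  "zeta \<tau> v i = alpha * of_nat (entry v i) + of_int (CT \<tau> (sigma v i))"


section \<open>The graphs\<close>

text \<open>Vertices of the graph $G_\lambda$: \<open>None\<close> is the vertex $\varnothing$.\<close>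

type_synonym vertex = "tab \<times> nat list"

datatype label = Psi_edge | S_edge nat

inductive arrow :: "nat list \<Rightarrow> vertex option \<Rightarrow> label \<Rightarrow> vertex option \<Rightarrow> bool"
  for lam :: "nat list" where
  psi: "v \<noteq> [] \<Longrightarrow> arrow lam (Some (\<tau>, v)) Psi_edge (Some (\<tau>, vpsi v))"
| swap: "\<lbrakk>1 \<le> i; i < sum_list lam; entry v i < entry v (i + 1)\<rbrakk>
     \<Longrightarrow> arrow lam (Some (\<tau>, v)) (S_edge i) (Some (\<tau>, vswap i v))"
| inter: "\<lbrakk>1 \<le> i; i < sum_list lam; entry v i = entry v (i + 1);
       CT \<tau> (sigma v i) - CT \<tau> (sigma v i + 1) \<ge> 2\<rbrakk>
     \<Longrightarrow> arrow lam (Some (\<tau>, v)) (S_edge i) (Some (interchange (sigma v i) \<tau>, v))"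
| fall: "\<lbrakk>1 \<le> i; i < sum_list lam; entry v i = entry v (i + 1);
       \<not> is_rst lam (interchange (sigma v i) \<tau>)\<rbrakk>
     \<Longrightarrow> arrow lam (Some (\<tau>, v)) (S_edge i) None"

definition root_vertex :: "nat list \<Rightarrow> vertex" where
  "root_vertex lam = (tau_shape lam, replicate (sum_list lam) 0)"

inductive_set reachable :: "nat list \<Rightarrow> vertex option set" for lam :: "nat list" where
  root: "Some (root_vertex lam) \<in> reachable lam"
| step: "u \<in> reachable lam \<Longrightarrow> arrow lam u l w \<Longrightarrow> w \<in> reachable lam"

definition G_verts :: "nat list \<Rightarrow> vertex option set" where
  "G_verts lam = reachable lam \<union> {None}"

definition G_edge :: "nat list \<Rightarrow> vertex option \<Rightarrow> label \<Rightarrow> vertex option \<Rightarrow> bool" where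
  "G_edge lam u l w \<longleftrightarrow> u \<in> G_verts lam \<and> arrow lam u l w"

definition H_verts :: "nat list \<Rightarrow> vertex set" where
  "H_verts lam = {u. Some u \<in> G_verts lam}"

definition H_edge :: "nat list \<Rightarrow> vertex \<Rightarrow> nat \<Rightarrow> vertex \<Rightarrow> bool" where
  "H_edge lam u i w \<longleftrightarrow> G_edge lam (Some u) (S_edge i) (Some w)"

definition H_adj :: "nat list \<Rightarrow> (vertex \<times> vertex) set" where
  "H_adj lam = {(u, w). \<exists>i. H_edge lam u i w \<or> H_edge lam w i u}"

definition H_components :: "nat list \<Rightarrow> vertex set set" where
  "H_components lam = {(H_adj lam)\<^sup>* `` {u} | u. u \<in> H_verts lam}"


section \<open>The filling attached to a component\<close>

definition T_of :: "nat list \<Rightarrow> vertex \<Rightarrow> tab" where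
  "T_of lam = (\<lambda>(\<tau>, v) p. if p \<in> cells lam then entry (vplus v) (\<tau> p) else 0)"

definition one_compatible :: "nat list \<Rightarrow> tab \<Rightarrow> bool" where
  "one_compatible lam T \<longleftrightarrow>
     (\<forall>r r' c. (r, c) \<in> cells lam \<and> (r', c) \<in> cells lam \<and> r < r' \<longrightarrow> T (r, c) < T (r', c))"

definition lambda_T :: "nat list \<Rightarrow> tab \<Rightarrow> nat list" where
  "lambda_T lam T = rev (sorted_list_of_multiset (image_mset T (mset_set (cells lam))))"

definition std :: "nat list \<Rightarrow> tab \<Rightarrow> tab" where
  "std lam T = (\<lambda>(r, c). if (r, c) \<in> cells lam
     then sum_list lam - (\<Sum>j<T (r, c). card {q \<in> cells lam. T q = j})
        - card {(r', c') \<in> cells lam. T (r', c') = T (r, c) \<and> (r' < r \<or> (r' = r \<and> c' < c))}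
     else 0)"


section \<open>The coefficients on a component\<close>

text \<open>\<open>E_rel lam C u e\<close>: the value \<open>e\<close> is obtained at \<open>u\<close> by following some path inside the
  component \<open>C\<close> from a vertex without incoming edge.\<close>

inductive E_rel :: "nat list \<Rightarrow> vertex set \<Rightarrow> vertex \<Rightarrow> qalpha \<Rightarrow> bool"
  for lam :: "nat list" and C :: "vertex set" where
  source: "\<lbrakk>u \<in> C; \<not> (\<exists>u'\<in>C. \<exists>i. H_edge lam u' i u)\<rbrakk> \<Longrightarrow> E_rel lam C u 1"
| step: "\<lbrakk>E_rel lam C (\<tau>', v') e; w \<in> C; H_edge lam (\<tau>', v') i w\<rbrakk> \<Longrightarrow>
     E_rel lam C w
       ((zeta \<tau>' v' i - zeta \<tau>' v' (i + 1)) / (zeta \<tau>' v' i - zeta \<tau>' v' (i + 1) + 1) * e)"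

definition E_coeff :: "nat list \<Rightarrow> vertex set \<Rightarrow> vertex \<Rightarrow> qalpha" where
  "E_coeff lam C u = (THE e. E_rel lam C u e)"


section \<open>Vector-valued polynomials\<close>

type_synonym mpol = "(nat \<Rightarrow>\<^sub>0 nat) \<Rightarrow>\<^sub>0 qalpha"

text \<open>$V_\lambda$ is spanned by the basis vectors \<open>Poly_Mapping.single \<tau> 1\<close>, and $M_\lambda$
  is the free module over the polynomials on the same basis: the coefficient of an element
  at \<open>\<tau>\<close> is the polynomial tensored with \<open>\<tau>\<close>.\<close>

type_synonym tabvec = "tab \<Rightarrow>\<^sub>0 qalpha"
type_synonym tabpol = "tab \<Rightarrow>\<^sub>0 mpol"

definition pconst :: "qalpha \<Rightarrow> mpol" where
  "pconst c = Poly_Mapping.single 0 c"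

definition pvar :: "nat \<Rightarrow> mpol" where
  "pvar i = Poly_Mapping.single (Poly_Mapping.single i 1) 1"

definition pmul :: "mpol \<Rightarrow> tabpol \<Rightarrow> tabpol" where
  "pmul f P = Poly_Mapping.map (\<lambda>g. f * g) P"

definition smul :: "qalpha \<Rightarrow> tabpol \<Rightarrow> tabpol" where
  "smul c P = pmul (pconst c) P"

definition tensor :: "mpol \<Rightarrow> tabvec \<Rightarrow> tabpol" where
  "tensor f t = Poly_Mapping.map (\<lambda>c. pconst c * f) t"

definition pol_s :: "nat \<Rightarrow> mpol \<Rightarrow> mpol" where
  "pol_s i f = Poly_Mapping.map_key (Poly_Mapping.map_key (transpose i (i + 1))) f"

definition tab_s :: "nat \<Rightarrow> tab \<Rightarrow> tabvec" where
  "tab_s i \<tau> =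
     (let b = 1 / rat_of_int (CT \<tau> i - CT \<tau> (i + 1)) in
      if b = 1 \<or> b = -1 then Poly_Mapping.single \<tau> (rat_const b)
      else if 0 < b \<and> b \<le> 1 / 2
      then Poly_Mapping.single \<tau> (rat_const b) + Poly_Mapping.single (interchange i \<tau>) 1
      else Poly_Mapping.single \<tau> (rat_const b)
         + Poly_Mapping.single (interchange i \<tau>) (rat_const (1 - b\<^sup>2)))"

text \<open>The operator $s_i \otimes s_i$ acting from the right.\<close>

definition diag_s :: "nat \<Rightarrow> tabpol \<Rightarrow> tabpol" where
  "diag_s i P = (\<Sum>\<tau>\<in>Poly_Mapping.keys P. tensor (pol_s i (Poly_Mapping.lookup P \<tau>)) (tab_s i \<tau>))"

text \<open>The operator $\omega \otimes \omega$ for the product $\omega$ of the simple transpositions in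
  a word; since operators act from the right, the leftmost letter is applied first. The image
  of \<open>j\<close> under \<open>word_perm ws\<close> is correspondingly obtained by applying the leftmost letter first.\<close>

definition diag_word :: "nat list \<Rightarrow> tabpol \<Rightarrow> tabpol" where
  "diag_word ws P = fold diag_s ws P"

definition word_perm :: "nat list \<Rightarrow> nat \<Rightarrow> nat" where
  "word_perm ws = fold (\<lambda>i p. transpose i (i + 1) \<circ> p) ws id"

definition diag_perm :: "nat \<Rightarrow> (nat \<Rightarrow> nat) \<Rightarrow> tabpol \<Rightarrow> tabpol" where
  "diag_perm N w P = diag_word (SOME ws. set ws \<subseteq> {1..<N} \<and> word_perm ws = w) P"

definition Sym :: "nat \<Rightarrow> tabpol \<Rightarrow> tabpol" where
  "Sym N P = (\<Sum>w | w permutes {1..N}. diag_perm N w P)"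

definition Psi :: "nat \<Rightarrow> tabpol \<Rightarrow> tabpol" where
  "Psi N P = pmul (pvar N) (diag_word [1..<N] P)"


section \<open>The vector-valued Jack polynomials\<close>

text \<open>\<open>J_rel lam u P\<close>: the element \<open>P\<close> is obtained at \<open>u\<close> by following some path from the root.\<close>

inductive J_rel :: "nat list \<Rightarrow> vertex option \<Rightarrow> tabpol \<Rightarrow> bool" for lam :: "nat list" where
  root: "J_rel lam (Some (root_vertex lam)) (tensor 1 (Poly_Mapping.single (tau_shape lam) 1))"
| s_step: "\<lbrakk>J_rel lam (Some (\<tau>, v)) P; G_edge lam (Some (\<tau>, v)) (S_edge i) w\<rbrakk> \<Longrightarrow>
     J_rel lam w (diag_s i P + smul (1 / (zeta \<tau> v (i + 1) - zeta \<tau> v i)) P)"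
| psi_step: "\<lbrakk>J_rel lam (Some (\<tau>, v)) P; G_edge lam (Some (\<tau>, v)) Psi_edge w\<rbrakk> \<Longrightarrow>
     J_rel lam w (Psi (sum_list lam) P)"

definition Jack :: "nat list \<Rightarrow> vertex \<Rightarrow> tabpol" where
  "Jack lam u = (THE P. J_rel lam (Some u) P)"

definition Jack_T :: "nat list \<Rightarrow> vertex set \<Rightarrow> tabpol" where
  "Jack_T lam C = (\<Sum>u\<in>C. smul (E_coeff lam C u) (Jack lam u))"

end

theory Submission
  imports Defs
begin

text \<open>
  To a vertex attach the sequence of labels \<open>(v[i], CT(\<sigma>\<^sub>v[i]))\<close>; it determines the vertex. An edge
  \<open>s\<^sub>i\<close> exchanges the labels at \<open>i\<close> and \<open>i + 1\<close>, and the affine edge rotates the sequence. Any two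
  edges entering a vertex can be completed to a square, a hexagon or a double affine step, so the
  Yang--Baxter equation and the commutation of \<open>\<Psi>\<close> with the \<open>s\<^sub>i\<close> give path independence by descent;
  the same descent shows that an edge into the vertex \<open>\<emptyset>\<close> annihilates the polynomial.

  An edge multiplies the symmetrization by a nonzero scalar, so all symmetrizations on a component
  are proportional. If two equal entries of \<open>T\<close> share a column, the source of the component contains
  them as consecutive entries, and its polynomial is antisymmetric under one \<open>s\<^sub>i\<close>. Otherwise the
  two ends of each edge contribute a multiple of \<open>J (1 + s\<^sub>i)\<close> to \<open>J\<^sub>T\<close>, which is therefore symmetric.
  Finally, \<open>J\<^sub>T\<close> does not vanish: only the vertices with \<open>v = \<lambda>\<^sub>T\<close> contribute to the monomial \<open>x\<close>
  to the power \<open>\<lambda>\<^sub>T\<close>, and the coefficients there are the images of distinct tableaux under one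
  invertible operator.
\<close>

declare One_nat_def [simp del] Suc_eq_plus1 [symmetric, simp]

section \<open>Finitely supported functions\<close>

abbreviation lookup :: "('a \<Rightarrow>\<^sub>0 'b::zero) \<Rightarrow> 'a \<Rightarrow> 'b" where
  "lookup \<equiv> Poly_Mapping.lookup"

abbreviation keys :: "('a \<Rightarrow>\<^sub>0 'b::zero) \<Rightarrow> 'a set" where
  "keys \<equiv> Poly_Mapping.keys"

abbreviation single :: "'a \<Rightarrow> 'b::zero \<Rightarrow> ('a \<Rightarrow>\<^sub>0 'b)" where
  "single \<equiv> Poly_Mapping.single"

lemma sum_single_keys:
  fixes P :: "'a \<Rightarrow>\<^sub>0 'b::comm_monoid_add"
  shows "(\<Sum>k\<in>keys P. single k (lookup P k)) = P"
proof (rule poly_mapping_eqI)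
  fix k
  have "(\<Sum>x\<in>keys P. lookup (single x (lookup P x)) k)
      = (\<Sum>x\<in>keys P. if x = k then lookup P k else 0)"
    by (rule sum.cong) (auto simp: lookup_single when_def)
  also have "\<dots> = lookup P k"
    by (auto simp: sum.delta in_keys_iff)
  finally show "lookup (\<Sum>k\<in>keys P. single k (lookup P k)) k = lookup P k"
    by (simp add: lookup_sum)
qed

lemma additive_eqI_keys:
  fixes F G :: "('a \<Rightarrow>\<^sub>0 'b::ab_group_add) \<Rightarrow> 'c::ab_group_add"
  assumes "additive F" and "additive G"
    and single: "\<And>k x. k \<in> keys P \<Longrightarrow> F (single k x) = G (single k x)"
  shows "F P = G P"
proof -
  have "F (\<Sum>k\<in>keys P. single k (lookup P k)) = G (\<Sum>k\<in>keys P. single k (lookup P k))"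
    unfolding additive.sum[OF assms(1)] additive.sum[OF assms(2)]
    by (rule sum.cong) (auto simp: single)
  then show ?thesis by (simp add: sum_single_keys)
qed

section \<open>Scalars\<close>

lemma rat_const_add: "rat_const (a + b) = rat_const a + rat_const b"
  by (simp add: rat_const_def)

lemma rat_const_mult: "rat_const (a * b) = rat_const a * rat_const b"
  by (simp add: rat_const_def mult.commute)

lemma rat_const_0 [simp]: "rat_const 0 = 0"
  by (simp add: rat_const_def Zero_fract_def)

lemma rat_const_1 [simp]: "rat_const 1 = 1"
  by (simp add: rat_const_def One_fract_def pCons_one)

lemma rat_const_minus: "rat_const (- a) = - rat_const a"
  by (simp add: rat_const_def)

lemma rat_const_of_nat: "rat_const (of_nat n) = of_nat n"
  by (induction n) (auto simp: rat_const_add)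

lemma rat_const_of_int: "rat_const (of_int n) = of_int n"
  by (cases n) (auto simp: rat_const_of_nat rat_const_minus simp del: of_nat_Suc)

lemma rat_const_eq_0_iff [simp]: "rat_const a = 0 \<longleftrightarrow> a = 0"
  by (simp add: rat_const_def Zero_fract_def eq_fract)

lemma rat_const_divide: "rat_const (a / b) = rat_const a / rat_const b"
proof (cases "b = 0")
  case False
  then have "rat_const (a / b) * rat_const b = rat_const a"
    by (simp flip: rat_const_mult)
  then show ?thesis using False by (metis nonzero_eq_divide_eq rat_const_eq_0_iff)
qed auto

lemma alpha_lincomb_eq_0_iff: "alpha * of_int n + of_int m = 0 \<longleftrightarrow> n = 0 \<and> m = 0"
proof -
  have "alpha * of_int n + of_int m = Fract [:of_int m, of_int n:] 1"
    unfolding rat_const_of_int[symmetric] alpha_def rat_const_def by simp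
  also have "\<dots> = 0 \<longleftrightarrow> n = 0 \<and> m = 0"
    by (auto simp: Zero_fract_def eq_fract)
  finally show ?thesis .
qed

lemma pconst_0 [simp]: "pconst 0 = 0"
  by (simp add: pconst_def)

lemma pconst_1 [simp]: "pconst 1 = 1"
  by (simp add: pconst_def)

lemma pconst_add: "pconst (a + b) = pconst a + pconst b"
  by (simp add: pconst_def single_add)

lemma pconst_mult: "pconst (a * b) = pconst a * pconst b"
  by (simp add: pconst_def mult_single)

lemma lookup_pconst_mult [simp]: "lookup (pconst c * f) m = c * lookup f m"
  by (simp add: pconst_def flip: mult_map_scale_conv_mult) (simp add: map.rep_eq when_def)

lemma lookup_pmul [simp]: "lookup (pmul f P) \<tau> = f * lookup P \<tau>"
  by (simp add: pmul_def map.rep_eq when_def)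

lemma lookup_smul [simp]: "lookup (smul c P) \<tau> = pconst c * lookup P \<tau>"
  by (simp add: smul_def)

interpretation smul: vector_space smul
  by unfold_locales
    (auto intro!: poly_mapping_eqI simp: lookup_add algebra_simps pconst_add pconst_mult)

lemma smul_single: "smul c (single \<tau> f) = single \<tau> (pconst c * f)"
  by (auto intro!: poly_mapping_eqI simp: lookup_single when_def)

interpretation pmul: module_hom smul smul "pmul f" for f
  by unfold_locales (auto intro!: poly_mapping_eqI simp: lookup_add algebra_simps)

lemma pmul_single: "pmul f (single \<tau> g) = single \<tau> (f * g)"
  by (auto intro!: poly_mapping_eqI simp: lookup_single when_def)

lemma pmul_pmul: "pmul f (pmul g P) = pmul (f * g) P"
  by (auto intro!: poly_mapping_eqI simp: algebra_simps)

section \<open>Simple transpositions acting on polynomials\<close>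

abbreviation swap_exponents :: "nat \<Rightarrow> (nat \<Rightarrow>\<^sub>0 nat) \<Rightarrow> (nat \<Rightarrow>\<^sub>0 nat)" where
  "swap_exponents i \<equiv> Poly_Mapping.map_key (transpose i (Suc i))"

lemma lookup_swap_exponents [simp]:
  "lookup (swap_exponents i m) k = lookup m (transpose i (Suc i) k)"
  by (simp add: map_key.rep_eq)

lemma swap_exponents_involutory [simp]: "swap_exponents i (swap_exponents i m) = m"
  by (auto intro!: poly_mapping_eqI)

lemma lookup_pol_s [simp]: "lookup (pol_s i f) m = lookup f (swap_exponents i m)"
proof -
  have "inj (swap_exponents i)" by (metis injI swap_exponents_involutory)
  then show ?thesis by (simp add: pol_s_def map_key.rep_eq)
qed

lemma additive_pol_s: "additive (pol_s i)"
  by unfold_locales (auto intro!: poly_mapping_eqI simp: lookup_add)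

lemmas pol_s_add = additive.add[OF additive_pol_s]

lemma pol_s_single: "pol_s i (single m c) = single (swap_exponents i m) c"
  by (auto intro!: poly_mapping_eqI simp: lookup_single when_def)

lemma pol_s_mult: "pol_s i (f * g) = pol_s i f * pol_s i g"
proof (rule additive_eqI_keys[where F = "\<lambda>f. pol_s i (f * g)" and G = "\<lambda>f. pol_s i f * pol_s i g"])
  fix m c
  show "pol_s i (single m c * g) = pol_s i (single m c) * pol_s i g"
    by (rule additive_eqI_keys[where F = "\<lambda>g. pol_s i (single m c * g)"
          and G = "\<lambda>g. pol_s i (single m c) * pol_s i g"])
      (auto simp: additive_def pol_s_add algebra_simps mult_single pol_s_single map_key_plus)
qed (auto simp: additive_def pol_s_add algebra_simps)

lemma pol_s_1 [simp]: "pol_s i 1 = 1"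
  by (simp add: pol_s_single flip: single_one)

lemma pol_s_pconst [simp]: "pol_s i (pconst c) = pconst c"
  by (simp add: pconst_def pol_s_single)

lemma pol_s_involutory [simp]: "pol_s i (pol_s i f) = f"
  by (auto intro!: poly_mapping_eqI)

lemma pol_s_commute:
  assumes "Suc (Suc i) \<le> j"
  shows "pol_s i (pol_s j f) = pol_s j (pol_s i f)"
proof -
  have "swap_exponents j (swap_exponents i m) = swap_exponents i (swap_exponents j m)" for m
    using assms by (auto intro!: poly_mapping_eqI arg_cong[of _ _ "lookup m"] simp: transpose_def)
  then show ?thesis by (auto intro!: poly_mapping_eqI)
qed

lemma pol_s_braid: "pol_s i (pol_s (Suc i) (pol_s i f)) = pol_s (Suc i) (pol_s i (pol_s (Suc i) f))"
proof -
  have "swap_exponents i (swap_exponents (Suc i) (swap_exponents i m))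
      = swap_exponents (Suc i) (swap_exponents i (swap_exponents (Suc i) m))" for m
    by (auto intro!: poly_mapping_eqI arg_cong[of _ _ "lookup m"] simp: transpose_def)
  then show ?thesis by (auto intro!: poly_mapping_eqI)
qed

lemma pol_s_pvar: "pol_s i (pvar k) = pvar (transpose i (Suc i) k)"
proof -
  have "swap_exponents i (single k 1) = single (transpose i (Suc i) k) 1"
    by (rule poly_mapping_eqI) (auto simp: lookup_single when_def transpose_eq_iff)
  then show ?thesis unfolding pvar_def pol_s_single by simp
qed

section \<open>Simple transpositions acting on tableaux\<close>

lemma interchange_eq: "interchange i \<tau> = transpose i (Suc i) \<circ> \<tau>"
  by (simp add: interchange_def)

lemma CT_interchange: "CT (interchange i \<tau>) k = CT \<tau> (transpose i (Suc i) k)"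
proof -
  have "transpose i (Suc i) (\<tau> p) = k \<longleftrightarrow> \<tau> p = transpose i (Suc i) k" for p
    by (metis transpose_involutory)
  then show ?thesis by (simp add: CT_def interchange_eq)
qed

lemma interchange_involutory [simp]: "interchange i (interchange i \<tau>) = \<tau>"
  by (auto simp: interchange_eq fun_eq_iff)

lemma interchange_commute:
  "Suc (Suc i) \<le> j \<Longrightarrow> interchange i (interchange j \<tau>) = interchange j (interchange i \<tau>)"
  by (auto simp: interchange_eq fun_eq_iff transpose_def)

lemma interchange_braid:
  "interchange i (interchange (Suc i) (interchange i \<tau>))
    = interchange (Suc i) (interchange i (interchange (Suc i) \<tau>))"
  by (auto simp: interchange_eq fun_eq_iff transpose_def)

definition axial_distance :: "nat \<Rightarrow> tab \<Rightarrow> int" where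
  "axial_distance i \<tau> = CT \<tau> i - CT \<tau> (Suc i)"

lemma axial_distance_interchange:
  "axial_distance i (interchange i \<tau>) = - axial_distance i \<tau>"
  "axial_distance (Suc i) (interchange i \<tau>) = axial_distance i \<tau> + axial_distance (Suc i) \<tau>"
  "axial_distance i (interchange (Suc i) \<tau>) = axial_distance i \<tau> + axial_distance (Suc i) \<tau>"
  by (auto simp: axial_distance_def CT_interchange transpose_def)

lemma axial_distance_interchange_far:
  "Suc (Suc i) \<le> j \<Longrightarrow> axial_distance i (interchange j \<tau>) = axial_distance i \<tau>"
  "Suc (Suc i) \<le> j \<Longrightarrow> axial_distance j (interchange i \<tau>) = axial_distance j \<tau>"
  by (auto simp: axial_distance_def CT_interchange transpose_def)

definition seminormal_coeff :: "int \<Rightarrow> qalpha" where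
  "seminormal_coeff d =
     (if d = 1 \<or> d = -1 then 0 else if 2 \<le> d then 1 else 1 - (1 / of_int d)\<^sup>2)"

lemma seminormal_coeff_mult_uminus:
  "seminormal_coeff d * seminormal_coeff (- d) = 1 - (1 / of_int d)\<^sup>2"
  by (auto simp: seminormal_coeff_def)

lemma tab_s_seminormal:
  "tab_s i \<tau> = single \<tau> (1 / of_int (axial_distance i \<tau>))
    + single (interchange i \<tau>) (seminormal_coeff (axial_distance i \<tau>))"
proof -
  let ?d = "axial_distance i \<tau>"
  define b where "b = 1 / rat_of_int ?d"
  have "rat_const b = 1 / of_int ?d"
    by (simp add: b_def rat_const_divide rat_const_of_int)
  moreover have "rat_const (1 - b\<^sup>2) = 1 - (rat_const b)\<^sup>2"
    using rat_const_add[of 1 "- b\<^sup>2"] by (simp add: rat_const_minus rat_const_mult power2_eq_square)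
  moreover have "b = 1 \<longleftrightarrow> ?d = 1" "b = -1 \<longleftrightarrow> ?d = -1" "0 < b \<and> b \<le> 1 / 2 \<longleftrightarrow> 2 \<le> ?d"
    unfolding b_def by (cases "?d = 0"; simp add: field_simps divide_eq_minus_1_iff)
      (auto simp: divide_eq_minus_1_iff divide_le_eq le_divide_eq)
  ultimately show ?thesis
    unfolding tab_s_def Let_def Suc_eq_plus1[symmetric] axial_distance_def[symmetric]
      b_def[symmetric]
    by (auto simp: seminormal_coeff_def)
qed

section \<open>Simple transpositions acting on tableau-valued polynomials\<close>

lemma lookup_tensor [simp]: "lookup (tensor f t) \<tau> = pconst (lookup t \<tau>) * f"
  by (simp add: tensor_def map.rep_eq when_def)

lemma tensor_one_single: "tensor 1 (single \<tau> 1) = single \<tau> 1"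
  by (auto intro!: poly_mapping_eqI simp: lookup_single when_def)

lemma diag_s_eq_sum:
  assumes "finite A" "keys P \<subseteq> A"
  shows "diag_s i P = (\<Sum>\<tau>\<in>A. tensor (pol_s i (lookup P \<tau>)) (tab_s i \<tau>))"
proof -
  have "tensor (pol_s i 0) t = 0" for t
    by (auto intro!: poly_mapping_eqI)
  then show ?thesis
    unfolding diag_s_def using assms
    by (intro sum.mono_neutral_left) (auto simp: in_keys_iff)
qed

lemma additive_diag_s: "additive (diag_s i)"
proof
  fix P Q :: tabpol
  let ?A = "keys P \<union> keys Q"
  have "tensor (pol_s i (f + g)) t = tensor (pol_s i f) t + tensor (pol_s i g) t" for f g t
    by (auto intro!: poly_mapping_eqI simp: lookup_add pol_s_add algebra_simps)
  then show "diag_s i (P + Q) = diag_s i P + diag_s i Q"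
    using keys_add[of P Q] by (simp add: diag_s_eq_sum[of ?A] sum.distrib lookup_add)
qed

lemma diag_s_single:
  "diag_s i (single \<tau> f) = smul (1 / of_int (axial_distance i \<tau>)) (single \<tau> (pol_s i f))
    + smul (seminormal_coeff (axial_distance i \<tau>)) (single (interchange i \<tau>) (pol_s i f))"
proof -
  have "diag_s i (single \<tau> f) = tensor (pol_s i f) (tab_s i \<tau>)"
    by (subst diag_s_eq_sum[of "{\<tau>}"]) auto
  then show ?thesis
    by (auto intro!: poly_mapping_eqI
        simp: tab_s_seminormal lookup_add lookup_single when_def pconst_add distrib_right)
qed

lemma diag_s_pmul: "diag_s i (pmul f P) = pmul (pol_s i f) (diag_s i P)"
  by (rule additive_eqI_keys[where F = "\<lambda>P. diag_s i (pmul f P)"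
        and G = "\<lambda>P. pmul (pol_s i f) (diag_s i P)"])
    (auto simp: additive_def pmul.add additive.add[OF additive_diag_s] pmul_single diag_s_single
      pol_s_mult smul_single algebra_simps)

interpretation diag_s: module_hom smul smul "diag_s i" for i
  by unfold_locales (simp_all add: additive.add[OF additive_diag_s] smul_def diag_s_pmul)

lemma diag_s_involutory [simp]: "diag_s i (diag_s i P) = P"
proof (rule additive_eqI_keys[where F = "\<lambda>P. diag_s i (diag_s i P)" and G = "\<lambda>P. P"])
  fix \<tau> f
  let ?b = "1 / of_int (axial_distance i \<tau>)"
    and ?w = "\<lambda>e. seminormal_coeff (e * axial_distance i \<tau>)"
  have "diag_s i (diag_s i (single \<tau> f)) =
      smul (?b * ?b + ?w 1 * ?w (- 1)) (single \<tau> f)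
        + smul (?b * ?w 1 - ?w 1 * ?b) (single (interchange i \<tau>) f)"
    by (simp add: diag_s_single diag_s.add diag_s.scale axial_distance_interchange
      smul.scale_left_distrib smul.scale_left_diff_distrib smul.scale_right_distrib algebra_simps)
  also have "\<dots> = single \<tau> f"
    using seminormal_coeff_mult_uminus[of "axial_distance i \<tau>"] by (simp add: power2_eq_square)
  finally show "diag_s i (diag_s i (single \<tau> f)) = single \<tau> f" .
qed (auto simp: additive_def diag_s.add)

lemma diag_s_commute:
  assumes "Suc (Suc i) \<le> j"
  shows "diag_s i (diag_s j P) = diag_s j (diag_s i P)"
proof (rule additive_eqI_keys[where F = "\<lambda>P. diag_s i (diag_s j P)"
      and G = "\<lambda>P. diag_s j (diag_s i P)"])
  fix \<tau> f
  show "diag_s i (diag_s j (single \<tau> f)) = diag_s j (diag_s i (single \<tau> f))"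
    unfolding diag_s_single diag_s.add diag_s.scale interchange_commute[OF assms]
      axial_distance_interchange_far[OF assms] pol_s_commute[OF assms]
      smul.scale_right_distrib smul.scale_scale
    by (simp only: ac_simps)
qed (auto simp: additive_def diag_s.add)

lemma inverse_mult_inverse_eq:
  fixes x y :: "'a::field"
  assumes "x \<noteq> 0" "y \<noteq> 0" "x + y \<noteq> 0"
  shows "1 / x * (1 / y) = 1 / (x + y) * (1 / x + 1 / y)"
  using assms by (simp add: field_simps)

lemma seminormal_coeff_braid:
  fixes d e :: int
  defines "b \<equiv> \<lambda>n. 1 / of_int n" and "w \<equiv> seminormal_coeff"
  assumes "d \<noteq> 0" "e \<noteq> 0" "d + e \<noteq> 0"
  shows "b d * b e * b d + w d * b (d + e) * w (- d) = b e * b d * b e + w e * b (d + e) * w (- e)"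
    and "b d * b e * w d + w d * b (d + e) * b (- d) = b e * w d * b (d + e)"
proof -
  have b_uminus: "b (- n) = - b n" for n by (simp add: b_def)
  have b_mult: "b d * b e = b (d + e) * (b d + b e)"
    unfolding b_def of_int_add using assms(3-5)
    by (intro inverse_mult_inverse_eq) (auto simp flip: of_int_add)
  have w_mult: "w n * w (- n) = 1 - b n * b n" for n
    by (simp add: w_def seminormal_coeff_mult_uminus b_def power2_eq_square)
  show "b d * b e * b d + w d * b (d + e) * w (- d) = b e * b d * b e + w e * b (d + e) * w (- e)"
    using w_mult[of d] w_mult[of e] b_mult by algebra
  show "b d * b e * w d + w d * b (d + e) * b (- d) = b e * w d * b (d + e)"
    unfolding b_uminus using b_mult by algebra
qed

lemma diag_s_braid_single:
  assumes "axial_distance i \<tau> \<noteq> 0" "axial_distance (Suc i) \<tau> \<noteq> 0"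
    "axial_distance i \<tau> + axial_distance (Suc i) \<tau> \<noteq> 0"
  shows "diag_s i (diag_s (Suc i) (diag_s i (single \<tau> f))) =
    diag_s (Suc i) (diag_s i (diag_s (Suc i) (single \<tau> f)))"
proof -
  define d where "d = axial_distance i \<tau>"
  define e where "e = axial_distance (Suc i) \<tau>"
  define b where "b n = 1 / (of_int n :: qalpha)" for n
  let ?w = seminormal_coeff
  let ?S = "\<lambda>word. single (foldr interchange word \<tau>) (pol_s (Suc i) (pol_s i (pol_s (Suc i) f)))"
  note expand = diag_s_single diag_s.add diag_s.scale axial_distance_interchange
    d_def[symmetric] e_def[symmetric] b_def[symmetric] pol_s_braid interchange_braid
    smul.scale_right_distrib smul.scale_scale interchange_involutory
  have lhs: "diag_s i (diag_s (Suc i) (diag_s i (single \<tau> f))) =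
     smul (b d * b e * b d + ?w d * b (d + e) * ?w (- d)) (?S [])
    + smul (b d * b e * ?w d + ?w d * b (d + e) * b (- d)) (?S [i])
    + smul (b d * ?w e * b (d + e)) (?S [Suc i])
    + smul (b d * ?w e * ?w (d + e)) (?S [i, Suc i])
    + smul (?w d * ?w (d + e) * b e) (?S [Suc i, i])
    + smul (?w d * ?w (d + e) * ?w e) (?S [Suc i, i, Suc i])"
    unfolding expand by (simp add: interchange_braid algebra_simps smul.scale_left_distrib)
  have rhs: "diag_s (Suc i) (diag_s i (diag_s (Suc i) (single \<tau> f))) =
      smul (b e * b d * b e + ?w e * b (d + e) * ?w (- e)) (?S [])
    + smul (b e * b d * ?w e + ?w e * b (d + e) * b (- e)) (?S [Suc i])
    + smul (b e * ?w d * b (d + e)) (?S [i])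
    + smul (b e * ?w d * ?w (d + e)) (?S [Suc i, i])
    + smul (?w e * ?w (d + e) * b d) (?S [i, Suc i])
    + smul (?w e * ?w (d + e) * ?w d) (?S [Suc i, i, Suc i])"
    unfolding expand by (simp add: interchange_braid algebra_simps smul.scale_left_distrib)
  show ?thesis
    using seminormal_coeff_braid[of d e] seminormal_coeff_braid(2)[of e d] assms
    unfolding lhs rhs d_def[symmetric] e_def[symmetric] b_def[symmetric]
    by (simp add: algebra_simps)
qed

section \<open>Words in the simple transpositions\<close>

lemma word_perm_eq_apply_adj_transps: "word_perm ws = apply_adj_transps (rev ws)"
  unfolding word_perm_def by (induction ws rule: rev_induct) simp_all

lemma word_perm_Nil [simp]: "word_perm [] = id"
  by (simp add: word_perm_def)

lemma word_perm_Cons: "word_perm (i # ws) = word_perm ws \<circ> transpose i (Suc i)"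
  by (simp add: word_perm_eq_apply_adj_transps)

lemma word_perm_append: "word_perm (us @ vs) = word_perm vs \<circ> word_perm us"
  by (induction us) (simp_all add: word_perm_Cons o_assoc)

lemma word_perm_permutes: "set ws \<subseteq> {1..<n} \<Longrightarrow> word_perm ws permutes {1..n}"
  unfolding word_perm_eq_apply_adj_transps by (intro permutes_apply_adj_transps) auto

lemma inj_word_perm: "inj (word_perm ws)"
  using permutation_bijective[OF permutation_apply_adj_transps, of "rev ws"]
  by (simp add: word_perm_eq_apply_adj_transps bij_is_inj)

lemma word_perm_surj:
  assumes "w permutes {1..n}"
  shows "\<exists>ws. set ws \<subseteq> {1..<n} \<and> word_perm ws = w"
  using assms finite_atLeastAtMost
proof (induction rule: permutes_induct)
  case id
  show ?case by (intro exI[of _ "[]"]) simp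
next
  case (swap a b p)
  then obtain ws where ws: "set ws \<subseteq> {1..<n}" "word_perm ws = p" by blast
  have "\<exists>us. set us \<subseteq> {1..<n} \<and> word_perm us = transpose a b"
    if "a < b" "1 \<le> a" "b \<le> n" for a b
    using that adj_transp_seq_correct[of a b] set_adj_transp_seq[of a b]
    by (intro exI[of _ "rev (adj_transp_seq a b)"]) (auto simp: word_perm_eq_apply_adj_transps)
  then obtain us where us: "set us \<subseteq> {1..<n}" "word_perm us = transpose a b"
    using swap.hyps by (metis atLeastAtMost_iff linorder_neqE_nat transpose_commute)
  show ?case using ws us by (intro exI[of _ "ws @ us"]) (auto simp: word_perm_append)
qed

inductive coxeter_equiv :: "nat \<Rightarrow> nat list \<Rightarrow> nat list \<Rightarrow> bool" for n where
  refl [simp]: "coxeter_equiv n ws ws"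
| sym: "coxeter_equiv n us vs \<Longrightarrow> coxeter_equiv n vs us"
| trans [trans]: "coxeter_equiv n us vs \<Longrightarrow> coxeter_equiv n vs ws \<Longrightarrow> coxeter_equiv n us ws"
| append: "coxeter_equiv n us us' \<Longrightarrow> coxeter_equiv n vs vs' \<Longrightarrow> coxeter_equiv n (us @ vs) (us' @ vs')"
| cancel: "0 < i \<Longrightarrow> i < n \<Longrightarrow> coxeter_equiv n [i, i] []"
| commute: "0 < i \<Longrightarrow> Suc (Suc i) \<le> j \<Longrightarrow> j < n \<Longrightarrow> coxeter_equiv n [i, j] [j, i]"
| braid: "0 < i \<Longrightarrow> Suc i < n \<Longrightarrow> coxeter_equiv n [i, Suc i, i] [Suc i, i, Suc i]"

lemma coxeter_equiv_word_perm: "coxeter_equiv n us vs \<Longrightarrow> word_perm us = word_perm vs"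
  by (induction rule: coxeter_equiv.induct)
    (auto simp: word_perm_append word_perm_Cons fun_eq_iff transpose_def)

lemma coxeter_equiv_letters: "coxeter_equiv n us vs \<Longrightarrow> set us \<subseteq> {1..<n} \<longleftrightarrow> set vs \<subseteq> {1..<n}"
  by (induction rule: coxeter_equiv.induct) (auto simp: Suc_le_eq)

lemma coxeter_equiv_append_left: "coxeter_equiv n vs vs' \<Longrightarrow> coxeter_equiv n (us @ vs) (us @ vs')"
  by (intro coxeter_equiv.append coxeter_equiv.refl)

lemma coxeter_equiv_append_right: "coxeter_equiv n us us' \<Longrightarrow> coxeter_equiv n (us @ vs) (us' @ vs)"
  by (intro coxeter_equiv.append coxeter_equiv.refl)

lemma coxeter_equiv_commute_word:
  assumes "set ws \<subseteq> {1..<n}" "0 < j" "j < n"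
    and "\<And>i. i \<in> set ws \<Longrightarrow> Suc (Suc i) \<le> j \<or> Suc (Suc j) \<le> i"
  shows "coxeter_equiv n (ws @ [j]) (j # ws)"
  using assms
proof (induction ws)
  case (Cons i ws)
  have "coxeter_equiv n ([i] @ ws @ [j]) ([i] @ j # ws)"
    using Cons by (intro coxeter_equiv_append_left) auto
  also have "coxeter_equiv n [i, j] [j, i]"
    using Cons.prems coxeter_equiv.commute[of i j n] coxeter_equiv.commute[of j i n]
    by (auto intro: coxeter_equiv.sym simp: Suc_le_eq)
  then have "coxeter_equiv n ([i] @ j # ws) (j # i # ws)"
    using coxeter_equiv_append_right[of n "[i, j]" "[j, i]" ws] by simp
  finally show ?case by simp
qed simp

text \<open>For \<open>1 \<le> k \<le> m + 1\<close> these words represent the cosets of the symmetric group on \<open>m\<close> letters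
  in that on \<open>m + 1\<close> letters.\<close>

definition coset_word :: "nat \<Rightarrow> nat \<Rightarrow> nat list" where
  "coset_word m k = rev [k..<Suc m]"

lemma set_coset_word: "set (coset_word m k) = {k..m}"
  by (auto simp: coset_word_def)

lemma coset_word_empty [simp]: "coset_word m (Suc m) = []"
  by (simp add: coset_word_def)

lemma coset_word_snoc: "k \<le> m \<Longrightarrow> coset_word m k = coset_word m (Suc k) @ [k]"
  by (simp add: coset_word_def upt_rec[of k])

lemma coset_word_split:
  assumes "0 < k" "k \<le> i" "i < m"
  shows "coset_word m k = coset_word m (Suc (Suc i)) @ [Suc i, i] @ coset_word (i - 1) k"
proof -
  have "[k..<Suc m] = [k..<i] @ [i..<Suc m]"
    using assms upt_add_eq_append[of k i "Suc m - i"] by simp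
  also have "[i..<Suc m] = i # Suc i # [Suc (Suc i)..<Suc m]"
    using assms by (simp add: upt_conv_Cons del: upt_Suc)
  finally show ?thesis using assms by (simp add: coset_word_def del: upt_Suc)
qed

lemma word_perm_coset_word: "k \<le> Suc m \<Longrightarrow> word_perm (coset_word m k) (Suc m) = k"
  by (induction k rule: inc_induct) (simp_all add: coset_word_snoc word_perm_append word_perm_Cons)

lemma coset_word_shift:
  assumes "m < n" "0 < k" "k < j" "j \<le> m"
  shows "coxeter_equiv n (coset_word m k @ [j]) ((j - 1) # coset_word m k)"
proof -
  obtain i where j: "j = Suc i" using assms by (cases j) auto
  let ?A = "coset_word m (Suc j)" and ?B = "coset_word (i - 1) k"
  have split: "coset_word m k = ?A @ [j, i] @ ?B"
    using assms coset_word_split[of k i m] by (simp add: j)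
  have "coxeter_equiv n ((?A @ [j, i]) @ ?B @ [j]) ((?A @ [j, i]) @ j # ?B)"
    using assms j
    by (intro coxeter_equiv_append_left coxeter_equiv_commute_word) (auto simp: set_coset_word)
  also have "coxeter_equiv n [j, i, j] [i, j, i]"
    using assms by (auto simp: j intro: coxeter_equiv.sym[OF coxeter_equiv.braid])
  then have "coxeter_equiv n ((?A @ [j, i]) @ j # ?B) ((?A @ [i]) @ [j, i] @ ?B)"
    using coxeter_equiv_append_left[of n _ _ ?A]
      coxeter_equiv_append_right[of n "[j, i, j]" "[i, j, i]" ?B] by simp
  also have "coxeter_equiv n ((?A @ [i]) @ [j, i] @ ?B) ((i # ?A) @ [j, i] @ ?B)"
    using assms j
    by (intro coxeter_equiv_append_right coxeter_equiv_commute_word) (auto simp: set_coset_word)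
  finally show ?thesis by (simp add: split j)
qed

lemma coset_word_append_letter:
  assumes "m < n" "0 < k" "k \<le> Suc m" "0 < j" "j \<le> m"
  shows "\<exists>us l. set us \<subseteq> {1..<m} \<and> 0 < l \<and> l \<le> Suc m \<and>
    coxeter_equiv n (coset_word m k @ [j]) (us @ coset_word m l)"
proof -
  consider (far) "j < k - 1" | (extend) "k = Suc j" | (cancel) "j = k" | (shift) "k < j" by linarith
  then show ?thesis
  proof cases
    case far
    then have "coxeter_equiv n (coset_word m k @ [j]) (j # coset_word m k)"
      using assms by (intro coxeter_equiv_commute_word) (auto simp: set_coset_word)
    then show ?thesis using assms far by (intro exI[of _ "[j]"] exI[of _ k]) auto
  next
    case extend
    then show ?thesis using assms by (intro exI[of _ "[]"] exI[of _ j]) (simp add: coset_word_snoc)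
  next
    case cancel
    then have "coxeter_equiv n (coset_word m (Suc k) @ [k, k]) (coset_word m (Suc k) @ [])"
      using assms by (intro coxeter_equiv_append_left coxeter_equiv.cancel) auto
    then show ?thesis
      using assms cancel by (intro exI[of _ "[]"] exI[of _ "Suc k"]) (simp add: coset_word_snoc)
  next
    case shift
    then show ?thesis
      using assms coset_word_shift[of m n k j] by (intro exI[of _ "[j - 1]"] exI[of _ k]) auto
  qed
qed

lemma coxeter_normal_form:
  assumes "m < n" "set ws \<subseteq> {1..<Suc m}"
  shows "\<exists>us k. set us \<subseteq> {1..<m} \<and> 0 < k \<and> k \<le> Suc m \<and> coxeter_equiv n ws (us @ coset_word m k)"
  using assms(2)
proof (induction ws rule: rev_induct)
  case Nil
  then show ?case by (intro exI[of _ "[]"] exI[of _ "Suc m"]) auto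
next
  case (snoc j ws)
  then obtain us k where us: "set us \<subseteq> {1..<m}" "0 < k" "k \<le> Suc m"
    and ws: "coxeter_equiv n ws (us @ coset_word m k)" by auto
  obtain vs l where vs: "set vs \<subseteq> {1..<m}" "0 < l" "l \<le> Suc m"
    and letter: "coxeter_equiv n (coset_word m k @ [j]) (vs @ coset_word m l)"
    using coset_word_append_letter[OF assms(1) us(2,3), of j] snoc.prems by auto
  have "coxeter_equiv n (ws @ [j]) (us @ coset_word m k @ [j])"
    using coxeter_equiv_append_right[OF ws, of "[j]"] by simp
  also have "coxeter_equiv n (us @ coset_word m k @ [j]) (us @ vs @ coset_word m l)"
    using letter by (rule coxeter_equiv_append_left)
  finally show ?case using us vs by (intro exI[of _ "us @ vs"] exI[of _ l]) auto
qed

text \<open>The letter \<open>k\<close> of the normal form is the image of \<open>m + 1\<close>, so the normal form is unique.\<close>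

lemma coxeter_equiv_if_word_perm_eq:
  assumes "set us \<subseteq> {1..<n}" "set vs \<subseteq> {1..<n}" "word_perm us = word_perm vs"
  shows "coxeter_equiv n us vs"
proof -
  have "coxeter_equiv n us vs"
    if "m \<le> n" "set us \<subseteq> {1..<m}" "set vs \<subseteq> {1..<m}" "word_perm us = word_perm vs" for m us vs
    using that
  proof (induction m arbitrary: us vs)
    case (Suc m)
    obtain us' k where us': "set us' \<subseteq> {1..<m}" "0 < k" "k \<le> Suc m"
      "coxeter_equiv n us (us' @ coset_word m k)"
      using coxeter_normal_form[of m n us] Suc.prems by auto
    obtain vs' l where vs': "set vs' \<subseteq> {1..<m}" "0 < l" "l \<le> Suc m"
      "coxeter_equiv n vs (vs' @ coset_word m l)"
      using coxeter_normal_form[of m n vs] Suc.prems by auto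
    have us'_perm: "word_perm us = word_perm (coset_word m k) \<circ> word_perm us'"
      using coxeter_equiv_word_perm[OF us'(4)] by (simp add: word_perm_append)
    have vs'_perm: "word_perm vs = word_perm (coset_word m l) \<circ> word_perm vs'"
      using coxeter_equiv_word_perm[OF vs'(4)] by (simp add: word_perm_append)
    have "word_perm us (Suc m) = k" "word_perm vs (Suc m) = l"
      using us' vs' word_perm_permutes[of us' m] word_perm_permutes[of vs' m]
      by (simp_all add: us'_perm vs'_perm word_perm_coset_word permutes_not_in)
    then have "k = l" using Suc.prems(4) by simp
    then have "word_perm us' = word_perm vs'"
      using Suc.prems(4) inj_word_perm[of "coset_word m k"]
      by (simp add: us'_perm vs'_perm fun_eq_iff inj_eq)
    then have "coxeter_equiv n (us' @ coset_word m k) (vs' @ coset_word m k)"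
      using Suc.IH us'(1) vs'(1) Suc.prems(1) by (intro coxeter_equiv_append_right) simp
    then show ?case
      using us'(4) vs'(4) \<open>k = l\<close> by (metis coxeter_equiv.sym coxeter_equiv.trans)
  qed simp
  then show ?thesis using assms by blast
qed

locale coxeter_action =
  fixes N :: nat and S :: "nat \<Rightarrow> 'm \<Rightarrow> 'm" and M :: "'m set"
  assumes closed: "P \<in> M \<Longrightarrow> 0 < i \<Longrightarrow> i < N \<Longrightarrow> S i P \<in> M"
    and involutory: "P \<in> M \<Longrightarrow> 0 < i \<Longrightarrow> i < N \<Longrightarrow> S i (S i P) = P"
    and far_commute: "P \<in> M \<Longrightarrow> 0 < i \<Longrightarrow> Suc (Suc i) \<le> j \<Longrightarrow> j < N \<Longrightarrow> S i (S j P) = S j (S i P)"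
    and braid: "P \<in> M \<Longrightarrow> 0 < i \<Longrightarrow> Suc i < N \<Longrightarrow>
      S i (S (Suc i) (S i P)) = S (Suc i) (S i (S (Suc i) P))"
begin

lemma fold_closed: "P \<in> M \<Longrightarrow> set ws \<subseteq> {1..<N} \<Longrightarrow> fold S ws P \<in> M"
  by (induction ws arbitrary: P) (auto simp: closed Suc_le_eq)

lemma fold_eq_if_coxeter_equiv:
  "coxeter_equiv N us vs \<Longrightarrow> set us \<subseteq> {1..<N} \<Longrightarrow> P \<in> M \<Longrightarrow> fold S us P = fold S vs P"
proof (induction arbitrary: P rule: coxeter_equiv.induct)
  case (sym us vs)
  then show ?case using coxeter_equiv_letters[OF sym.hyps] by simp
next
  case (trans us vs ws)
  then show ?case using coxeter_equiv_letters[OF trans.hyps(1)] by simp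
next
  case (append us us' vs vs')
  then show ?case using fold_closed[of P us] by simp
next
  case (commute i j)
  then show ?case using far_commute[of P i j] by simp
qed (simp_all add: involutory braid)

lemma fold_eq_if_word_perm_eq:
  assumes "set us \<subseteq> {1..<N}" "set vs \<subseteq> {1..<N}" "word_perm us = word_perm vs" "P \<in> M"
  shows "fold S us P = fold S vs P"
  using coxeter_equiv_if_word_perm_eq[OF assms(1-3)] assms(1,4) by (rule fold_eq_if_coxeter_equiv)

end

section \<open>Ranks in finite linear orders\<close>

lemma card_below_less_iff:
  assumes "finite A" "irreflp_on A lt" "transp_on A lt" "totalp_on A lt" "p \<in> A" "q \<in> A"
  shows "card {x \<in> A. lt x p} < card {x \<in> A. lt x q} \<longleftrightarrow> lt p q"
proof -
  have mono: "card {x \<in> A. lt x p} < card {x \<in> A. lt x q}" if "p \<in> A" "q \<in> A" "lt p q" for p q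
  proof (rule psubset_card_mono)
    have "p \<in> {x \<in> A. lt x q} - {x \<in> A. lt x p}"
      using that assms(2) by (auto dest: irreflp_onD)
    then show "{x \<in> A. lt x p} \<subset> {x \<in> A. lt x q}"
      using that transp_onD[OF assms(3)] by blast
  qed (use assms(1) in simp)
  then show ?thesis
    using assms(5,6) mono[of p q] mono[of q p] totalp_onD[OF assms(4), of p q]
      irreflp_onD[OF assms(2), of p]
    by (cases "p = q") (auto dest: less_asym)
qed

lemma card_below_less_card:
  assumes "finite A" "irreflp_on A lt" "p \<in> A"
  shows "card {x \<in> A. lt x p} < card A"
  using assms by (intro psubset_card_mono) (auto dest: irreflp_onD)

lemma inj_on_card_below:
  assumes "finite A" "irreflp_on A lt" "transp_on A lt" "totalp_on A lt"
  shows "inj_on (\<lambda>p. card {x \<in> A. lt x p}) A"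
proof (rule inj_onI)
  fix p q assume "p \<in> A" "q \<in> A" and "card {x \<in> A. lt x p} = card {x \<in> A. lt x q}"
  then have "\<not> lt p q" "\<not> lt q p"
    using card_below_less_iff[OF assms, of p q] card_below_less_iff[OF assms, of q p] by auto
  then show "p = q" using assms(4) \<open>p \<in> A\<close> \<open>q \<in> A\<close> by (metis totalp_onD)
qed

lemma bij_betw_rank_from_top:
  assumes "finite A" "irreflp_on A lt" "transp_on A lt" "totalp_on A lt"
  shows "bij_betw (\<lambda>p. card A - card {x \<in> A. lt x p}) A {1..card A}"
proof (rule bij_betw_imageI)
  note less = card_below_less_card[OF assms(1,2)]
  show inj: "inj_on (\<lambda>p. card A - card {x \<in> A. lt x p}) A"
  proof (rule inj_onI)
    fix p q assume pq: "p \<in> A" "q \<in> A"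
      "card A - card {x \<in> A. lt x p} = card A - card {x \<in> A. lt x q}"
    then have "card {x \<in> A. lt x p} = card {x \<in> A. lt x q}" using less[of p] less[of q] by simp
    then show "p = q" by (rule inj_onD[OF inj_on_card_below[OF assms]]) (use pq in auto)
  qed
  show "(\<lambda>p. card A - card {x \<in> A. lt x p}) ` A = {1..card A}"
    using less by (intro card_subset_eq) (auto simp: card_image[OF inj] Suc_le_eq One_nat_def)
qed

lemma card_less_eq_sum_card_eq:
  fixes f :: "'a \<Rightarrow> nat"
  assumes "finite A"
  shows "card {x \<in> A. f x < t} = (\<Sum>j<t. card {x \<in> A. f x = j})"
proof (induction t)
  case (Suc t)
  have "{x \<in> A. f x < Suc t} = {x \<in> A. f x < t} \<union> {x \<in> A. f x = t}" by auto
  moreover have "card ({x \<in> A. f x < t} \<union> {x \<in> A. f x = t})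
      = card {x \<in> A. f x < t} + card {x \<in> A. f x = t}"
    using assms by (intro card_Un_disjoint) auto
  ultimately show ?case using Suc by simp
qed simp

lemma card_greater_inj:
  fixes a b :: "'a::linorder"
  assumes "finite A" "a \<in> A" "b \<in> A" "card {x \<in> A. a < x} = card {x \<in> A. b < x}"
  shows "a = b"
  using inj_on_card_below[of A "(>)"] assms
  by (simp add: inj_on_def irreflp_on_def transp_on_def totalp_on_def)

section \<open>Reverse standard tableaux\<close>

definition block_order ::
    "tab \<Rightarrow> (nat \<times> nat \<Rightarrow> nat) \<Rightarrow> (nat \<times> nat \<Rightarrow> nat) \<Rightarrow> nat \<times> nat \<Rightarrow> nat \<times> nat \<Rightarrow> bool" where
  "block_order T f g p q \<longleftrightarrow> T p < T q \<or> (T p = T q \<and> (f p < f q \<or> (f p = f q \<and> g p < g q)))"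

abbreviation column_order :: "tab \<Rightarrow> nat \<times> nat \<Rightarrow> nat \<times> nat \<Rightarrow> bool" where
  "column_order T \<equiv> block_order T snd fst"

abbreviation row_order :: "tab \<Rightarrow> nat \<times> nat \<Rightarrow> nat \<times> nat \<Rightarrow> bool" where
  "row_order T \<equiv> block_order T fst snd"

lemma column_order_linear:
  "irreflp_on A (column_order T)" "transp_on A (column_order T)" "totalp_on A (column_order T)"
  by (auto simp: irreflp_on_def transp_on_def totalp_on_def block_order_def)

locale shape =
  fixes lam :: "nat list" and N :: nat
  assumes partition: "partition_of lam N"
begin

lemma sum_list_lam: "sum_list lam = N"
  using partition by (simp add: partition_of_def)

lemma cells_down_closed:
  assumes "(r, c) \<in> cells lam" "1 \<le> r'" "r' \<le> r" "1 \<le> c'" "c' \<le> c"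
  shows "(r', c') \<in> cells lam"
proof -
  have "lam ! (r - 1) \<le> lam ! (r' - 1)"
  proof (cases "r' = r")
    case False
    then show ?thesis
      using partition assms
      by (auto simp: partition_of_def cells_def intro!: sorted_wrt_nth_less[of "(\<ge>)"])
  qed auto
  then show ?thesis using assms by (auto simp: cells_def)
qed

lemma cells_eq_Sigma: "cells lam = (SIGMA r:{1..length lam}. {1..lam ! (r - 1)})"
  by (auto simp: cells_def)

lemma finite_cells [simp]: "finite (cells lam)"
  by (auto simp: cells_eq_Sigma)

lemma card_cells: "card (cells lam) = N"
proof -
  have "card (cells lam) = (\<Sum>r\<in>{1..length lam}. lam ! (r - 1))"
    by (simp add: cells_eq_Sigma)
  also have "\<dots> = (\<Sum>r\<in>{0..<length lam}. lam ! r)"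
    by (rule sum.reindex_bij_witness[of _ Suc "\<lambda>r. r - 1"]) auto
  finally show ?thesis by (simp add: sum_list_sum_nth sum_list_lam[symmetric])
qed

abbreviation rst :: "tab \<Rightarrow> bool" where "rst \<equiv> is_rst lam"

lemma rst_outside: "rst \<tau> \<Longrightarrow> p \<notin> cells lam \<Longrightarrow> \<tau> p = 0"
  by (cases p) (simp add: is_rst_def)

lemma rst_bij: "rst \<tau> \<Longrightarrow> bij_betw \<tau> (cells lam) {1..N}"
  by (simp add: is_rst_def sum_list_lam)

lemma rst_range: "rst \<tau> \<Longrightarrow> p \<in> cells lam \<Longrightarrow> 1 \<le> \<tau> p \<and> \<tau> p \<le> N"
  using rst_bij[of \<tau>] by (auto simp: bij_betw_def)

lemma rst_cell:
  assumes "rst \<tau>" "1 \<le> a" "a \<le> N"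
  obtains r c where "(r, c) \<in> cells lam" "\<tau> (r, c) = a"
proof -
  have "a \<in> \<tau> ` cells lam" using rst_bij[OF assms(1)] assms by (auto simp: bij_betw_def)
  then show ?thesis using that by auto
qed

lemma rst_inj: "rst \<tau> \<Longrightarrow> p \<in> cells lam \<Longrightarrow> \<tau> q = \<tau> p \<Longrightarrow> q = p"
  using rst_bij[of \<tau>] rst_range[of \<tau> p] rst_outside[of \<tau> q]
  by (cases "q \<in> cells lam") (auto simp: bij_betw_def inj_on_def)

lemma CT_rst:
  assumes "rst \<tau>" "(r, c) \<in> cells lam"
  shows "CT \<tau> (\<tau> (r, c)) = int c - int r"
proof -
  have "(THE p. \<tau> p = \<tau> (r, c)) = (r, c)"
    using assms by (intro the_equality) (auto dest: rst_inj)
  then show ?thesis by (simp add: CT_def)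
qed

lemma rst_antimono:
  assumes "rst \<tau>" "(r, c) \<in> cells lam" "(r', c') \<in> cells lam" "r \<le> r'" "c \<le> c'"
  shows "\<tau> (r', c') \<le> \<tau> (r, c)"
proof -
  have corner: "(r, c') \<in> cells lam"
    by (rule cells_down_closed[OF assms(3)]) (use assms in \<open>auto simp: cells_def\<close>)
  have "\<tau> (r', c') \<le> \<tau> (r, c')"
    using assms corner by (cases "r = r'") (auto simp: is_rst_def less_imp_le)
  also have "\<dots> \<le> \<tau> (r, c)"
    using assms corner by (cases "c = c'") (auto simp: is_rst_def less_imp_le)
  finally show ?thesis .
qed

lemma rst_strict_antimono:
  assumes "rst \<tau>" "(r, c) \<in> cells lam" "(r', c') \<in> cells lam" "r \<le> r'" "c \<le> c'" "(r, c) \<noteq> (r', c')"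
  shows "\<tau> (r', c') < \<tau> (r, c)"
  using rst_antimono[OF assms(1-5)] rst_inj[OF assms(1,2), of "(r', c')"] assms(6) by force

lemma rst_consecutive_cells:
  assumes "rst \<tau>" "(r, c) \<in> cells lam" "(r', c') \<in> cells lam" "\<tau> (r', c') = Suc (\<tau> (r, c))"
  shows "(r < r' \<and> c' < c) \<or> (r' < r \<and> c < c') \<or> (r' = r \<and> c = Suc c') \<or> (c' = c \<and> r = Suc r')"
proof -
  have positive: "1 \<le> r'" "1 \<le> c'" using assms by (auto simp: cells_def)
  have between: "(x, y) = (r, c) \<or> (x, y) = (r', c')"
    if "r' \<le> x" "x \<le> r" "c' \<le> y" "y \<le> c" for x y
  proof -
    have cell: "(x, y) \<in> cells lam"
      by (rule cells_down_closed[OF assms(2)]) (use that positive in auto)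
    have "\<tau> (r, c) \<le> \<tau> (x, y)" "\<tau> (x, y) \<le> \<tau> (r', c')"
      using rst_antimono[OF assms(1) cell assms(2)] rst_antimono[OF assms(1,3) cell] that by auto
    then have "\<tau> (x, y) = \<tau> (r, c) \<or> \<tau> (x, y) = \<tau> (r', c')" using assms by auto
    then show ?thesis using rst_inj assms by blast
  qed
  have "r' < r \<or> c' < c" using rst_antimono[OF assms(1-3)] assms(4) by force
  moreover have "\<not> (r' < r \<and> c' < c)" using between[of r' c] by auto
  moreover have "r = Suc r'" if "r' < r" "c' = c" using between[of "Suc r'" c] that by auto
  moreover have "c = Suc c'" if "c' < c" "r' = r" using between[of r "Suc c'"] that by auto
  ultimately show ?thesis by linarith
qed

lemma axial_distance_cells:
  assumes "rst \<tau>" "(r, c) \<in> cells lam" "(r', c') \<in> cells lam" "\<tau> (r', c') = Suc (\<tau> (r, c))"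
  shows "axial_distance (\<tau> (r, c)) \<tau> = int c - int r - (int c' - int r')"
  using CT_rst[OF assms(1,2)] CT_rst[OF assms(1,3)] assms(4) by (simp add: axial_distance_def)

lemma axial_distance_cases:
  assumes "rst \<tau>" "(r, c) \<in> cells lam" "(r', c') \<in> cells lam" "\<tau> (r', c') = Suc (\<tau> (r, c))"
  obtains "2 \<le> axial_distance (\<tau> (r, c)) \<tau>" "r < r'" "c' < c"
    | "axial_distance (\<tau> (r, c)) \<tau> \<le> -2" "r' < r" "c < c'"
    | "axial_distance (\<tau> (r, c)) \<tau> = 1" "r' = r" "c = Suc c'"
    | "axial_distance (\<tau> (r, c)) \<tau> = -1" "c' = c" "r = Suc r'"
proof -
  note distance = axial_distance_cells[OF assms]
  consider "r < r'" "c' < c" | "r' < r" "c < c'" | "r' = r" "c = Suc c'" | "c' = c" "r = Suc r'"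
    using rst_consecutive_cells[OF assms] by blast
  then show ?thesis
    by cases (use distance in \<open>auto intro: that\<close>)
qed

lemma axial_distance_trichotomy:
  assumes "rst \<tau>" "1 \<le> a" "a < N"
  shows "2 \<le> axial_distance a \<tau> \<or> axial_distance a \<tau> \<le> -2 \<or> \<bar>axial_distance a \<tau>\<bar> = 1"
proof -
  obtain r c where a: "(r, c) \<in> cells lam" "\<tau> (r, c) = a"
    using rst_cell[of \<tau> a] assms by auto
  moreover obtain r' c' where "(r', c') \<in> cells lam" "\<tau> (r', c') = Suc a"
    using rst_cell[of \<tau> "Suc a"] assms by auto
  ultimately show ?thesis
    by (cases rule: axial_distance_cases[OF assms(1), of r c r' c']) auto
qed

lemma axial_distance_two_steps:
  assumes "rst \<tau>" "1 \<le> a" "Suc a < N"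
  shows "axial_distance a \<tau> + axial_distance (Suc a) \<tau> \<noteq> 0"
proof
  assume cancel: "axial_distance a \<tau> + axial_distance (Suc a) \<tau> = 0"
  obtain r c where p: "(r, c) \<in> cells lam" "\<tau> (r, c) = a"
    using rst_cell[of \<tau> a] assms by auto
  obtain r' c' where q: "(r', c') \<in> cells lam" "\<tau> (r', c') = Suc (Suc a)"
    using rst_cell[of \<tau> "Suc (Suc a)"] assms by auto
  have "int c - int r = int c' - int r'"
    using CT_rst[OF assms(1) p(1)] CT_rst[OF assms(1) q(1)] p q cancel
    by (simp add: axial_distance_def)
  moreover have "\<not> (r \<le> r' \<and> c \<le> c')" using rst_antimono[OF assms(1) p(1) q(1)] p q by auto
  ultimately have strictly_below: "r' < r" "c' < c" by linarith+
  have positive: "1 \<le> r'" "1 \<le> c'" using q by (auto simp: cells_def)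
  have corners: "(r', c) \<in> cells lam" "(r, c') \<in> cells lam"
    using strictly_below positive by (auto intro: cells_down_closed[OF p(1)])
  have "\<tau> (x, y) = Suc a" if "(x, y) \<in> {(r', c), (r, c')}" for x y
    using that strictly_below p q rst_strict_antimono[OF assms(1) q(1), of x y]
      rst_strict_antimono[OF assms(1) _ p(1), of x y] corners
    by force
  then have "\<tau> (r', c) = \<tau> (r, c')" by simp
  then show False using rst_inj[OF assms(1) corners(2), of "(r', c)"] strictly_below by auto
qed

lemma rst_interchange:
  assumes "rst \<tau>" "1 \<le> a" "a < N" "2 \<le> \<bar>axial_distance a \<tau>\<bar>"
  shows "rst (interchange a \<tau>)"
proof -
  have decreasing: "interchange a \<tau> (r', c') < interchange a \<tau> (r, c)"
    if cells: "(r, c) \<in> cells lam" "(r', c') \<in> cells lam"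
      and componentwise: "r \<le> r'" "c \<le> c'" "(r, c) \<noteq> (r', c')" for r c r' c'
  proof -
    have "\<not> (\<tau> (r, c) = Suc a \<and> \<tau> (r', c') = a)"
    proof
      assume "\<tau> (r, c) = Suc a \<and> \<tau> (r', c') = a"
      then show False
        using assms(4) componentwise
        by (cases rule: axial_distance_cases[OF assms(1) cells(2,1)]) auto
    qed
    then show ?thesis
      using rst_strict_antimono[OF assms(1) cells componentwise]
      by (auto simp: interchange_eq transpose_def)
  qed
  have "transpose a (Suc a) permutes {1..N}" using assms by (intro permutes_swap_id) auto
  then have "bij_betw (interchange a \<tau>) (cells lam) {1..N}"
    unfolding interchange_eq
    using rst_bij[OF assms(1)] permutes_imp_bij by (blast intro: bij_betw_trans)
  then show ?thesis
    unfolding is_rst_def sum_list_lam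
    using decreasing rst_outside[OF assms(1)] assms(2) by (auto simp: interchange_eq transpose_def)
qed

lemma greater_on_diagonal:
  assumes "rst \<tau>" "(r, c) \<in> cells lam"
  shows "{a \<in> {1..N}. CT \<tau> a = int c - int r \<and> \<tau> (r, c) < a}
    = \<tau> ` {q \<in> cells lam. int (snd q) - int (fst q) = int c - int r \<and> fst q < r}"
proof (intro equalityI subsetI)
  fix a assume a: "a \<in> {a \<in> {1..N}. CT \<tau> a = int c - int r \<and> \<tau> (r, c) < a}"
  then obtain r' c' where q: "(r', c') \<in> cells lam" "\<tau> (r', c') = a"
    using rst_cell[OF assms(1), of a] by auto
  then have diagonal: "int c' - int r' = int c - int r" using CT_rst[OF assms(1) q(1)] a by auto
  have "\<not> (r \<le> r' \<and> c \<le> c')" using rst_antimono[OF assms q(1)] q(2) a by auto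
  then have "r' < r" using diagonal by linarith
  then show "a \<in> \<tau> ` {q \<in> cells lam. int (snd q) - int (fst q) = int c - int r \<and> fst q < r}"
    using q diagonal by force
next
  fix a assume "a \<in> \<tau> ` {q \<in> cells lam. int (snd q) - int (fst q) = int c - int r \<and> fst q < r}"
  then obtain r' c' where "(r', c') \<in> cells lam" "\<tau> (r', c') = a"
    "int c' - int r' = int c - int r" "r' < r"
    by auto
  then show "a \<in> {a \<in> {1..N}. CT \<tau> a = int c - int r \<and> \<tau> (r, c) < a}"
    using rst_strict_antimono[OF assms(1) _ assms(2), of r' c'] CT_rst[OF assms(1), of r' c']
      rst_range[OF assms(1), of "(r', c')"] by auto
qed

lemma rst_eqI_CT:
  assumes "rst \<tau>" "rst \<tau>'" and contents: "\<And>a. 1 \<le> a \<Longrightarrow> a \<le> N \<Longrightarrow> CT \<tau> a = CT \<tau>' a"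
  shows "\<tau> = \<tau>'"
proof
  fix p
  show "\<tau> p = \<tau>' p"
  proof (cases "p \<in> cells lam")
    case True
    obtain r c where p: "p = (r, c)" by fastforce
    define D where "D = {q \<in> cells lam. int (snd q) - int (fst q) = int c - int r \<and> fst q < r}"
    define A where "A = {a \<in> {1..N}. CT \<tau> a = int c - int r}"
    have A_eq: "A = {a \<in> {1..N}. CT \<tau>' a = int c - int r}" unfolding A_def using contents by auto
    have rank: "card {a \<in> {1..N}. CT \<sigma> a = int c - int r \<and> \<sigma> p < a} = card D" if "rst \<sigma>" for \<sigma>
    proof -
      have "inj_on \<sigma> D"
        using rst_bij[OF that] by (auto simp: bij_betw_def D_def intro: inj_on_subset)
      then show ?thesis
        unfolding p greater_on_diagonal[OF that True[unfolded p]] D_def[symmetric]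
        by (rule card_image)
    qed
    have member: "\<sigma> p \<in> {a \<in> {1..N}. CT \<sigma> a = int c - int r}" if "rst \<sigma>" for \<sigma>
      using True rst_range[OF that True] CT_rst[OF that] by (simp add: p)
    have "card {a \<in> A. \<tau> p < a} = card D"
      using rank[OF assms(1)] by (simp add: A_def conj_assoc)
    moreover have "card {a \<in> A. \<tau>' p < a} = card D"
      using rank[OF assms(2)] by (simp add: A_eq conj_assoc)
    ultimately have card: "card {a \<in> A. \<tau> p < a} = card {a \<in> A. \<tau>' p < a}" by simp
    have "\<tau> p \<in> A" "\<tau>' p \<in> A"
      using member[OF assms(1)] member[OF assms(2)] A_eq unfolding A_def by auto
    moreover have "finite A" by (simp add: A_def)
    ultimately show ?thesis using card by (auto intro: card_greater_inj)
  qed (simp add: rst_outside assms(1,2))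
qed

lemma rst_eq_card_greater:
  assumes "rst \<tau>" "p \<in> cells lam"
  shows "\<tau> p = N - card {q \<in> cells lam. \<tau> p < \<tau> q}"
proof -
  have image: "\<tau> ` cells lam = {1..N}" and inj: "inj_on \<tau> (cells lam)"
    using rst_bij[OF assms(1)] by (auto simp: bij_betw_def)
  have "\<tau> ` {q \<in> cells lam. \<tau> p < \<tau> q} = {a \<in> \<tau> ` cells lam. \<tau> p < a}" by auto
  also have "\<dots> = {\<tau> p<..N}" unfolding image using rst_range[OF assms] by auto
  finally have "card {q \<in> cells lam. \<tau> p < \<tau> q} = N - \<tau> p"
    using card_image[OF inj_on_subset[OF inj], of "{q \<in> cells lam. \<tau> p < \<tau> q}"] by simp
  then show ?thesis using rst_range[OF assms] by simp
qed

lemma rst_eqI_order: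
  assumes "rst \<tau>" "rst \<tau>'"
    and "\<And>p q. p \<in> cells lam \<Longrightarrow> q \<in> cells lam \<Longrightarrow> \<tau> q < \<tau> p \<longleftrightarrow> \<tau>' q < \<tau>' p"
  shows "\<tau> = \<tau>'"
proof
  fix p
  show "\<tau> p = \<tau>' p"
  proof (cases "p \<in> cells lam")
    case True
    then have "{q \<in> cells lam. \<tau> p < \<tau> q} = {q \<in> cells lam. \<tau>' p < \<tau>' q}"
      using assms(3) by blast
    then show ?thesis
      using rst_eq_card_greater[OF assms(1) True] rst_eq_card_greater[OF assms(2) True] by simp
  qed (simp add: rst_outside assms(1,2))
qed

lemma finite_rst: "finite {\<tau>. rst \<tau>}"
proof (rule finite_subset)
  show "{\<tau>. rst \<tau>} \<subseteq> {f. \<forall>x. (x \<in> cells lam \<longrightarrow> f x \<in> {1..N}) \<and> (x \<notin> cells lam \<longrightarrow> f x = 0)}"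
    using rst_range rst_outside by auto
  show "finite {f :: tab. \<forall>x. (x \<in> cells lam \<longrightarrow> f x \<in> {1..N}) \<and> (x \<notin> cells lam \<longrightarrow> f x = 0)}"
    by (rule finite_set_of_finite_funs) auto
qed

lemma tau_shape_eq_rank:
  assumes "p \<in> cells lam"
  shows "tau_shape lam p = card (cells lam) - card {q \<in> cells lam. column_order (\<lambda>_. 0) q p}"
proof -
  have "{(r', c') \<in> cells lam. c' < snd p \<or> c' = snd p \<and> r' < fst p}
      = {q \<in> cells lam. column_order (\<lambda>_. 0) q p}"
    by (auto simp: block_order_def)
  then show ?thesis using assms by (cases p) (simp add: tau_shape_def sum_list_lam card_cells)
qed

lemma tau_shape_less_iff:
  assumes "p \<in> cells lam" "q \<in> cells lam"
  shows "tau_shape lam q < tau_shape lam p \<longleftrightarrow> column_order (\<lambda>_. 0) p q"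
proof -
  note less = card_below_less_card[OF finite_cells column_order_linear(1), of _ "\<lambda>_. 0"]
  show ?thesis
    using less[OF assms(1)] less[OF assms(2)]
    unfolding card_below_less_iff[OF finite_cells column_order_linear assms, symmetric]
    by (auto simp: assms tau_shape_eq_rank)
qed

lemma rst_tau_shape: "rst (tau_shape lam)"
  unfolding is_rst_def sum_list_lam
proof (intro conjI allI impI)
  show "bij_betw (tau_shape lam) (cells lam) {1..N}"
    using bij_betw_rank_from_top[OF finite_cells column_order_linear, of "\<lambda>_. 0",
        unfolded card_cells]
    by (simp add: tau_shape_eq_rank card_cells cong: bij_betw_cong)
  show "tau_shape lam p = 0" if "p \<notin> cells lam" for p
    using that by (cases p) (simp add: tau_shape_def)
qed (auto simp: tau_shape_less_iff block_order_def)

section \<open>The module of tableau-valued polynomials\<close>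

definition rst_module :: "tabpol set" where
  "rst_module = {P. \<forall>\<tau>\<in>keys P. rst \<tau>}"

lemma subspace_rst_module: "smul.subspace rst_module"
  by (auto simp: smul.subspace_def rst_module_def in_keys_iff lookup_add)

lemmas rst_module_add = smul.subspace_add[OF subspace_rst_module]
lemmas rst_module_smul = smul.subspace_scale[OF subspace_rst_module]
lemmas rst_module_sum = smul.subspace_sum[OF subspace_rst_module]

lemma rst_module_single: "rst \<tau> \<Longrightarrow> single \<tau> f \<in> rst_module"
  by (simp add: rst_module_def)

lemma rst_module_pmul: "P \<in> rst_module \<Longrightarrow> pmul f P \<in> rst_module"
  by (auto simp: rst_module_def in_keys_iff)

lemma rst_module_diag_s:
  assumes "P \<in> rst_module" "0 < i" "i < N"
  shows "diag_s i P \<in> rst_module"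
proof -
  have single: "diag_s i (single \<tau> f) \<in> rst_module" if "rst \<tau>" for \<tau> f
  proof -
    have "rst (interchange i \<tau>) \<or> seminormal_coeff (axial_distance i \<tau>) = 0"
      using axial_distance_trichotomy[OF that, of i] rst_interchange[OF that, of i] assms
      by (auto simp: seminormal_coeff_def)
    then show ?thesis
      unfolding diag_s_single using that
      by (elim disjE) (simp_all add: rst_module_add rst_module_smul rst_module_single)
  qed
  have "diag_s i P = (\<Sum>\<tau>\<in>keys P. diag_s i (single \<tau> (lookup P \<tau>)))"
    unfolding diag_s.sum[symmetric] sum_single_keys ..
  also have "\<dots> \<in> rst_module"
    using assms(1) by (intro rst_module_sum single) (simp add: rst_module_def)
  finally show ?thesis .
qed

lemma diag_s_braid:
  assumes "P \<in> rst_module" "0 < i" "Suc i < N"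
  shows "diag_s i (diag_s (Suc i) (diag_s i P)) = diag_s (Suc i) (diag_s i (diag_s (Suc i) P))"
proof (rule additive_eqI_keys[where F = "\<lambda>P. diag_s i (diag_s (Suc i) (diag_s i P))"
      and G = "\<lambda>P. diag_s (Suc i) (diag_s i (diag_s (Suc i) P))"])
  fix \<tau> f assume "\<tau> \<in> keys P"
  then have "rst \<tau>" using assms by (simp add: rst_module_def)
  then show "diag_s i (diag_s (Suc i) (diag_s i (single \<tau> f)))
      = diag_s (Suc i) (diag_s i (diag_s (Suc i) (single \<tau> f)))"
    using axial_distance_trichotomy[of \<tau> i] axial_distance_trichotomy[of \<tau> "Suc i"]
      axial_distance_two_steps[of \<tau> i] assms
    by (intro diag_s_braid_single) auto
qed (simp_all add: additive_def diag_s.add)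

sublocale diag_s: coxeter_action N diag_s rst_module
  by unfold_locales (rule rst_module_diag_s diag_s_involutory diag_s_commute diag_s_braid;
    assumption)+

end

section \<open>Standardization of vectors\<close>

definition precedes_in :: "nat list \<Rightarrow> nat \<Rightarrow> nat \<Rightarrow> bool" where
  "precedes_in v j i \<longleftrightarrow> entry v i < entry v j \<or> (entry v j = entry v i \<and> j < i)"

lemma precedes_in_linear:
  "irreflp_on A (precedes_in v)" "transp_on A (precedes_in v)" "totalp_on A (precedes_in v)"
  by (auto simp: irreflp_on_def transp_on_def totalp_on_def precedes_in_def)

lemma sigma_eq_rank:
  assumes "i \<in> {1..length v}"
  shows "sigma v i = Suc (card {j \<in> {1..length v}. precedes_in v j i})"
proof -
  have "Suc (card {j \<in> {1..length v}. precedes_in v j i})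
      = card (insert i {j \<in> {1..length v}. precedes_in v j i})"
    by (simp add: precedes_in_def)
  also have "insert i {j \<in> {1..length v}. precedes_in v j i}
      = {j \<in> {1..length v}. entry v i < entry v j} \<union> {j \<in> {1..i}. entry v j = entry v i}"
    using assms by (auto simp: precedes_in_def)
  also have "card \<dots> = sigma v i"
    unfolding sigma_def by (subst card_Un_disjoint) auto
  finally show ?thesis by simp
qed

lemma sigma_less_iff:
  assumes "i \<in> {1..length v}" "j \<in> {1..length v}"
  shows "sigma v j < sigma v i \<longleftrightarrow> precedes_in v j i"
  using card_below_less_iff[OF finite_atLeastAtMost precedes_in_linear assms(2,1)] assms
  by (simp add: sigma_eq_rank)

lemma bij_betw_sigma: "bij_betw (sigma v) {1..length v} {1..length v}"
proof (rule bij_betw_imageI)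
  show inj: "inj_on (sigma v) {1..length v}"
    using inj_on_card_below[OF finite_atLeastAtMost precedes_in_linear, of 1 "length v" v]
    by (simp add: inj_on_def sigma_eq_rank)
  have "sigma v ` {1..length v} \<subseteq> {1..length v}"
    using card_below_less_card[OF finite_atLeastAtMost precedes_in_linear(1), of _ 1 "length v" v]
    by (auto simp: sigma_eq_rank Suc_le_eq One_nat_def)
  then show "sigma v ` {1..length v} = {1..length v}"
    using inj by (intro endo_inj_surj) simp_all
qed

lemma sigma_range: "1 \<le> i \<Longrightarrow> i \<le> length v \<Longrightarrow> 1 \<le> sigma v i \<and> sigma v i \<le> length v"
  using bij_betw_apply[OF bij_betw_sigma, of i v] by simp

lemma sigma_eq_iff:
  assumes "i \<in> {1..length v}" "j \<in> {1..length v}"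
  shows "sigma v i = sigma v j \<longleftrightarrow> i = j"
  using inj_on_eq_iff[OF bij_betw_imp_inj_on[OF bij_betw_sigma] assms] .

lemma sigma_Suc:
  assumes "1 \<le> i" "i < length v" "entry v i = entry v (Suc i)"
  shows "sigma v (Suc i) = Suc (sigma v i)"
proof -
  have "{j \<in> {1..length v}. precedes_in v j (Suc i)}
      = insert i {j \<in> {1..length v}. precedes_in v j i}"
    using assms by (auto simp: precedes_in_def less_Suc_eq)
  then show ?thesis using assms by (simp add: sigma_eq_rank precedes_in_def)
qed

lemma sigma_reindex:
  assumes "length w = length v" "bij_betw t {1..length v} {1..length v}" "k \<in> {1..length v}"
    and "\<And>j. j \<in> {1..length v} \<Longrightarrow> precedes_in v (t j) (t k) \<longleftrightarrow> precedes_in w j k"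
  shows "sigma w k = sigma v (t k)"
proof -
  have "bij_betw t {j \<in> {1..length v}. precedes_in w j k}
      {j \<in> {1..length v}. precedes_in v j (t k)}"
    using assms(2,4) by (rule bij_betw_Collect)
  then show ?thesis
    using assms(1,3) bij_betw_apply[OF assms(2,3)] by (simp add: sigma_eq_rank bij_betw_same_card)
qed

lemma entry_replicate [simp]: "1 \<le> k \<Longrightarrow> k \<le> n \<Longrightarrow> entry (replicate n x) k = x"
  by (cases k) auto

lemma sigma_replicate:
  assumes "1 \<le> k" "k \<le> n"
  shows "sigma (replicate n x) k = k"
proof -
  have "{j \<in> {1..n}. precedes_in (replicate n x) j k} = {1..<k}"
    using assms by (auto simp: precedes_in_def)
  then show ?thesis using assms by (simp add: sigma_eq_rank)
qed

lemma transpose_Suc_in_range_iff: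
  "1 \<le> i \<Longrightarrow> i < n \<Longrightarrow> 1 \<le> transpose i (Suc i) k \<and> transpose i (Suc i) k \<le> n \<longleftrightarrow> 1 \<le> k \<and> k \<le> n"
  by (auto simp: transpose_def)

lemma transpose_Suc_strict_mono:
  "j < k \<Longrightarrow> (j, k) \<noteq> (i, Suc i) \<Longrightarrow> transpose i (Suc i) j < transpose i (Suc i) k"
  by (auto simp: transpose_def)

lemma length_vswap [simp]: "length (vswap i v) = length v"
  by (simp add: vswap_def)

lemma entry_vswap:
  assumes "1 \<le> i" "i < length v" "1 \<le> k" "k \<le> length v"
  shows "entry (vswap i v) k = entry v (transpose i (Suc i) k)"
  using assms by (auto simp: vswap_def nth_list_update transpose_def)

lemma sigma_vswap:
  assumes "1 \<le> i" "i < length v" "1 \<le> k" "k \<le> length v" "entry v i \<noteq> entry v (Suc i)"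
  shows "sigma (vswap i v) k = sigma v (transpose i (Suc i) k)"
proof (rule sigma_reindex)
  let ?t = "transpose i (Suc i)"
  fix j assume "j \<in> {1..length v}"
  then have entries: "entry (vswap i v) j = entry v (?t j)" "entry (vswap i v) k = entry v (?t k)"
    using assms by (auto intro: entry_vswap)
  have "j < k \<longleftrightarrow> ?t j < ?t k" if "entry v (?t j) = entry v (?t k)"
    using that assms(5) by (auto simp: transpose_def split: if_splits)
  then show "precedes_in v (?t j) (?t k) \<longleftrightarrow> precedes_in (vswap i v) j k"
    unfolding precedes_in_def entries by auto
qed (use assms in auto)

lemma length_vpsi [simp]: "v \<noteq> [] \<Longrightarrow> length (vpsi v) = length v"
  by (simp add: vpsi_def)

lemma entry_vpsi:
  assumes "v \<noteq> []" "1 \<le> k" "k \<le> length v"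
  shows "entry (vpsi v) k = (if k = length v then Suc (entry v 1) else entry v (Suc k))"
  using assms by (cases v) (auto simp: vpsi_def nth_append)

lemma sigma_vpsi:
  assumes "v \<noteq> []" "1 \<le> k" "k \<le> length v"
  shows "sigma (vpsi v) k = sigma v (if k = length v then 1 else Suc k)"
proof (rule sigma_reindex[where t = "\<lambda>k. if k = length v then 1 else Suc k"])
  show "bij_betw (\<lambda>k. if k = length v then 1 else Suc k) {1..length v} {1..length v}"
    using assms
    by (intro bij_betw_byWitness[where f' = "\<lambda>k. if k = 1 then length v else k - 1"]) auto
  fix j assume "j \<in> {1..length v}"
  then show "precedes_in v (if j = length v then 1 else Suc j) (if k = length v then 1 else Suc k)
      \<longleftrightarrow> precedes_in (vpsi v) j k"
    using assms by (auto simp: precedes_in_def entry_vpsi)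
qed (use assms in auto)

lemma sorted_iff_entries: "sorted v \<longleftrightarrow> (\<forall>k. 1 \<le> k \<and> k < length v \<longrightarrow> entry v k \<le> entry v (Suc k))"
proof
  assume sorted: "\<forall>k. 1 \<le> k \<and> k < length v \<longrightarrow> entry v k \<le> entry v (Suc k)"
  show "sorted v"
    unfolding sorted_iff_nth_Suc
  proof (intro allI impI)
    fix i assume "Suc i < length v"
    then show "v ! i \<le> v ! Suc i" using sorted[rule_format, of "Suc i"] by simp
  qed
qed (auto intro: sorted_nth_mono)

lemma sorted_zero_last:
  assumes "sorted v" "v \<noteq> [] \<Longrightarrow> last v = 0"
  shows "v = replicate (length v) (0::nat)"
proof -
  have "x = 0" if "x \<in> set v" for x
    using that assms by (cases v rule: rev_cases) (auto simp: sorted_append)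
  then show ?thesis by (metis replicate_length_same)
qed

lemma image_mset_entry: "image_mset (entry v) (mset_set {1..length v}) = mset v"
proof -
  have "{1..length v} = Suc ` {0..<length v}"
    by (simp add: image_Suc_atLeastLessThan atLeastLessThanSuc_atLeastAtMost One_nat_def)
  then have "mset_set {1..length v} = image_mset Suc (mset_set {0..<length v})"
    by (simp add: image_mset_mset_set)
  then have "image_mset (entry v) (mset_set {1..length v}) = mset (map ((!) v) [0..<length v])"
    by (simp add: multiset.map_comp o_def)
  then show ?thesis by (simp only: map_nth)
qed

lemma vplus_eqI:
  assumes "mset w = mset v" "sorted (rev w)"
  shows "vplus v = w"
  using properties_for_sort[of "rev w" v] assms by (simp add: vplus_def)

lemma vplus_sigma:
  assumes "1 \<le> k" "k \<le> length v"
  shows "entry (vplus v) (sigma v k) = entry v k"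
proof -
  let ?n = "length v"
  define g where "g = inv_into {1..?n} (sigma v)"
  define w where "w = map (\<lambda>a. entry v (g (Suc a))) [0..<?n]"
  have bij_g: "bij_betw g {1..?n} {1..?n}"
    unfolding g_def by (rule bij_betw_inv_into[OF bij_betw_sigma])
  have sigma_g: "sigma v (g a) = a" if "a \<in> {1..?n}" for a
    using bij_betw_inv_into_right[OF bij_betw_sigma that] by (simp add: g_def)
  have g_range: "g a \<in> {1..?n}" if "a \<in> {1..?n}" for a
    using bij_betw_apply[OF bij_g that] .
  have entry_w: "entry w a = entry v (g a)" if "a \<in> {1..?n}" for a
    using that by (auto simp: w_def)
  have "mset w = image_mset (entry w) (mset_set {1..?n})"
    using image_mset_entry[of w] by (simp add: w_def)
  also have "\<dots> = image_mset (entry v) (image_mset g (mset_set {1..?n}))"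
    unfolding multiset.map_comp by (rule image_mset_cong) (simp add: entry_w)
  also have "image_mset g (mset_set {1..?n}) = mset_set {1..?n}"
    using bij_g by (simp add: image_mset_mset_set bij_betw_def)
  finally have "mset w = mset v" by (simp add: image_mset_entry)
  moreover have "sorted (rev w)"
    unfolding sorted_rev_iff_nth_Suc
  proof (intro allI impI)
    fix i assume i: "Suc i < length w"
    then have range: "Suc i \<in> {1..?n}" "Suc (Suc i) \<in> {1..?n}" by (auto simp: w_def)
    then have "precedes_in v (g (Suc i)) (g (Suc (Suc i)))"
      unfolding sigma_less_iff[OF g_range g_range, OF range(2,1), symmetric]
      by (simp add: sigma_g del: atLeastAtMost_iff)
    then show "w ! Suc i \<le> w ! i" using i by (auto simp: w_def precedes_in_def)
  qed
  ultimately have "vplus v = w" by (rule vplus_eqI)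
  moreover have "g (sigma v k) = k"
    using assms bij_betw_inv_into_left[OF bij_betw_sigma, of k v] by (simp add: g_def)
  ultimately show ?thesis using assms sigma_range[of k v] entry_w by simp
qed

lemma vplus_antimono:
  assumes "1 \<le> a" "a \<le> b" "b \<le> length v"
  shows "entry (vplus v) b \<le> entry (vplus v) a"
  using assms sorted_nth_mono[of "sort v" "length v - b" "length v - a"]
  by (auto simp: vplus_def rev_nth)

section \<open>Spectral labels of vertices\<close>

text \<open>The value outside the range of positions is arbitrary; it makes the edges act on labels by
  composition with transpositions.\<close>

definition label :: "vertex \<Rightarrow> nat \<Rightarrow> nat \<times> int" where
  "label u k = (if 1 \<le> k \<and> k \<le> length (snd u)
     then (entry (snd u) k, CT (fst u) (sigma (snd u) k)) else (0, 0))"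

definition spectral :: "nat \<times> int \<Rightarrow> qalpha" where
  "spectral x = alpha * of_nat (fst x) + of_int (snd x)"

abbreviation spec :: "vertex \<Rightarrow> nat \<Rightarrow> qalpha" where
  "spec u k \<equiv> spectral (label u k)"

lemma zeta_eq_spectral: "1 \<le> k \<Longrightarrow> k \<le> length v \<Longrightarrow> zeta \<tau> v k = spec (\<tau>, v) k"
  by (simp add: zeta_def spectral_def label_def)

lemma spectral_lower: "0 < fst x \<Longrightarrow> spectral (fst x - 1, snd x) = spectral x - alpha"
  by (simp add: spectral_def of_nat_diff algebra_simps)

lemma spectral_diff_eq_of_int_iff:
  "spectral x - spectral y = of_int m \<longleftrightarrow> fst x = fst y \<and> snd x - snd y = m"
proof -
  have "spectral x - spectral y = of_int m \<longleftrightarrow>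
    alpha * of_int (int (fst x) - int (fst y)) + of_int (snd x - snd y - m) = 0"
    by (simp add: spectral_def algebra_simps)
  then show ?thesis unfolding alpha_lincomb_eq_0_iff by auto
qed

text \<open>Exchanging neighbouring labels \<open>x\<close>, \<open>y\<close> is an edge of the graph precisely if \<open>x \<sqsubset> y\<close>; if they
  are adjacent, there is an edge to \<open>\<emptyset>\<close>.\<close>

definition label_less :: "nat \<times> int \<Rightarrow> nat \<times> int \<Rightarrow> bool" (infix \<open>\<sqsubset>\<close> 50) where
  "x \<sqsubset> y \<longleftrightarrow> fst x < fst y \<or> (fst x = fst y \<and> 2 \<le> snd x - snd y)"

definition label_adjacent :: "nat \<times> int \<Rightarrow> nat \<times> int \<Rightarrow> bool" where
  "label_adjacent x y \<longleftrightarrow> fst x = fst y \<and> \<bar>snd x - snd y\<bar> = 1"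

lemma label_less_trans: "x \<sqsubset> y \<Longrightarrow> y \<sqsubset> z \<Longrightarrow> x \<sqsubset> z"
  by (auto simp: label_less_def)

lemma label_less_asym: "x \<sqsubset> y \<Longrightarrow> \<not> y \<sqsubset> x"
  by (auto simp: label_less_def)

lemma spectral_diff_label_less:
  assumes "x \<sqsubset> y"
  shows "spectral y - spectral x \<notin> {-1, 0, 1}"
  using assms spectral_diff_eq_of_int_iff[of y x "-1"] spectral_diff_eq_of_int_iff[of y x 0]
    spectral_diff_eq_of_int_iff[of y x 1]
  by (auto simp: label_less_def)

lemma spectral_neq_if_label_less: "x \<sqsubset> y \<Longrightarrow> spectral y \<noteq> spectral x"
  using spectral_diff_label_less[of x y] by auto

lemma spectral_diff_label_adjacent:
  assumes "label_adjacent x y"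
  shows "spectral y - spectral x = of_int (snd y - snd x)"
  using assms spectral_diff_eq_of_int_iff[of y x "snd y - snd x"] by (simp add: label_adjacent_def)

definition step :: "nat \<Rightarrow> vertex \<Rightarrow> vertex" where
  "step i u = (if entry (snd u) i = entry (snd u) (Suc i)
     then (interchange (sigma (snd u) i) (fst u), snd u)
     else (fst u, vswap i (snd u)))"

definition psi :: "vertex \<Rightarrow> vertex" where
  "psi u = (fst u, vpsi (snd u))"

definition unpsi :: "vertex \<Rightarrow> vertex" where
  "unpsi u = (fst u, (last (snd u) - 1) # butlast (snd u))"

context shape
begin

definition is_vertex :: "vertex \<Rightarrow> bool" where
  "is_vertex u \<longleftrightarrow> rst (fst u) \<and> length (snd u) = N"

lemma is_vertexD: "is_vertex u \<Longrightarrow> rst (fst u)" "is_vertex u \<Longrightarrow> length (snd u) = N"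
  by (simp_all add: is_vertex_def)

definition ascent :: "nat \<Rightarrow> vertex \<Rightarrow> bool" where
  "ascent i u \<longleftrightarrow> is_vertex u \<and> 1 \<le> i \<and> i < N \<and> label u i \<sqsubset> label u (Suc i)"

definition descent :: "nat \<Rightarrow> vertex \<Rightarrow> bool" where
  "descent i u \<longleftrightarrow> is_vertex u \<and> 1 \<le> i \<and> i < N \<and> label u (Suc i) \<sqsubset> label u i"

definition affine_descent :: "vertex \<Rightarrow> bool" where
  "affine_descent u \<longleftrightarrow> is_vertex u \<and> 0 < fst (label u N)"

definition falls :: "nat \<Rightarrow> vertex \<Rightarrow> bool" where
  "falls i u \<longleftrightarrow> is_vertex u \<and> 1 \<le> i \<and> i < N \<and> label_adjacent (label u i) (label u (Suc i))"

lemma ascentD: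
  assumes "ascent i u"
  shows "is_vertex u" "1 \<le> i" "i < N" "label u i \<sqsubset> label u (Suc i)"
  using assms by (simp_all add: ascent_def)

lemma descentD:
  assumes "descent i u"
  shows "is_vertex u" "1 \<le> i" "i < N" "label u (Suc i) \<sqsubset> label u i"
  using assms by (simp_all add: descent_def)

lemma affine_descentD:
  assumes "affine_descent u"
  shows "is_vertex u" "0 < fst (label u N)" "0 < N"
proof -
  show "is_vertex u" and positive: "0 < fst (label u N)"
    using assms by (simp_all add: affine_descent_def)
  show "0 < N"
  proof (rule ccontr)
    assume "\<not> 0 < N"
    then have "label u N = (0, 0)" by (simp add: label_def)
    then show False using positive by simp
  qed
qed

lemma fallsD:
  assumes "falls i u"
  shows "is_vertex u" "1 \<le> i" "i < N" "label_adjacent (label u i) (label u (Suc i))"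
  using assms by (simp_all add: falls_def)

lemma label_nth:
  "is_vertex u \<Longrightarrow> 1 \<le> k \<Longrightarrow> k \<le> N \<Longrightarrow>
    label u k = (entry (snd u) k, CT (fst u) (sigma (snd u) k))"
  by (simp add: label_def is_vertex_def)

lemma label_outside: "is_vertex u \<Longrightarrow> \<not> (1 \<le> k \<and> k \<le> N) \<Longrightarrow> label u k = (0, 0)"
  by (auto simp: label_def is_vertex_def)

lemma vertex_eqI:
  assumes "is_vertex u" "is_vertex w" "label u = label w"
  shows "u = w"
proof (rule prod_eqI)
  note label = fun_cong[OF assms(3)]
  show v: "snd u = snd w"
  proof (rule nth_equalityI)
    fix k assume "k < length (snd u)"
    then show "snd u ! k = snd w ! k"
      using label[of "Suc k"] assms(1,2) by (simp add: label_def is_vertex_def)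
  qed (use assms in \<open>simp add: is_vertex_def\<close>)
  show "fst u = fst w"
  proof (rule rst_eqI_CT)
    fix a assume "1 \<le> a" "a \<le> N"
    then have "a \<in> sigma (snd u) ` {1..N}"
      using bij_betw_sigma[of "snd u"] is_vertexD(2)[OF assms(1)] by (auto simp: bij_betw_def)
    then obtain k where "1 \<le> k" "k \<le> N" "a = sigma (snd u) k" by auto
    then show "CT (fst u) a = CT (fst w) a"
      using label[of k] v assms(1,2) by (simp add: label_nth)
  qed (use assms in \<open>auto simp: is_vertex_def\<close>)
qed

lemma label_step:
  assumes "is_vertex u" "1 \<le> i" "i < N"
  shows "label (step i u) = label u \<circ> transpose i (Suc i)"
proof
  fix k
  let ?t = "transpose i (Suc i)" and ?s = "sigma (snd u)"
  have length_u: "length (snd u) = N" using assms by (simp add: is_vertex_def)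
  then have length_step: "length (snd (step i u)) = N" by (simp add: step_def)
  show "label (step i u) k = (label u \<circ> ?t) k"
  proof (cases "1 \<le> k \<and> k \<le> N")
    case k: True
    then have image_range: "1 \<le> ?t k \<and> ?t k \<le> N"
      using transpose_Suc_in_range_iff[OF assms(2,3)] by blast
    show ?thesis
    proof (cases "entry (snd u) i = entry (snd u) (Suc i)")
      case True
      then have "transpose (?s i) (Suc (?s i)) (?s k) = ?s (?t k)"
        using sigma_Suc[of i "snd u"] sigma_eq_iff[of k "snd u" i]
          sigma_eq_iff[of k "snd u" "Suc i"] assms k length_u
        by (auto simp: transpose_def)
      moreover have "entry (snd u) (?t k) = entry (snd u) k"
        using True by (auto simp: transpose_def)
      ultimately show ?thesis
        using True k image_range length_u by (simp add: label_def step_def CT_interchange)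
    next
      case False
      then show ?thesis
        using assms k image_range length_u by (simp add: label_def step_def entry_vswap sigma_vswap)
    qed
  next
    case False
    then show ?thesis
      using transpose_Suc_in_range_iff[OF assms(2,3), of k] length_u length_step
      by (auto simp: label_def)
  qed
qed

lemma label_equal_entries:
  assumes "is_vertex u" "1 \<le> i" "i < N" "entry (snd u) i = entry (snd u) (Suc i)"
  shows "fst (label u i) = fst (label u (Suc i))"
    "snd (label u i) - snd (label u (Suc i)) = axial_distance (sigma (snd u) i) (fst u)"
    "1 \<le> sigma (snd u) i" "sigma (snd u) i < N" "sigma (snd u) (Suc i) = Suc (sigma (snd u) i)"
proof -
  have length_u: "length (snd u) = N" using assms by (simp add: is_vertex_def)
  show Suc_sigma: "sigma (snd u) (Suc i) = Suc (sigma (snd u) i)"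
    using assms length_u by (intro sigma_Suc) auto
  then show "snd (label u i) - snd (label u (Suc i)) = axial_distance (sigma (snd u) i) (fst u)"
    using assms by (simp add: label_nth axial_distance_def)
  show "1 \<le> sigma (snd u) i" "sigma (snd u) i < N"
    using sigma_range[of i "snd u"] sigma_range[of "Suc i" "snd u"] Suc_sigma length_u assms by auto
  show "fst (label u i) = fst (label u (Suc i))" using assms by (simp add: label_nth)
qed

lemma vertex_trichotomy:
  assumes "is_vertex u" "1 \<le> i" "i < N"
  shows "ascent i u \<or> descent i u \<or> falls i u"
proof (cases "entry (snd u) i = entry (snd u) (Suc i)")
  case True
  note equal = label_equal_entries[OF assms True]
  have "\<bar>axial_distance (sigma (snd u) i) (fst u)\<bar> = 1
      \<or> 2 \<le> \<bar>axial_distance (sigma (snd u) i) (fst u)\<bar>"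
    using axial_distance_trichotomy[OF is_vertexD(1)[OF assms(1)] equal(3,4)] by auto
  then show ?thesis
    using assms equal(1,2)
    by (auto simp: ascent_def descent_def falls_def label_less_def label_adjacent_def)
next
  case False
  then show ?thesis using assms by (auto simp: ascent_def descent_def label_less_def label_nth)
qed

lemma is_vertex_step:
  assumes "ascent i u \<or> descent i u"
  shows "is_vertex (step i u)"
proof -
  have u: "is_vertex u" "1 \<le> i" "i < N" "label u i \<sqsubset> label u (Suc i) \<or> label u (Suc i) \<sqsubset> label u i"
    using assms by (auto simp: ascent_def descent_def)
  show ?thesis
  proof (cases "entry (snd u) i = entry (snd u) (Suc i)")
    case True
    note equal = label_equal_entries[OF u(1-3) True]
    have "rst (interchange (sigma (snd u) i) (fst u))"
      using equal u by (intro rst_interchange) (auto simp: is_vertex_def label_less_def)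
    then show ?thesis using u(1) True by (simp add: is_vertex_def step_def)
  qed (use u(1) in \<open>simp add: is_vertex_def step_def\<close>)
qed

lemma label_ascent_step: "ascent i u \<Longrightarrow> label (step i u) = label u \<circ> transpose i (Suc i)"
  by (rule label_step) (simp_all add: ascent_def)

lemma label_descent_step: "descent i u \<Longrightarrow> label (step i u) = label u \<circ> transpose i (Suc i)"
  by (rule label_step) (simp_all add: descent_def)

lemma descent_ascent_step: "ascent i u \<Longrightarrow> descent i (step i u)"
  using is_vertex_step[of i u] by (simp add: descent_def label_ascent_step) (simp add: ascent_def)

lemma ascent_descent_step: "descent i u \<Longrightarrow> ascent i (step i u)"
  using is_vertex_step[of i u] by (simp add: ascent_def label_descent_step) (simp add: descent_def)

lemma step_step:
  assumes "ascent i u \<or> descent i u"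
  shows "step i (step i u) = u"
proof (rule vertex_eqI)
  have u: "is_vertex u" "1 \<le> i" "i < N" using assms by (auto simp: ascent_def descent_def)
  show "is_vertex (step i (step i u))"
    using assms ascent_descent_step descent_ascent_step by (blast intro: is_vertex_step)
  show "label (step i (step i u)) = label u"
    using u is_vertex_step[OF assms] by (simp add: label_step comp_assoc)
qed (use assms in \<open>auto simp: ascent_def descent_def\<close>)

lemma is_vertex_psi: "is_vertex u \<Longrightarrow> 0 < N \<Longrightarrow> is_vertex (psi u)"
  by (auto simp: is_vertex_def psi_def)

lemma affine_descent_psi:
  assumes "is_vertex u" "0 < N"
  shows "affine_descent (psi u)"
proof -
  have "snd u \<noteq> []" using assms by (auto simp: is_vertex_def)
  then have "entry (vpsi (snd u)) N = Suc (entry (snd u) 1)"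
    using entry_vpsi[of "snd u" N] assms by (simp add: is_vertex_def)
  then show ?thesis
    using is_vertex_psi[OF assms] assms(2) by (simp add: affine_descent_def label_nth psi_def)
qed

lemma unpsi_psi: "is_vertex u \<Longrightarrow> 0 < N \<Longrightarrow> unpsi (psi u) = u"
  by (cases "snd u") (auto simp: is_vertex_def psi_def unpsi_def vpsi_def prod_eq_iff)

lemma affine_descent_last:
  assumes "affine_descent u"
  shows "snd u \<noteq> []" "0 < last (snd u)"
  using affine_descentD[OF assms] by (auto simp: label_nth last_conv_nth is_vertex_def)

lemma is_vertex_unpsi: "affine_descent u \<Longrightarrow> is_vertex (unpsi u)"
  using affine_descent_last(1)[of u]
  by (auto simp: affine_descent_def is_vertex_def unpsi_def Suc_le_eq)

lemma psi_unpsi: "affine_descent u \<Longrightarrow> psi (unpsi u) = u"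
  using affine_descent_last[of u] by (simp add: psi_def unpsi_def vpsi_def prod_eq_iff)

lemma label_psi:
  assumes "is_vertex u" "1 \<le> k" "k \<le> N"
  shows "label (psi u) k
      = (if k = N then (Suc (fst (label u 1)), snd (label u 1)) else label u (Suc k))"
proof -
  have "snd u \<noteq> []" "length (snd u) = N" using assms by (auto simp: is_vertex_def)
  then show ?thesis using assms by (simp add: label_def psi_def entry_vpsi sigma_vpsi)
qed

lemma label_unpsi:
  assumes "affine_descent u"
  shows "label (unpsi u) k = (if k = 1 then (fst (label u N) - 1, snd (label u N))
    else if k \<le> N then label u (k - 1) else (0, 0))"
proof -
  note u = affine_descentD[OF assms] and w = is_vertex_unpsi[OF assms]
  consider (outside) "k = 0 \<or> N < k" | (first) "k = 1" | (later) "1 < k \<and> k \<le> N" by linarith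
  then show ?thesis
  proof cases
    case outside
    then show ?thesis using u(1,3) w by (auto simp: label_outside)
  next
    case first
    then show ?thesis
      using label_psi[OF w, of N] psi_unpsi[OF assms] u(3) by (simp add: prod_eq_iff)
  next
    case later
    then show ?thesis using label_psi[OF w, of "k - 1"] psi_unpsi[OF assms] by auto
  qed
qed

lemma descent_if_entry_less:
  assumes "is_vertex u" "1 \<le> i" "i < N" "entry (snd u) (Suc i) < entry (snd u) i"
  shows "descent i u"
  using assms by (simp add: descent_def label_less_def label_nth)

section \<open>Squares and hexagons of descents\<close>

lemma descent_step_far:
  assumes "descent i u" "descent j u" "Suc (Suc i) \<le> j \<or> Suc (Suc j) \<le> i"
  shows "descent j (step i u)"
  using assms is_vertex_step[of i u] label_descent_step[OF assms(1)]
  by (auto simp: descent_def)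

lemma step_commute:
  assumes "descent i u" "descent j u" "Suc (Suc i) \<le> j"
  shows "step j (step i u) = step i (step j u)"
proof (rule vertex_eqI)
  note ij = descent_step_far[OF assms(1,2)] and ji = descent_step_far[OF assms(2,1)]
  show "is_vertex (step j (step i u))" "is_vertex (step i (step j u))"
    using ij ji assms(3) by (blast intro: is_vertex_step)+
  have "transpose i (Suc i) \<circ> transpose j (Suc j) = transpose j (Suc j) \<circ> transpose i (Suc i)"
    using assms(3) by (auto simp: fun_eq_iff transpose_def)
  then show "label (step j (step i u)) = label (step i (step j u))"
    using ij ji assms by (simp add: label_descent_step comp_assoc)
qed

lemma descent_braid:
  assumes "descent i u" "descent (Suc i) u"
  shows "descent (Suc i) (step i u)" "descent i (step (Suc i) (step i u))"
    "descent i (step (Suc i) u)" "descent (Suc i) (step i (step (Suc i) u))"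
proof -
  have "label u (Suc (Suc i)) \<sqsubset> label u i"
    using assms label_less_trans by (blast dest: descentD(4))
  then show one: "descent (Suc i) (step i u)" and two: "descent i (step (Suc i) u)"
    using assms is_vertex_step[of i u] is_vertex_step[of "Suc i" u]
      label_descent_step[OF assms(1)] label_descent_step[OF assms(2)]
    by (auto simp: descent_def)
  show "descent i (step (Suc i) (step i u))"
    using assms one is_vertex_step[of "Suc i" "step i u"] label_descent_step[OF assms(1)]
      label_descent_step[OF one]
    by (auto simp: descent_def)
  show "descent (Suc i) (step i (step (Suc i) u))"
    using assms two is_vertex_step[of i "step (Suc i) u"] label_descent_step[OF assms(2)]
      label_descent_step[OF two]
    by (auto simp: descent_def)
qed

lemma step_braid:
  assumes "descent i u" "descent (Suc i) u"
  shows "step i (step (Suc i) (step i u)) = step (Suc i) (step i (step (Suc i) u))"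
proof (rule vertex_eqI)
  note braid = descent_braid[OF assms]
  show "is_vertex (step i (step (Suc i) (step i u)))"
    "is_vertex (step (Suc i) (step i (step (Suc i) u)))"
    using braid by (blast intro: is_vertex_step)+
  have "transpose i (Suc i) \<circ> (transpose (Suc i) (Suc (Suc i)) \<circ> transpose i (Suc i))
      = transpose (Suc i) (Suc (Suc i)) \<circ> (transpose i (Suc i) \<circ> transpose (Suc i) (Suc (Suc i)))"
    by (auto simp: fun_eq_iff transpose_def)
  then show "label (step i (step (Suc i) (step i u)))
      = label (step (Suc i) (step i (step (Suc i) u)))"
    using braid assms by (simp add: label_descent_step comp_assoc)
qed

lemma affine_descent_step:
  assumes "descent i u" "affine_descent u"
  shows "affine_descent (step i u)"
proof -
  have "0 < fst (label (step i u) N)"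
    using assms label_descent_step[OF assms(1)]
    by (auto simp: descent_def affine_descent_def label_less_def transpose_def)
  then show ?thesis using is_vertex_step[of i u] assms(1) by (simp add: affine_descent_def)
qed

lemma descent_unpsi:
  assumes "descent i u" "affine_descent u" "Suc i < N"
  shows "descent (Suc i) (unpsi u)"
  using assms is_vertex_unpsi[OF assms(2)] by (simp add: descent_def label_unpsi)

lemma unpsi_step:
  assumes "descent i u" "affine_descent u" "Suc i < N"
  shows "unpsi (step i u) = step (Suc i) (unpsi u)"
proof (rule vertex_eqI)
  note affine = affine_descent_step[OF assms(1,2)] and down = descent_unpsi[OF assms]
  show "is_vertex (unpsi (step i u))" by (rule is_vertex_unpsi[OF affine])
  show "is_vertex (step (Suc i) (unpsi u))" using down by (blast intro: is_vertex_step)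
  show "label (unpsi (step i u)) = label (step (Suc i) (unpsi u))"
    using descentD(2)[OF assms(1)] assms(3)
    by (auto simp: fun_eq_iff label_unpsi[OF affine] label_descent_step[OF down]
        label_unpsi[OF assms(2)] label_descent_step[OF assms(1)] transpose_def)
qed

lemma affine_descent_unpsi:
  assumes "descent (N - 1) u" "affine_descent u"
  shows "affine_descent (unpsi u)"
proof -
  note u = descentD[OF assms(1)]
  have "label (unpsi u) N = label u (N - 1)" using u(2) by (auto simp: label_unpsi[OF assms(2)])
  moreover have "0 < fst (label u (N - 1))"
    using u(2,4) affine_descentD(2)[OF assms(2)] by (auto simp: label_less_def)
  ultimately show ?thesis using is_vertex_unpsi[OF assms(2)] by (simp add: affine_descent_def)
qed

lemma label_unpsi_unpsi:
  assumes "affine_descent u" "affine_descent (unpsi u)" "2 \<le> N"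
  shows "label (unpsi (unpsi u)) k =
    (if k = 1 then (fst (label u (N - 1)) - 1, snd (label u (N - 1)))
     else if k = 2 then (fst (label u N) - 1, snd (label u N))
     else if k \<le> N then label u (k - 2) else (0, 0))"
  using assms(3) by (auto simp: label_unpsi[OF assms(2)] label_unpsi[OF assms(1)])

lemma descent_unpsi_unpsi:
  assumes "descent (N - 1) u" "affine_descent u"
  shows "descent 1 (unpsi (unpsi u))"
proof -
  note u = descentD[OF assms(1)] and affine = affine_descent_unpsi[OF assms]
  have "label (unpsi (unpsi u)) 2 \<sqsubset> label (unpsi (unpsi u)) 1"
    using u(2,4) affine_descentD(2)[OF assms(2)]
    by (auto simp: label_unpsi_unpsi[OF assms(2) affine] label_less_def)
  then show ?thesis
    using is_vertex_unpsi[OF affine] u(2) by (simp add: descent_def)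
qed

lemma unpsi_unpsi_step:
  assumes "descent (N - 1) u" "affine_descent u"
  shows "affine_descent (unpsi (step (N - 1) u))"
    "unpsi (unpsi (step (N - 1) u)) = step 1 (unpsi (unpsi u))"
proof -
  note u = descentD[OF assms(1)] and affine = affine_descent_step[OF assms]
  have N_bounds: "2 \<le> N" "Suc (N - 1) = N" using u(2) by auto
  have "label (unpsi (step (N - 1) u)) N = label u N"
    using N_bounds by (simp add: label_unpsi[OF affine] label_descent_step[OF assms(1)])
  then show affine2: "affine_descent (unpsi (step (N - 1) u))"
    using is_vertex_unpsi[OF affine] affine_descentD(2)[OF assms(2)]
    by (simp add: affine_descent_def)
  note down = descent_unpsi_unpsi[OF assms]
  show "unpsi (unpsi (step (N - 1) u)) = step 1 (unpsi (unpsi u))"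
  proof (rule vertex_eqI)
    show "is_vertex (unpsi (unpsi (step (N - 1) u)))" by (rule is_vertex_unpsi[OF affine2])
    show "is_vertex (step 1 (unpsi (unpsi u)))" using down by (blast intro: is_vertex_step)
    show "label (unpsi (unpsi (step (N - 1) u))) = label (step 1 (unpsi (unpsi u)))"
      using N_bounds
      by (auto simp: fun_eq_iff label_unpsi_unpsi[OF affine affine2 N_bounds(1)]
        label_descent_step[OF down]
        label_unpsi_unpsi[OF assms(2) affine_descent_unpsi[OF assms] N_bounds(1)]
        label_descent_step[OF assms(1)] transpose_def)
  qed
qed

section \<open>Edges in terms of labels\<close>

lemma arrow_S_iff:
  assumes "is_vertex u"
  shows "arrow lam (Some u) (S_edge i) (Some w) \<longleftrightarrow> ascent i u \<and> w = step i u"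
proof -
  obtain \<tau> v where u: "u = (\<tau>, v)" by fastforce
  have length_v: "length v = N" using assms u by (simp add: is_vertex_def)
  note sigma_Suc_v = sigma_Suc[of i v, unfolded length_v]
  have label: "label u i \<sqsubset> label u (Suc i) \<longleftrightarrow> entry v i < entry v (i + 1) \<or>
      (entry v i = entry v (i + 1) \<and> 2 \<le> CT \<tau> (sigma v i) - CT \<tau> (sigma v i + 1))"
    if "1 \<le> i" "i < N"
    using that assms sigma_Suc_v u by (auto simp: label_nth label_less_def)
  show ?thesis
  proof
    assume "arrow lam (Some u) (S_edge i) (Some w)"
    then show "ascent i u \<and> w = step i u"
    proof cases
      case (swap v' \<tau>')
      then show ?thesis using u label assms by (simp add: sum_list_lam ascent_def step_def)
    next
      case (inter v' \<tau>')
      then show ?thesis using u label assms by (simp add: sum_list_lam ascent_def step_def)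
    qed
  next
    assume "ascent i u \<and> w = step i u"
    then have i: "1 \<le> i" "i < sum_list lam" "label u i \<sqsubset> label u (Suc i)" "w = step i u"
      by (auto simp: ascent_def sum_list_lam)
    show "arrow lam (Some u) (S_edge i) (Some w)"
    proof (cases "entry v i = entry v (i + 1)")
      case True
      then show ?thesis
        using arrow.inter[OF i(1,2) True, of \<tau>] label i u by (simp add: sum_list_lam step_def)
    next
      case False
      then show ?thesis
        using arrow.swap[OF i(1,2), of v \<tau>] label i u by (simp add: sum_list_lam step_def)
    qed
  qed
qed

lemma arrow_Psi_iff:
  assumes "is_vertex u"
  shows "arrow lam (Some u) Psi_edge w \<longleftrightarrow> 0 < N \<and> w = Some (psi u)"
proof -
  have nonempty: "snd u \<noteq> [] \<longleftrightarrow> 0 < N" using assms by (auto simp: is_vertex_def)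
  show ?thesis
  proof
    assume "arrow lam (Some u) Psi_edge w"
    then show "0 < N \<and> w = Some (psi u)" using nonempty by cases (auto simp: psi_def)
  next
    assume "0 < N \<and> w = Some (psi u)"
    then show "arrow lam (Some u) Psi_edge w"
      using arrow.psi[of "snd u" lam "fst u"] nonempty by (simp add: psi_def)
  qed
qed

lemma arrow_is_vertex:
  assumes "arrow lam (Some u) l (Some w)" "is_vertex u"
  shows "is_vertex w"
  using assms
  by (cases l) (auto simp: arrow_Psi_iff arrow_S_iff intro: is_vertex_psi is_vertex_step)

lemma is_vertex_root: "is_vertex (root_vertex lam)"
  by (simp add: is_vertex_def root_vertex_def rst_tau_shape sum_list_lam)

lemma is_vertex_reachable:
  assumes "Some u \<in> reachable lam"
  shows "is_vertex u"
proof -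
  have "case x of Some u \<Rightarrow> is_vertex u | None \<Rightarrow> True" if "x \<in> reachable lam" for x
    using that
  proof induction
    case root
    then show ?case by (simp add: is_vertex_root)
  next
    case (step x l w)
    from step.hyps(2) obtain u where "x = Some u" by cases auto
    then show ?case using step arrow_is_vertex[of u l] by (cases w) auto
  qed
  from this[OF assms] show ?thesis by simp
qed

section \<open>Inversions and the order of the vertices\<close>

definition inversions :: "vertex \<Rightarrow> (nat \<times> nat) set" where
  "inversions u = {(j, k). 1 \<le> j \<and> j < k \<and> k \<le> N \<and> label u k \<sqsubset> label u j}"

lemma inversions_subset: "inversions u \<subseteq> {1..N} \<times> {1..N}"
  by (auto simp: inversions_def)

lemma finite_inversions [simp]: "finite (inversions u)"
  by (rule finite_subset[OF inversions_subset]) simp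

lemma inversions_step_iff:
  assumes "descent i u" "(j, k) \<noteq> (i, Suc i)" "(j, k) \<noteq> (Suc i, i)"
  shows "(j, k) \<in> inversions (step i u)
    \<longleftrightarrow> (transpose i (Suc i) j, transpose i (Suc i) k) \<in> inversions u"
proof -
  let ?t = "transpose i (Suc i)"
  note i = descentD[OF assms(1)]
  have "?t j < ?t k \<longleftrightarrow> j < k"
    using transpose_Suc_strict_mono[of j k i] transpose_Suc_strict_mono[of "?t j" "?t k" i]
      assms(2,3)
    by (auto simp: transpose_eq_iff)
  then show ?thesis
    using transpose_Suc_in_range_iff[OF i(2,3), of j] transpose_Suc_in_range_iff[OF i(2,3), of k]
    by (auto simp: inversions_def label_descent_step[OF assms(1)])
qed

lemma inversions_descent_step:
  assumes "descent i u"
  defines "swap_pair \<equiv> map_prod (transpose i (Suc i)) (transpose i (Suc i))"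
  shows "inversions u = insert (i, Suc i) (swap_pair ` inversions (step i u))"
    and "(i, Suc i) \<notin> swap_pair ` inversions (step i u)"
    and "inj swap_pair"
proof -
  let ?t = "transpose i (Suc i)"
  note i = descentD[OF assms(1)]
  have not_inverted: "(i, Suc i) \<notin> inversions (step i u)" "(Suc i, i) \<notin> inversions (step i u)"
    using label_less_asym[OF i(4)] by (auto simp: inversions_def label_descent_step[OF assms(1)])
  have involutory: "swap_pair (swap_pair p) = p" for p by (cases p) (simp add: swap_pair_def)
  then show "inj swap_pair" by (metis injI)
  have "p \<in> swap_pair ` inversions (step i u) \<longleftrightarrow> swap_pair p \<in> inversions (step i u)" for p
    using involutory by (metis image_iff)
  then have image: "(j, k) \<in> swap_pair ` inversions (step i u)
      \<longleftrightarrow> (?t j, ?t k) \<in> inversions (step i u)" for j k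
    by (simp add: swap_pair_def)
  then show "(i, Suc i) \<notin> swap_pair ` inversions (step i u)" using not_inverted by simp
  have "(j, k) \<in> inversions u \<longleftrightarrow> (j, k) = (i, Suc i) \<or> (?t j, ?t k) \<in> inversions (step i u)" for j k
  proof (cases "(?t j, ?t k) = (i, Suc i) \<or> (?t j, ?t k) = (Suc i, i)")
    case True
    then show ?thesis using not_inverted i by (auto simp: transpose_eq_iff inversions_def)
  next
    case False
    then show ?thesis using inversions_step_iff[OF assms(1), of "?t j" "?t k"] by auto
  qed
  then have "p \<in> inversions u \<longleftrightarrow> p \<in> insert (i, Suc i) (swap_pair ` inversions (step i u))" for p
    by (cases p) (simp add: image)
  then show "inversions u = insert (i, Suc i) (swap_pair ` inversions (step i u))"
    by (rule set_eqI)
qed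

lemma card_inversions_descent_step:
  assumes "descent i u"
  shows "card (inversions u) = Suc (card (inversions (step i u)))"
  using inversions_descent_step[OF assms] by (simp add: card_image inj_on_subset[OF _ subset_UNIV])

definition vertex_less :: "vertex \<Rightarrow> vertex \<Rightarrow> bool" (infix \<open>\<prec>\<close> 50) where
  "w \<prec> u \<longleftrightarrow> is_vertex w \<and> (w, u) \<in> measures [\<lambda>u. sum_list (snd u), \<lambda>u. card (inversions u)]"

lemma is_vertex_if_less: "w \<prec> u \<Longrightarrow> is_vertex w"
  by (simp add: vertex_less_def)

lemma vertex_less_trans [trans]: "w \<prec> x \<Longrightarrow> x \<prec> u \<Longrightarrow> w \<prec> u"
  by (auto simp: vertex_less_def)

lemma vertex_induct [consumes 1, case_names vertex]:
  assumes "is_vertex u" and "\<And>u. is_vertex u \<Longrightarrow> (\<And>w. w \<prec> u \<Longrightarrow> Q w) \<Longrightarrow> Q u"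
  shows "Q u"
  using assms(1)
proof (induction u
    rule: wf_induct_rule[OF wf_measures[of "[\<lambda>u. sum_list (snd u), \<lambda>u. card (inversions u)]"]])
  case (1 u)
  show ?case
  proof (rule assms(2)[OF 1(2)])
    show "Q w" if "w \<prec> u" for w
      using that 1(1) unfolding vertex_less_def by blast
  qed
qed

lemma sum_list_step:
  assumes "is_vertex u" "1 \<le> i" "i < N"
  shows "sum_list (snd (step i u)) = sum_list (snd u)"
proof -
  have "mset (vswap i (snd u)) = mset (snd u)"
    using mset_swap[of i "snd u" "i - 1"] assms by (simp add: vswap_def is_vertex_def)
  then have "sum_list (vswap i (snd u)) = sum_list (snd u)" by (metis sum_mset_sum_list)
  then show ?thesis by (simp add: step_def)
qed

lemma descent_step_less:
  assumes "descent i u"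
  shows "step i u \<prec> u"
  using assms is_vertex_step card_inversions_descent_step[OF assms]
    sum_list_step[OF descentD(1-3)[OF assms]]
  by (simp add: vertex_less_def)

lemma unpsi_less:
  assumes "affine_descent u"
  shows "unpsi u \<prec> u"
proof -
  note last = affine_descent_last[OF assms]
  have "sum_list (snd u) = sum_list (butlast (snd u)) + last (snd u)"
    using last(1) sum_list_append[of "butlast (snd u)" "[last (snd u)]"] by simp
  then have "sum_list (snd (unpsi u)) < sum_list (snd u)" using last(2) by (simp add: unpsi_def)
  then show ?thesis using is_vertex_unpsi[OF assms] by (simp add: vertex_less_def)
qed

lemma ascent_induct [consumes 1, case_names vertex]:
  assumes "is_vertex u"
    and step: "\<And>u. is_vertex u \<Longrightarrow> (\<And>i. ascent i u \<Longrightarrow> Q (step i u)) \<Longrightarrow> Q u"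
  shows "Q u"
  using assms(1)
proof (induction u rule: measure_induct_rule[of "\<lambda>u. N * N - card (inversions u)"])
  case (less u)
  show ?case
  proof (rule step[OF less.prems])
    fix i assume i: "ascent i u"
    have "card (inversions (step i u)) \<le> card ({1..N} \<times> {1..N})"
      by (rule card_mono[OF _ inversions_subset]) simp
    then have "N * N - card (inversions (step i u)) < N * N - card (inversions u)"
      using card_inversions_descent_step[OF descent_ascent_step[OF i]] step_step[of i u] i by simp
    then show "Q (step i u)" using less.IH is_vertex_step i by blast
  qed
qed

section \<open>Vertices without descents or ascents\<close>

lemma rst_block_mono:
  assumes \<tau>: "rst \<tau>"
    and antimono: "\<And>p q. p \<in> cells lam \<Longrightarrow> q \<in> cells lam \<Longrightarrow> \<tau> q < \<tau> p \<Longrightarrow> T p \<le> (T q :: nat)"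
    and consecutive: "\<And>p q. p \<in> cells lam \<Longrightarrow> q \<in> cells lam \<Longrightarrow> \<tau> q = Suc (\<tau> p) \<Longrightarrow> T p = T q \<Longrightarrow>
      f q \<le> (f p :: nat)"
    and "p \<in> cells lam" "q \<in> cells lam" "\<tau> q < \<tau> p" "T p = T q"
  shows "f p \<le> f q"
  using assms(4-)
proof (induction "\<tau> p" arbitrary: p rule: less_induct)
  case less
  show ?case
  proof (cases "\<tau> p = Suc (\<tau> q)")
    case True
    then show ?thesis using consecutive[of q p] less.prems by simp
  next
    case False
    then have bounds: "\<tau> q < \<tau> p - 1" "1 \<le> \<tau> p - 1" "\<tau> p - 1 \<le> N"
      using less.prems rst_range[OF \<tau>, of p] by auto
    obtain p' where p': "p' \<in> cells lam" "\<tau> p' = \<tau> p - 1"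
      by (rule rst_cell[OF \<tau> bounds(2,3)]) (rule that)
    then have pred: "\<tau> q < \<tau> p'" "\<tau> p = Suc (\<tau> p')" using bounds by auto
    have "T p \<le> T p'" "T p' \<le> T q"
      using antimono[of p p'] antimono[of p' q] less.prems(1,2) p'(1) pred by auto
    then have "T p' = T p" "T p' = T q" using less.prems(4) by auto
    then have "f p' \<le> f q" "f p \<le> f p'"
      using less.hyps[of p'] consecutive[of p' p] less.prems(1,2) p'(1) pred by auto
    then show ?thesis by simp
  qed
qed

lemma rst_less_iff_block_order:
  assumes \<tau>: "rst \<tau>" and coordinates: "(f, g) = (fst, snd) \<or> (f, g) = (snd, fst)"
    and antimono: "\<And>p q. p \<in> cells lam \<Longrightarrow> q \<in> cells lam \<Longrightarrow> \<tau> q < \<tau> p \<Longrightarrow> T p \<le> T q"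
    and consecutive: "\<And>p q. p \<in> cells lam \<Longrightarrow> q \<in> cells lam \<Longrightarrow> \<tau> q = Suc (\<tau> p) \<Longrightarrow> T p = T q \<Longrightarrow>
      f q \<le> f p"
    and cells: "p \<in> cells lam" "q \<in> cells lam"
  shows "\<tau> q < \<tau> p \<longleftrightarrow> block_order T f g p q"
proof -
  have tie: "g p < g q" if "p \<in> cells lam" "q \<in> cells lam" "f p = f q" "\<tau> q < \<tau> p" for p q
  proof (rule ccontr)
    assume "\<not> g p < g q"
    then have "\<tau> p \<le> \<tau> q"
      using that(1-3) coordinates rst_antimono[OF \<tau>, of "fst q" "snd q" "fst p" "snd p"] by auto
    then show False using that(4) by simp
  qed
  have forward: "block_order T f g p q" if "p \<in> cells lam" "q \<in> cells lam" "\<tau> q < \<tau> p" for p q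
  proof -
    have "f p \<le> f q" if "T p = T q"
      using rst_block_mono[OF \<tau> antimono consecutive \<open>p \<in> cells lam\<close> \<open>q \<in> cells lam\<close>
          \<open>\<tau> q < \<tau> p\<close> that] .
    then show ?thesis
      using antimono[OF that] tie[OF that(1,2) _ that(3)] unfolding block_order_def by linarith
  qed
  show ?thesis
  proof
    assume order: "block_order T f g p q"
    then have "\<not> block_order T f g q p" "p \<noteq> q" by (auto simp: block_order_def)
    then have "\<not> \<tau> p < \<tau> q" "\<tau> p \<noteq> \<tau> q"
      using forward[OF cells(2,1)] rst_inj[OF \<tau> cells(2), of p] by auto
    then show "\<tau> q < \<tau> p" by simp
  qed (rule forward[OF cells])
qed

lemma T_of_cell: "p \<in> cells lam \<Longrightarrow> T_of lam u p = entry (vplus (snd u)) (fst u p)"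
  by (cases u) (simp add: T_of_def)

lemma T_of_antimono:
  assumes "is_vertex u" "p \<in> cells lam" "q \<in> cells lam" "fst u q < fst u p"
  shows "T_of lam u p \<le> T_of lam u q"
  using assms rst_range[of "fst u" p] rst_range[of "fst u" q]
  by (auto simp: T_of_cell is_vertex_def intro!: vplus_antimono)

text \<open>If \<open>v\<close> is monotone, its equal entries are consecutive, so neighbouring entries of a block of
  the tableau sit at neighbouring positions of \<open>v\<close>.\<close>

lemma consecutive_in_block:
  assumes u: "is_vertex u" and monotone: "sorted (snd u) \<or> sorted (rev (snd u))"
    and consecutive: "p \<in> cells lam" "q \<in> cells lam" "fst u q = Suc (fst u p)"
      "T_of lam u p = T_of lam u q"
  obtains k where "1 \<le> k" "k < N" "sigma (snd u) k = fst u p"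
    "entry (snd u) k = entry (snd u) (Suc k)"
proof -
  define v where "v = snd u"
  have length_v: "length v = N" and \<tau>: "rst (fst u)" using u by (auto simp: is_vertex_def v_def)
  have sigma_surj: "\<exists>k. 1 \<le> k \<and> k \<le> N \<and> sigma v k = fst u x" if "x \<in> cells lam" for x
  proof -
    have "fst u x \<in> sigma v ` {1..N}"
      using rst_range[OF \<tau> that] bij_betw_imp_surj_on[OF bij_betw_sigma[of v]]
      by (simp add: length_v)
    then show ?thesis by auto
  qed
  obtain k where k: "1 \<le> k" "k \<le> N" "sigma v k = fst u p"
    using sigma_surj[OF consecutive(1)] by blast
  obtain k' where k': "1 \<le> k'" "k' \<le> N" "sigma v k' = fst u q"
    using sigma_surj[OF consecutive(2)] by blast
  have "T_of lam u p = entry v k" "T_of lam u q = entry v k'"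
    using k k' consecutive length_v vplus_sigma[of k v] vplus_sigma[of k' v]
    by (simp_all add: T_of_cell v_def)
  then have equal: "entry v k = entry v k'" using consecutive by simp
  have "k < k'"
    using sigma_less_iff[of k' v k] equal k k' consecutive(3) length_v
    by (auto simp: precedes_in_def)
  moreover have "entry v k = entry v (Suc k)"
  proof -
    have "sorted v \<Longrightarrow> entry v k \<le> entry v (Suc k) \<and> entry v (Suc k) \<le> entry v k'"
      using k k' \<open>k < k'\<close> length_v by (auto intro!: sorted_nth_mono)
    moreover have "sorted (rev v) \<Longrightarrow> entry v k' \<le> entry v (Suc k) \<and> entry v (Suc k) \<le> entry v k"
      using k k' \<open>k < k'\<close> length_v by (auto intro!: sorted_rev_nth_mono)
    ultimately show ?thesis using monotone equal unfolding v_def by linarith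
  qed
  ultimately show ?thesis using that k k' v_def by simp
qed

lemma axial_distance_in_block:
  assumes u: "is_vertex u" and "sorted (snd u) \<or> sorted (rev (snd u))"
    and "p \<in> cells lam" "q \<in> cells lam" "fst u q = Suc (fst u p)" "T_of lam u p = T_of lam u q"
  shows "axial_distance (fst u p) (fst u) \<le> -2 \<Longrightarrow> \<exists>i. descent i u"
    and "2 \<le> axial_distance (fst u p) (fst u) \<Longrightarrow> \<exists>i. ascent i u"
proof -
  obtain k where k: "1 \<le> k" "k < N" "sigma (snd u) k = fst u p"
    "entry (snd u) k = entry (snd u) (Suc k)"
    using consecutive_in_block[OF assms] .
  note equal = label_equal_entries[OF u k(1,2,4), unfolded k(3)]
  show "axial_distance (fst u p) (fst u) \<le> -2 \<Longrightarrow> \<exists>i. descent i u"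
    using u k equal(1,2) by (intro exI[of _ k]) (simp add: descent_def label_less_def)
  show "2 \<le> axial_distance (fst u p) (fst u) \<Longrightarrow> \<exists>i. ascent i u"
    using u k equal(1,2) by (intro exI[of _ k]) (simp add: ascent_def label_less_def)
qed

lemma no_descent_structure:
  assumes u: "is_vertex u" and no_descent: "\<And>i. \<not> descent i u"
  shows "sorted (snd u)"
    and "\<And>p q. p \<in> cells lam \<Longrightarrow> q \<in> cells lam \<Longrightarrow> fst u q < fst u p \<longleftrightarrow> column_order (T_of lam u) p q"
proof -
  show sorted: "sorted (snd u)"
    unfolding sorted_iff_entries
    using no_descent descent_if_entry_less[OF u] is_vertexD(2)[OF u] by (metis not_less)
  have \<tau>: "rst (fst u)" using u by (simp add: is_vertex_def)
  show "fst u q < fst u p \<longleftrightarrow> column_order (T_of lam u) p q"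
    if "p \<in> cells lam" "q \<in> cells lam" for p q
  proof (rule rst_less_iff_block_order[OF \<tau> _ T_of_antimono[OF u] _ that])
    fix p q
    assume consecutive: "p \<in> cells lam" "q \<in> cells lam" "fst u q = Suc (fst u p)"
      "T_of lam u p = T_of lam u q"
    have "\<not> axial_distance (fst u p) (fst u) \<le> -2"
      using axial_distance_in_block(1)[OF u _ consecutive] sorted no_descent by blast
    then show "snd q \<le> snd p"
      using consecutive
      by (cases rule: axial_distance_cases[OF \<tau>, of "fst p" "snd p" "fst q" "snd q"]) auto
  qed simp
qed

lemma no_ascent_structure:
  assumes u: "is_vertex u" and no_ascent: "\<And>i. \<not> ascent i u"
  shows "sorted (rev (snd u))"
    and "\<And>p q. p \<in> cells lam \<Longrightarrow> q \<in> cells lam \<Longrightarrow> fst u q < fst u p \<longleftrightarrow> row_order (T_of lam u) p q"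
proof -
  show sorted: "sorted (rev (snd u))"
    unfolding sorted_rev_iff_nth_Suc
  proof (intro allI impI)
    fix i assume "Suc i < length (snd u)"
    then show "snd u ! Suc i \<le> snd u ! i"
      using u no_ascent[of "Suc i"] is_vertexD(2)[OF u]
      by (auto simp: ascent_def label_less_def label_nth)
  qed
  have \<tau>: "rst (fst u)" using u by (simp add: is_vertex_def)
  show "fst u q < fst u p \<longleftrightarrow> row_order (T_of lam u) p q" if "p \<in> cells lam" "q \<in> cells lam" for p q
  proof (rule rst_less_iff_block_order[OF \<tau> _ T_of_antimono[OF u] _ that])
    fix p q
    assume consecutive: "p \<in> cells lam" "q \<in> cells lam" "fst u q = Suc (fst u p)"
      "T_of lam u p = T_of lam u q"
    have "\<not> 2 \<le> axial_distance (fst u p) (fst u)"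
      using axial_distance_in_block(2)[OF u _ consecutive] sorted no_ascent by blast
    then show "fst q \<le> fst p"
      using consecutive
      by (cases rule: axial_distance_cases[OF \<tau>, of "fst p" "snd p" "fst q" "snd q"]) auto
  qed simp
qed

lemma last_eq_0_if_not_affine_descent:
  assumes "is_vertex u" "\<not> affine_descent u" "snd u \<noteq> []"
  shows "last (snd u) = 0"
proof -
  have length_u: "length (snd u) = N" using assms(1) by (simp add: is_vertex_def)
  then have "1 \<le> N" using assms(3) by (cases N) auto
  then have "fst (label u N) = entry (snd u) N" using label_nth[OF assms(1)] by simp
  then show ?thesis using assms length_u by (simp add: affine_descent_def last_conv_nth)
qed

section \<open>Reachability\<close>

lemma exists_descent:
  assumes u: "is_vertex u" "u \<noteq> root_vertex lam" "\<not> affine_descent u"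
  obtains i where "descent i u"
proof (rule ccontr)
  assume "\<not> thesis"
  then have no_descent: "\<not> descent i u" for i using that by blast
  note order = no_descent_structure[OF u(1) no_descent]
  have length_u: "length (snd u) = N" and \<tau>: "rst (fst u)" using u by (auto simp: is_vertex_def)
  have zero_vector: "snd u = replicate N 0"
    using sorted_zero_last[OF order(1)] last_eq_0_if_not_affine_descent[OF u(1,3)] length_u by simp
  have "T_of lam u p = 0" if "p \<in> cells lam" for p
    using that rst_range[OF \<tau> that] by (simp add: T_of_cell zero_vector vplus_def sort_replicate)
  then have "fst u = tau_shape lam"
    using order(2) tau_shape_less_iff
    by (intro rst_eqI_order[OF \<tau> rst_tau_shape]) (simp add: block_order_def)
  then show False using u(2) zero_vector by (simp add: root_vertex_def sum_list_lam prod_eq_iff)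
qed

lemma not_descent_root: "\<not> descent i (root_vertex lam)"
proof
  let ?\<tau> = "tau_shape lam"
  assume descent: "descent i (root_vertex lam)"
  note i = descentD[OF descent]
  have "label (root_vertex lam) k = (0, CT ?\<tau> k)" if "1 \<le> k" "k \<le> N" for k
    using that by (simp add: label_def root_vertex_def sum_list_lam sigma_replicate)
  then have distance: "axial_distance i ?\<tau> \<le> -2"
    using i by (auto simp: axial_distance_def label_less_def)
  obtain r c where p: "(r, c) \<in> cells lam" "?\<tau> (r, c) = i"
    using rst_cell[OF rst_tau_shape, of i] i(2,3) by auto
  obtain r' c' where q: "(r', c') \<in> cells lam" "?\<tau> (r', c') = Suc i"
    using rst_cell[OF rst_tau_shape, of "Suc i"] i(3) by auto
  have "c' \<le> c" using tau_shape_less_iff[OF q(1) p(1)] p q by (auto simp: block_order_def)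
  then show False
    using p q distance by (cases rule: axial_distance_cases[OF rst_tau_shape p(1) q(1)]) auto
qed

lemma not_affine_descent_root: "\<not> affine_descent (root_vertex lam)"
  by (auto simp: affine_descent_def label_def root_vertex_def sum_list_lam)

lemma vertex_cases:
  assumes "is_vertex u"
  obtains (root) "u = root_vertex lam" | (descent) i where "descent i u"
    | (affine) "affine_descent u"
  using exists_descent[OF assms] that by metis

lemma arrow_from_step: "descent i u \<Longrightarrow> arrow lam (Some (step i u)) (S_edge i) (Some u)"
  using is_vertex_step[of i u] step_step[of i u] by (simp add: arrow_S_iff ascent_descent_step)

lemma arrow_from_unpsi: "affine_descent u \<Longrightarrow> arrow lam (Some (unpsi u)) Psi_edge (Some u)"
  using affine_descentD(3) by (simp add: arrow_Psi_iff is_vertex_unpsi psi_unpsi)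

lemma reachable_is_vertex: "is_vertex u \<Longrightarrow> Some u \<in> reachable lam"
proof (induction u rule: vertex_induct)
  case (vertex u)
  from vertex(1) show ?case
  proof (cases rule: vertex_cases)
    case root
    then show ?thesis by (simp add: reachable.root)
  next
    case (descent i)
    show ?thesis
      by (rule reachable.step[OF vertex(2)[OF descent_step_less[OF descent]]
            arrow_from_step[OF descent]])
  next
    case affine
    show ?thesis
      by (rule reachable.step[OF vertex(2)[OF unpsi_less[OF affine]] arrow_from_unpsi[OF affine]])
  qed
qed

lemma H_verts_iff: "u \<in> H_verts lam \<longleftrightarrow> is_vertex u"
  using reachable_is_vertex[of u] is_vertex_reachable[of u] by (auto simp: H_verts_def G_verts_def)

lemma G_edge_iff: "is_vertex u \<Longrightarrow> G_edge lam (Some u) l w \<longleftrightarrow> arrow lam (Some u) l w"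
  using reachable_is_vertex[of u] by (simp add: G_edge_def G_verts_def)

lemma H_edge_iff: "H_edge lam u i w \<longleftrightarrow> ascent i u \<and> w = step i u"
  using arrow_S_iff[of u i w] H_verts_iff[of u]
  by (auto simp: H_edge_def G_edge_def H_verts_def ascent_def)

lemma H_edge_from_step: "descent i u \<Longrightarrow> H_edge lam (step i u) i u"
  using step_step[of i u] by (simp add: H_edge_iff ascent_descent_step)

end

section \<open>Intertwining operators\<close>

definition intertwiner :: "nat \<Rightarrow> qalpha \<Rightarrow> qalpha \<Rightarrow> tabpol \<Rightarrow> tabpol" where
  "intertwiner i x y P = diag_s i P + smul (1 / (x - y)) P"

interpretation intertwiner: module_hom smul smul "intertwiner i x y" for i x y
  by unfold_locales (simp_all add: intertwiner_def diag_s.add diag_s.scale smul.scale_right_distrib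
    algebra_simps)

lemma intertwiner_shift: "intertwiner i (x - a) (y - a) = intertwiner i x y"
  by (simp add: intertwiner_def fun_eq_iff)

lemma intertwiner_commute:
  assumes "Suc (Suc i) \<le> j"
  shows "intertwiner i x y (intertwiner j x' y' P) = intertwiner j x' y' (intertwiner i x y P)"
  using diag_s_commute[OF assms, of P]
  by (simp add: intertwiner_def diag_s.add diag_s.scale smul.scale_right_distrib algebra_simps)

interpretation diag_word: module_hom smul smul "diag_word ws" for ws
proof
  show "diag_word ws (P + Q) = diag_word ws P + diag_word ws Q" for P Q
    by (induction ws arbitrary: P Q) (auto simp: diag_word_def diag_s.add)
  show "diag_word ws (smul c P) = smul c (diag_word ws P)" for c P
    by (induction ws arbitrary: P) (auto simp: diag_word_def diag_s.scale)
qed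

lemma diag_word_append: "diag_word (us @ vs) P = diag_word vs (diag_word us P)"
  by (simp add: diag_word_def)

lemma diag_word_rev: "diag_word (rev ws) (diag_word ws P) = P"
  by (induction ws arbitrary: P) (auto simp: diag_word_def)

lemma diag_word_pmul: "diag_word ws (pmul f P) = pmul (fold pol_s ws f) (diag_word ws P)"
  by (induction ws arbitrary: f P) (auto simp: diag_word_def diag_s_pmul)

lemma fold_pol_s_pvar: "fold pol_s ws (pvar k) = pvar (word_perm ws k)"
  by (induction ws arbitrary: k) (auto simp: pol_s_pvar word_perm_Cons)

lemma word_perm_cycle:
  "1 \<le> n \<Longrightarrow> word_perm [1..<n] k = (if k = 1 then n else if 1 < k \<and> k \<le> n then k - 1 else k)"
proof (induction n rule: dec_induct)
  case (step n)
  then have "word_perm [1..<Suc n] k = transpose n (Suc n) (word_perm [1..<n] k)"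
    by (simp add: word_perm_append word_perm_Cons)
  then show ?case using step by (auto simp: transpose_def)
qed simp

lemma word_perm_cycle_twice:
  "2 \<le> n \<Longrightarrow> word_perm ([1..<n] @ [1..<n]) k =
    (if k = 1 then n - 1 else if k = 2 then n else if 2 < k \<and> k \<le> n then k - 2 else k)"
  by (auto simp: word_perm_append word_perm_cycle)

interpretation Psi: module_hom smul smul "Psi n" for n
  by unfold_locales (simp_all add: Psi_def diag_word.add diag_word.scale pmul.add pmul.scale)

lemma Psi_Psi:
  assumes "2 \<le> n"
  shows "Psi n (Psi n P) = pmul (pvar n * pvar (n - 1)) (diag_word ([1..<n] @ [1..<n]) P)"
  using assms
  by (simp add: Psi_def diag_word_pmul fold_pol_s_pvar word_perm_cycle pmul_pmul diag_word_append)

context shape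
begin

lemma rst_module_diag_word: "P \<in> rst_module \<Longrightarrow> set ws \<subseteq> {1..<N} \<Longrightarrow> diag_word ws P \<in> rst_module"
  unfolding diag_word_def by (rule diag_s.fold_closed)

lemma diag_word_cong:
  assumes "set us \<subseteq> {1..<N}" "set vs \<subseteq> {1..<N}" "word_perm us = word_perm vs" "P \<in> rst_module"
  shows "diag_word us P = diag_word vs P"
  unfolding diag_word_def using assms by (rule diag_s.fold_eq_if_word_perm_eq)

lemma rst_module_Psi: "P \<in> rst_module \<Longrightarrow> Psi N P \<in> rst_module"
  unfolding Psi_def by (intro rst_module_pmul rst_module_diag_word) auto

lemma yang_baxter:
  assumes P: "P \<in> rst_module" "1 \<le> i" "Suc i < N" and distinct: "x \<noteq> y" "y \<noteq> z" "x \<noteq> z"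
  shows "intertwiner i x y (intertwiner (Suc i) x z (intertwiner i y z P))
    = intertwiner (Suc i) y z (intertwiner i x z (intertwiner (Suc i) x y P))"
proof -
  let ?s = "diag_s i" and ?t = "diag_s (Suc i)"
  define a b c where abc: "a = 1 / (y - z)" "b = 1 / (x - z)" "c = 1 / (x - y)"
  have braid: "?s (?t (?s P)) = ?t (?s (?t P))" using P by (intro diag_s_braid) auto
  have scalars: "b * (a + c) = a * c"
    using inverse_mult_inverse_eq[of "x - y" "y - z"] distinct by (simp add: abc algebra_simps)
  have "intertwiner i x y (intertwiner (Suc i) x z (intertwiner i y z P)) =
     ?s (?t (?s P)) + smul c (?t (?s P)) + smul a (?s (?t P)) + smul (b * (a + c)) (?s P)
       + smul (a * c) (?t P) + smul b P + smul (a * b * c) P"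
    by (simp add: intertwiner_def diag_s.add diag_s.scale smul.scale_right_distrib
        smul.scale_left_distrib algebra_simps flip: abc)
  moreover have "intertwiner (Suc i) y z (intertwiner i x z (intertwiner (Suc i) x y P)) =
     ?t (?s (?t P)) + smul c (?t (?s P)) + smul a (?s (?t P)) + smul (a * c) (?s P)
       + smul (b * (a + c)) (?t P) + smul b P + smul (a * b * c) P"
    by (simp add: intertwiner_def diag_s.add diag_s.scale smul.scale_right_distrib
        smul.scale_left_distrib algebra_simps flip: abc)
  ultimately show ?thesis unfolding braid scalars by simp
qed

lemma diag_s_Psi:
  assumes "P \<in> rst_module" "1 \<le> i" "Suc i < N"
  shows "diag_s i (Psi N P) = Psi N (diag_s (Suc i) P)"
proof -
  have "word_perm ([1..<N] @ [i]) = word_perm ([Suc i] @ [1..<N])"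
    using assms(2,3)
    by (auto simp: word_perm_append word_perm_Cons word_perm_cycle fun_eq_iff transpose_def)
  then have "diag_word ([1..<N] @ [i]) P = diag_word ([Suc i] @ [1..<N]) P"
    using assms by (intro diag_word_cong) auto
  moreover have "pol_s i (pvar N) = pvar N" using assms by (simp add: pol_s_pvar transpose_def)
  ultimately show ?thesis by (simp add: Psi_def diag_s_pmul diag_word_def)
qed

lemma diag_s_Psi_Psi:
  assumes "P \<in> rst_module" "2 \<le> N"
  shows "diag_s (N - 1) (Psi N (Psi N P)) = Psi N (Psi N (diag_s 1 P))"
proof -
  let ?cycles = "[1..<N] @ [1..<N]"
  have Suc_pred_N: "Suc (N - 1) = N" using assms(2) by simp
  have "word_perm (?cycles @ [N - 1]) = word_perm ([1] @ ?cycles)"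
  proof
    fix k
    have "word_perm (?cycles @ [N - 1]) k = transpose (N - 1) N (word_perm ?cycles k)"
      unfolding word_perm_append[of ?cycles] by (simp add: word_perm_Cons Suc_pred_N)
    moreover have "word_perm ([1] @ ?cycles) k = word_perm ?cycles (transpose 1 2 k)"
      unfolding word_perm_append[of "[1]"] by (simp add: word_perm_Cons)
    ultimately show "word_perm (?cycles @ [N - 1]) k = word_perm ([1] @ ?cycles) k"
      using assms(2) by (auto simp: word_perm_cycle_twice transpose_def)
  qed
  then have "diag_word (?cycles @ [N - 1]) P = diag_word ([1] @ ?cycles) P"
    using assms by (intro diag_word_cong) auto
  moreover have "pol_s (N - 1) (pvar N * pvar (N - 1)) = pvar N * pvar (N - 1)"
    by (simp add: pol_s_mult pol_s_pvar Suc_pred_N mult.commute)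
  ultimately show ?thesis
    unfolding Psi_Psi[OF assms(2)] diag_s_pmul by (simp add: diag_word_def)
qed

lemma intertwiner_Psi:
  "P \<in> rst_module \<Longrightarrow> 1 \<le> i \<Longrightarrow> Suc i < N \<Longrightarrow>
    intertwiner i x y (Psi N P) = Psi N (intertwiner (Suc i) x y P)"
  by (simp add: intertwiner_def diag_s_Psi Psi.add Psi.scale)

lemma intertwiner_Psi_Psi:
  "P \<in> rst_module \<Longrightarrow> 2 \<le> N \<Longrightarrow>
    intertwiner (N - 1) x y (Psi N (Psi N P)) = Psi N (Psi N (intertwiner 1 x y P))"
  by (simp add: intertwiner_def diag_s_Psi_Psi Psi.add Psi.scale)

section \<open>Path independence\<close>

definition root_poly :: tabpol where
  "root_poly = single (tau_shape lam) 1"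

lemma J_rel_root: "J_rel lam (Some (root_vertex lam)) root_poly"
  using J_rel.root by (simp add: root_poly_def tensor_one_single)

lemma J_rel_descent:
  assumes "descent i u" "J_rel lam (Some (step i u)) P"
  shows "J_rel lam (Some u) (intertwiner i (spec u i) (spec u (Suc i)) P)"
proof -
  obtain \<tau> v where step: "step i u = (\<tau>, v)" by fastforce
  have is_vertex: "is_vertex (\<tau>, v)" using is_vertex_step[of i u] assms(1) step by simp
  have "G_edge lam (Some (\<tau>, v)) (S_edge i) (Some u)"
    using G_edge_iff[OF is_vertex] arrow_from_step[OF assms(1)] step by simp
  from J_rel.s_step[OF _ this] show ?thesis
    using assms(2) step is_vertex descentD[OF assms(1)] label_descent_step[OF assms(1)]
    by (simp add: intertwiner_def zeta_eq_spectral is_vertex_def)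
qed

lemma J_rel_affine_descent:
  assumes "affine_descent u" "J_rel lam (Some (unpsi u)) P"
  shows "J_rel lam (Some u) (Psi N P)"
proof -
  obtain \<tau> v where unpsi: "unpsi u = (\<tau>, v)" by fastforce
  have "G_edge lam (Some (\<tau>, v)) Psi_edge (Some u)"
    using G_edge_iff[OF is_vertex_unpsi[OF assms(1)]] arrow_from_unpsi[OF assms(1)] unpsi by simp
  from J_rel.psi_step[OF _ this] show ?thesis using assms(2) unpsi by (simp add: sum_list_lam)
qed

lemma J_rel_rst_module: "J_rel lam x P \<Longrightarrow> P \<in> rst_module \<and> (\<forall>u. x = Some u \<longrightarrow> is_vertex u)"
proof (induction rule: J_rel.induct)
  case root
  then show ?case
    by (simp add: tensor_one_single rst_module_single rst_tau_shape is_vertex_root)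
next
  case (s_step \<tau> v P i w)
  then have arrow: "arrow lam (Some (\<tau>, v)) (S_edge i) w" by (simp add: G_edge_def)
  then have "1 \<le> i" "i < N" by (cases; simp add: sum_list_lam)+
  then have "diag_s i P + smul (1 / (zeta \<tau> v (i + 1) - zeta \<tau> v i)) P \<in> rst_module"
    using s_step.IH by (intro rst_module_add rst_module_smul rst_module_diag_s) auto
  then show ?case using arrow arrow_is_vertex s_step.IH by blast
next
  case (psi_step \<tau> v P w)
  then show ?case
    using arrow_is_vertex by (auto simp: G_edge_def sum_list_lam intro: rst_module_Psi)
qed

lemma J_rel_cases [consumes 1, case_names root descent affine]:
  assumes "J_rel lam (Some u) P"
  obtains "u = root_vertex lam" "P = root_poly"
  | i Q where "descent i u" "J_rel lam (Some (step i u)) Q"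
    "P = intertwiner i (spec u i) (spec u (Suc i)) Q"
  | Q where "affine_descent u" "J_rel lam (Some (unpsi u)) Q" "P = Psi N Q"
  using assms
proof cases
  case root
  then show ?thesis using that(1) by (simp add: root_poly_def tensor_one_single)
next
  case (s_step \<tau> v Q i)
  have is_vertex: "is_vertex (\<tau>, v)" using J_rel_rst_module[OF s_step(2)] by simp
  then have ascent: "ascent i (\<tau>, v)" "u = step i (\<tau>, v)"
    using arrow_S_iff s_step(3) by (simp_all add: G_edge_def)
  then have "descent i u" "step i u = (\<tau>, v)"
    using descent_ascent_step step_step[of i "(\<tau>, v)"] by simp_all
  moreover have "P = intertwiner i (spec u i) (spec u (Suc i)) Q"
    using s_step(1) ascentD[OF ascent(1)] is_vertex
    by (simp add: ascent(2) label_ascent_step[OF ascent(1)] intertwiner_def zeta_eq_spectral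
      is_vertex_def)
  ultimately show ?thesis using that(2)[of i Q] s_step(2) by simp
next
  case (psi_step \<tau> v Q)
  have is_vertex: "is_vertex (\<tau>, v)" using J_rel_rst_module[OF psi_step(2)] by simp
  then have "0 < N" "u = psi (\<tau>, v)" using arrow_Psi_iff psi_step(3) by (simp_all add: G_edge_def)
  then show ?thesis
    using that(3)[of Q] affine_descent_psi[OF is_vertex] unpsi_psi[OF is_vertex] psi_step(1,2)
    by (simp add: sum_list_lam)
qed

definition well_defined :: "vertex \<Rightarrow> bool" where
  "well_defined u \<longleftrightarrow> (\<exists>!P. J_rel lam (Some u) P)"

lemma J_rel_Jack: "well_defined u \<Longrightarrow> J_rel lam (Some u) (Jack lam u)"
  unfolding well_defined_def Jack_def by (rule theI')

lemma Jack_eqI: "well_defined u \<Longrightarrow> J_rel lam (Some u) P \<Longrightarrow> Jack lam u = P"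
  using J_rel_Jack unfolding well_defined_def by blast

abbreviation edge_image :: "nat \<Rightarrow> vertex \<Rightarrow> tabpol" where
  "edge_image i u \<equiv> intertwiner i (spec u (Suc i)) (spec u i) (Jack lam u)"

abbreviation descent_image :: "nat \<Rightarrow> vertex \<Rightarrow> tabpol" where
  "descent_image i u \<equiv> intertwiner i (spec u i) (spec u (Suc i)) (Jack lam (step i u))"

lemma Jack_descent_if_well_defined:
  assumes "descent i u" "well_defined u" "well_defined (step i u)"
  shows "Jack lam u = descent_image i u"
  by (rule Jack_eqI[OF assms(2) J_rel_descent[OF assms(1) J_rel_Jack[OF assms(3)]]])

lemma Jack_affine_descent_if_well_defined:
  assumes "affine_descent u" "well_defined u" "well_defined (unpsi u)"
  shows "Jack lam u = Psi N (Jack lam (unpsi u))"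
  by (rule Jack_eqI[OF assms(2) J_rel_affine_descent[OF assms(1) J_rel_Jack[OF assms(3)]]])

definition incoming :: "vertex \<Rightarrow> tabpol \<Rightarrow> bool" where
  "incoming u P \<longleftrightarrow>
    (\<exists>i. descent i u \<and> P = descent_image i u) \<or> (affine_descent u \<and> P = Psi N (Jack lam (unpsi u)))"

context
  fixes u :: vertex
  assumes well_defined_below: "\<And>w. w \<prec> u \<Longrightarrow> well_defined w"
begin

lemma Jack_descent_below:
  assumes "w \<prec> u" "descent i w"
  shows "Jack lam w = descent_image i w"
  using assms vertex_less_trans[OF descent_step_less] well_defined_below
  by (blast intro: Jack_descent_if_well_defined)

lemma Jack_affine_descent_below:
  assumes "w \<prec> u" "affine_descent w"
  shows "Jack lam w = Psi N (Jack lam (unpsi w))"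
  using assms vertex_less_trans[OF unpsi_less] well_defined_below
  by (blast intro: Jack_affine_descent_if_well_defined)

lemma Jack_rst_module_below: "w \<prec> u \<Longrightarrow> Jack lam w \<in> rst_module"
  using J_rel_rst_module J_rel_Jack well_defined_below by blast

lemma incoming_far:
  assumes "descent i u" "descent j u" "Suc (Suc i) \<le> j"
  shows "descent_image i u = descent_image j u"
proof -
  let ?J = "Jack lam (step j (step i u))"
  have "descent j (step i u)" "descent i (step j u)"
    using descent_step_far[OF assms(1,2)] descent_step_far[OF assms(2,1)] assms(3) by auto
  then have "Jack lam (step i u) = intertwiner j (spec u j) (spec u (Suc j)) ?J"
    "Jack lam (step j u) = intertwiner i (spec u i) (spec u (Suc i)) ?J"
    using assms step_commute[OF assms]
    by (simp_all add: Jack_descent_below[OF descent_step_less] label_descent_step)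
  then show ?thesis using intertwiner_commute[OF assms(3)] by simp
qed

lemma incoming_braid:
  assumes "descent i u" "descent (Suc i) u"
  shows "descent_image i u = descent_image (Suc i) u"
proof -
  note braid = descent_braid[OF assms] and less = descentD(4)[OF assms(1)] descentD(4)[OF assms(2)]
  note distinct = less[THEN spectral_neq_if_label_less]
    spectral_neq_if_label_less[OF label_less_trans[OF less(2,1)]]
  let ?J = "Jack lam (step i (step (Suc i) (step i u)))"
  have below: "step i u \<prec> u" "step (Suc i) (step i u) \<prec> u" "step (Suc i) u \<prec> u"
    "step i (step (Suc i) u) \<prec> u"
    using assms braid by (blast intro: descent_step_less vertex_less_trans)+
  have "?J \<in> rst_module"
    using braid(2) below(2)
    by (blast intro: Jack_rst_module_below descent_step_less vertex_less_trans)
  moreover have "Jack lam (step i u) = intertwiner (Suc i) (spec u i) (spec u (Suc (Suc i)))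
      (intertwiner i (spec u (Suc i)) (spec u (Suc (Suc i))) ?J)"
    using Jack_descent_below[OF below(1) braid(1)] Jack_descent_below[OF below(2) braid(2)]
      assms braid
    by (simp add: label_descent_step)
  moreover have "Jack lam (step (Suc i) u) = intertwiner i (spec u i) (spec u (Suc (Suc i)))
      (intertwiner (Suc i) (spec u i) (spec u (Suc i)) ?J)"
    using Jack_descent_below[OF below(3) braid(3)] Jack_descent_below[OF below(4) braid(4)]
      assms braid
    by (simp add: label_descent_step step_braid)
  ultimately show ?thesis
    using yang_baxter[of ?J i, OF _ _ _ distinct] descentD[OF assms(1)] descentD[OF assms(2)]
    by simp
qed

lemma incoming_affine:
  assumes "descent i u" "affine_descent u" "Suc i < N"
  shows "descent_image i u = Psi N (Jack lam (unpsi u))"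
proof -
  note i = descentD[OF assms(1)] and affine = affine_descent_step[OF assms(1,2)]
    and down = descent_unpsi[OF assms]
  let ?J = "Jack lam (step (Suc i) (unpsi u))"
  have "Jack lam (step i u) = Psi N ?J"
    using Jack_affine_descent_below[OF descent_step_less[OF assms(1)] affine] unpsi_step[OF assms]
    by simp
  moreover have "Jack lam (unpsi u) = intertwiner (Suc i) (spec u i) (spec u (Suc i)) ?J"
    using Jack_descent_below[OF unpsi_less[OF assms(2)] down] i assms(3)
    by (simp add: label_unpsi[OF assms(2)])
  moreover have "?J \<in> rst_module"
    using down assms(2)
    by (blast intro: Jack_rst_module_below descent_step_less unpsi_less vertex_less_trans)
  ultimately show ?thesis using intertwiner_Psi i(2) assms(3) by simp
qed

lemma incoming_affine_last:
  assumes "descent (N - 1) u" "affine_descent u"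
  shows "descent_image (N - 1) u = Psi N (Jack lam (unpsi u))"
proof -
  note affine = affine_descent_step[OF assms] affine_descent_unpsi[OF assms]
      unpsi_unpsi_step(1)[OF assms]
    and down = descent_unpsi_unpsi[OF assms] and u = descentD[OF assms(1)]
  have N_bounds: "2 \<le> N" "Suc (N - 1) = N" using u(2) by auto
  let ?J = "Jack lam (step 1 (unpsi (unpsi u)))"
  have below: "step (N - 1) u \<prec> u" "unpsi (step (N - 1) u) \<prec> u" "unpsi u \<prec> u" "unpsi (unpsi u) \<prec> u"
    using assms affine by (blast intro: descent_step_less unpsi_less vertex_less_trans)+
  have "Jack lam (step (N - 1) u) = Psi N (Psi N ?J)"
    using Jack_affine_descent_below[OF below(1) affine(1)]
      Jack_affine_descent_below[OF below(2) affine(3)]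
      unpsi_unpsi_step(2)[OF assms] by simp
  moreover have "Jack lam (unpsi u) = Psi N (intertwiner 1 (spec u (N - 1)) (spec u N) ?J)"
  proof -
    have "0 < fst (label u N)" "0 < fst (label u (N - 1))"
      using affine_descentD(2)[OF assms(2)] u(4) N_bounds by (auto simp: label_less_def)
    then have "intertwiner 1 (spec (unpsi (unpsi u)) 1) (spec (unpsi (unpsi u)) 2)
        = intertwiner 1 (spec u (N - 1)) (spec u N)"
      by (simp add: label_unpsi_unpsi[OF assms(2) affine(2) N_bounds(1)] spectral_lower
        intertwiner_shift)
    then show ?thesis
      using Jack_affine_descent_below[OF below(3) affine(2)] Jack_descent_below[OF below(4) down]
      by simp
  qed
  moreover have "?J \<in> rst_module"
    using down below(4) by (blast intro: Jack_rst_module_below descent_step_less vertex_less_trans)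
  ultimately show ?thesis using intertwiner_Psi_Psi N_bounds by simp
qed

lemma incoming_descents:
  assumes "descent i u" "descent j u"
  shows "descent_image i u = descent_image j u"
proof -
  consider (equal) "i = j" | (right) "Suc i = j" | (left) "Suc j = i"
    | (far_right) "Suc (Suc i) \<le> j" | (far_left) "Suc (Suc j) \<le> i"
    by linarith
  then show ?thesis
  proof cases
    case right
    then show ?thesis using incoming_braid[of i] assms by blast
  next
    case left
    then show ?thesis using incoming_braid[of j, symmetric] assms by blast
  next
    case far_right
    then show ?thesis by (rule incoming_far[OF assms])
  next
    case far_left
    then show ?thesis by (rule incoming_far[OF assms(2,1), symmetric])
  qed simp
qed

lemma incoming_descent_affine:
  assumes "descent i u" "affine_descent u"
  shows "descent_image i u = Psi N (Jack lam (unpsi u))"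
proof (cases "Suc i < N")
  case False
  then have "i = N - 1" using descentD(3)[OF assms(1)] by simp
  then show ?thesis using incoming_affine_last assms by simp
qed (rule incoming_affine[OF assms])

lemma incoming_unique: "incoming u P \<Longrightarrow> incoming u Q \<Longrightarrow> P = Q"
  unfolding incoming_def using incoming_descents incoming_descent_affine by metis

lemma J_rel_iff_incoming: "J_rel lam (Some u) P
    \<longleftrightarrow> (u = root_vertex lam \<and> P = root_poly) \<or> incoming u P"
proof
  assume "J_rel lam (Some u) P"
  then show "(u = root_vertex lam \<and> P = root_poly) \<or> incoming u P"
  proof (cases rule: J_rel_cases)
    case (descent i Q)
    have "Jack lam (step i u) = Q"
      using Jack_eqI[OF well_defined_below[OF descent_step_less[OF descent(1)]] descent(2)] .
    then show ?thesis using descent unfolding incoming_def by blast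
  next
    case (affine Q)
    have "Jack lam (unpsi u) = Q"
      using Jack_eqI[OF well_defined_below[OF unpsi_less[OF affine(1)]] affine(2)] .
    then show ?thesis using affine unfolding incoming_def by blast
  qed simp
next
  assume "(u = root_vertex lam \<and> P = root_poly) \<or> incoming u P"
  then show "J_rel lam (Some u) P"
    unfolding incoming_def
    using J_rel_root J_rel_descent J_rel_affine_descent J_rel_Jack well_defined_below
      descent_step_less unpsi_less
    by metis
qed

lemma well_defined_if_below:
  assumes "is_vertex u"
  shows "well_defined u"
proof (cases "u = root_vertex lam")
  case True
  then have "\<not> incoming u P" for P
    using not_descent_root not_affine_descent_root by (simp add: incoming_def)
  then show ?thesis unfolding well_defined_def J_rel_iff_incoming using True by auto
next
  case False
  then have "\<exists>P. incoming u P"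
    using vertex_cases[OF assms] unfolding incoming_def by metis
  then show ?thesis
    using False incoming_unique unfolding well_defined_def J_rel_iff_incoming by auto
qed

end

lemma is_vertex_well_defined: "is_vertex u \<Longrightarrow> well_defined u"
  by (induction u rule: vertex_induct) (rule well_defined_if_below)

lemma Jack_rst_module: "is_vertex u \<Longrightarrow> Jack lam u \<in> rst_module"
  using J_rel_rst_module J_rel_Jack is_vertex_well_defined by blast

lemma Jack_descent:
  assumes "descent i u"
  shows "Jack lam u = descent_image i u"
  using assms is_vertex_step[of i u]
  by (intro Jack_descent_if_well_defined is_vertex_well_defined) (auto simp: descent_def)

lemma Jack_affine_descent:
  assumes "affine_descent u"
  shows "Jack lam u = Psi N (Jack lam (unpsi u))"
  using assms is_vertex_unpsi
  by (intro Jack_affine_descent_if_well_defined is_vertex_well_defined)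
    (auto simp: affine_descent_def)

lemma Jack_root: "Jack lam (root_vertex lam) = root_poly"
  by (rule Jack_eqI[OF is_vertex_well_defined[OF is_vertex_root] J_rel_root])

lemma Jack_ascent:
  assumes "ascent i u"
  shows "Jack lam (step i u) = edge_image i u"
  using Jack_descent[OF descent_ascent_step[OF assms]] step_step[of i u] assms
  by (simp add: label_ascent_step)

end

lemma intertwiner_single:
  assumes "x - y = - of_int (axial_distance i \<tau>)" "pol_s i f = f"
  shows "intertwiner i x y (single \<tau> f)
    = smul (seminormal_coeff (axial_distance i \<tau>)) (single (interchange i \<tau>) f)"
  by (simp add: intertwiner_def diag_s_single assms)

context shape
begin

section \<open>Vertices with zero vector\<close>

lemma label_zero_vector: "1 \<le> k \<Longrightarrow> k \<le> N \<Longrightarrow> label (\<tau>, replicate N 0) k = (0, CT \<tau> k)"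
  by (simp add: label_def sigma_replicate)

lemma step_zero_vector:
  "1 \<le> i \<Longrightarrow> i < N \<Longrightarrow> step i (\<tau>, replicate N 0) = (interchange i \<tau>, replicate N 0)"
  by (simp add: step_def sigma_replicate)

lemma not_affine_descent_zero_vector: "\<not> affine_descent (\<tau>, replicate N 0)"
  by (auto simp: affine_descent_def label_def)

lemma spec_diff_zero_vector:
  "1 \<le> i \<Longrightarrow> i < N \<Longrightarrow>
    spec (\<tau>, replicate N 0) i - spec (\<tau>, replicate N 0) (Suc i) = of_int (axial_distance i \<tau>)"
  by (simp add: label_zero_vector spectral_def axial_distance_def)

lemma Jack_zero_vector:
  assumes "rst \<tau>"
  shows "Jack lam (\<tau>, replicate N 0) = single \<tau> 1"
proof -
  have "snd u = replicate N 0 \<longrightarrow> Jack lam u = single (fst u) 1" if "is_vertex u" for u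
    using that
  proof (induction u rule: vertex_induct)
    case (vertex u)
    show ?case
    proof
      assume "snd u = replicate N 0"
      then obtain \<tau> where u: "u = (\<tau>, replicate N 0)" by (cases u) simp
      from vertex(1) show "Jack lam u = single (fst u) 1"
      proof (cases rule: vertex_cases)
        case root
        then show ?thesis using Jack_root by (simp add: root_poly_def root_vertex_def)
      next
        case affine
        then show ?thesis using not_affine_descent_zero_vector u by simp
      next
        case (descent i)
        note i = descentD[OF descent]
        have distance: "axial_distance i \<tau> \<le> -2"
          using i by (simp add: u label_zero_vector label_less_def axial_distance_def)
        have "Jack lam (step i u) = single (interchange i \<tau>) 1"
          using vertex(2)[OF descent_step_less[OF descent]] i by (simp add: u step_zero_vector)
        moreover have "spec u i - spec u (Suc i) = - of_int (axial_distance i (interchange i \<tau>))"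
          using spec_diff_zero_vector[OF i(2,3)] by (simp add: u axial_distance_interchange)
        ultimately show ?thesis
          unfolding Jack_descent[OF descent]
          using distance intertwiner_single[of _ _ i "interchange i \<tau>" 1]
          by (simp add: axial_distance_interchange seminormal_coeff_def u)
      qed
    qed
  qed
  from this[of "(\<tau>, replicate N 0)"] show ?thesis using assms by (simp add: is_vertex_def)
qed

lemma vertex_entry_cases [consumes 1, case_names zero affine entry]:
  assumes u: "is_vertex u"
  obtains "snd u = replicate N 0" | "affine_descent u"
    | i where "1 \<le> i" "i < N" "entry (snd u) (Suc i) < entry (snd u) i"
proof (cases "affine_descent u")
  case False
  show ?thesis
  proof (cases "sorted (snd u)")
    case True
    then have "snd u = replicate N 0"
      using sorted_zero_last last_eq_0_if_not_affine_descent[OF u False] is_vertexD(2)[OF u]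
      by metis
    then show ?thesis by (rule that(1))
  next
    case False
    then show ?thesis
      using that(3) is_vertexD(2)[OF u] unfolding sorted_iff_entries by (metis not_less)
  qed
qed (rule that(2))

section \<open>Edges into the empty vertex\<close>

lemma falls_zero_vector:
  assumes "falls i (\<tau>, replicate N 0)"
  shows "edge_image i (\<tau>, replicate N 0) = 0"
proof -
  note i = fallsD[OF assms]
  have "\<bar>axial_distance i \<tau>\<bar> = 1"
    using i by (simp add: label_zero_vector label_adjacent_def axial_distance_def)
  then have "seminormal_coeff (axial_distance i \<tau>) = 0" by (auto simp: seminormal_coeff_def)
  moreover have "Jack lam (\<tau>, replicate N 0) = single \<tau> 1"
    using i(1) by (intro Jack_zero_vector) (simp add: is_vertex_def)
  moreover have "spec (\<tau>, replicate N 0) (Suc i) - spec (\<tau>, replicate N 0) i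
      = - of_int (axial_distance i \<tau>)"
    using spec_diff_zero_vector[OF i(2,3), of \<tau>] by (simp add: algebra_simps)
  ultimately show ?thesis using intertwiner_single[of _ _ i \<tau> 1] by simp
qed

context
  fixes u :: vertex
  assumes falls_below: "\<And>w i. w \<prec> u \<Longrightarrow> falls i w \<Longrightarrow> edge_image i w = 0"
begin

lemma falls_affine:
  assumes "falls i u" "affine_descent u" "Suc i < N"
  shows "edge_image i u = 0"
proof -
  note i = fallsD[OF assms(1)] and w = is_vertex_unpsi[OF assms(2)]
  have labels: "label (unpsi u) (Suc i) = label u i"
    "label (unpsi u) (Suc (Suc i)) = label u (Suc i)"
    using i assms(3) by (simp_all add: label_unpsi[OF assms(2)])
  have falls: "falls (Suc i) (unpsi u)" using i w assms(3) by (simp add: falls_def labels)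
  have "intertwiner (Suc i) (spec u (Suc i)) (spec u i) (Jack lam (unpsi u)) = 0"
    using falls_below[OF unpsi_less[OF assms(2)] falls] labels by simp
  then show ?thesis
    using intertwiner_Psi[OF Jack_rst_module[OF w] i(2) assms(3)]
    by (simp add: Jack_affine_descent[OF assms(2)])
qed

lemma falls_affine_last:
  assumes "falls (N - 1) u" "affine_descent u"
  shows "edge_image (N - 1) u = 0"
proof -
  note u = fallsD[OF assms(1)] and w = is_vertex_unpsi[OF assms(2)]
  have N_bounds: "2 \<le> N" "Suc (N - 1) = N" using u(2) by auto
  have positive: "0 < fst (label u N)" "0 < fst (label u (N - 1))"
    using affine_descentD(2)[OF assms(2)] u(4) N_bounds by (auto simp: label_adjacent_def)
  then have affine: "affine_descent (unpsi u)"
    using w N_bounds by (simp add: affine_descent_def label_unpsi[OF assms(2)])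
  note label = label_unpsi_unpsi[OF assms(2) affine N_bounds(1)]
  have falls: "falls 1 (unpsi (unpsi u))"
    using is_vertex_unpsi[OF affine] u(4) N_bounds
    by (auto simp: falls_def label label_adjacent_def)
  have "intertwiner 1 (spec (unpsi (unpsi u)) 2) (spec (unpsi (unpsi u)) 1)
      (Jack lam (unpsi (unpsi u))) = 0"
    using falls_below[OF vertex_less_trans[OF unpsi_less[OF affine] unpsi_less[OF assms(2)]] falls]
    by simp
  then have "intertwiner 1 (spec u N) (spec u (N - 1)) (Jack lam (unpsi (unpsi u))) = 0"
    using positive by (simp add: label spectral_lower intertwiner_shift)
  moreover have "Jack lam u = Psi N (Psi N (Jack lam (unpsi (unpsi u))))"
    by (simp add: Jack_affine_descent assms(2) affine)
  ultimately show ?thesis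
    using intertwiner_Psi_Psi[OF Jack_rst_module[OF is_vertex_unpsi[OF affine]] N_bounds(1)]
      N_bounds(2) by simp
qed

lemma falls_descent_far:
  assumes "falls i u" "descent j u" "Suc (Suc i) \<le> j \<or> Suc (Suc j) \<le> i"
  shows "edge_image i u = 0"
proof -
  note label = label_descent_step[OF assms(2)]
  have labels: "label (step j u) i = label u i" "label (step j u) (Suc i) = label u (Suc i)"
    using assms(3) by (auto simp: label)
  have falls: "falls i (step j u)"
    using assms(1,2) is_vertex_step[of j u] by (simp add: falls_def labels)
  have "intertwiner i (spec u (Suc i)) (spec u i) (Jack lam (step j u)) = 0"
    using falls_below[OF descent_step_less[OF assms(2)] falls] labels by simp
  then show ?thesis
    using assms(3) unfolding Jack_descent[OF assms(2)]
    by (metis intertwiner.zero intertwiner_commute)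
qed

lemma falls_descent_right:
  assumes "falls i u" "descent (Suc i) u" "fst (label u (Suc (Suc i))) < fst (label u (Suc i))"
  shows "edge_image i u = 0"
proof -
  note i = fallsD[OF assms(1)] and j = descentD[OF assms(2)]
  let ?x = "label u i" and ?y = "label u (Suc i)" and ?z = "label u (Suc (Suc i))"
  have less: "?z \<sqsubset> ?x" "?z \<sqsubset> ?y"
    using assms(3) i(4) by (auto simp: label_less_def label_adjacent_def)
  have adjacent: "spectral ?y \<noteq> spectral ?x"
    using spectral_diff_label_adjacent[OF i(4)] i(4) by (auto simp: label_adjacent_def)
  let ?w = "step i (step (Suc i) u)"
  have down: "descent i (step (Suc i) u)"
    using i less is_vertex_step[of "Suc i" u] assms(2)
    by (simp add: descent_def label_descent_step[OF assms(2)])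
  have label_w: "label ?w = label u \<circ> transpose (Suc i) (Suc (Suc i)) \<circ> transpose i (Suc i)"
    using assms(2) down by (simp add: label_descent_step)
  have below: "?w \<prec> u" using down assms(2) by (blast intro: descent_step_less vertex_less_trans)
  have falls: "falls (Suc i) ?w"
    using i(4) j(3) is_vertex_if_less[OF below] by (simp add: falls_def label_w)
  have "intertwiner (Suc i) (spectral ?y) (spectral ?x) (Jack lam ?w) = 0"
    using falls_below[OF below falls] by (simp add: label_w)
  moreover have "Jack lam u = intertwiner (Suc i) (spectral ?y) (spectral ?z)
      (intertwiner i (spectral ?x) (spectral ?z) (Jack lam ?w))"
    using Jack_descent[OF assms(2)] Jack_descent[OF down]
    by (simp add: label_descent_step[OF assms(2)])
  ultimately show ?thesis
    using yang_baxter[OF Jack_rst_module[OF is_vertex_if_less[OF below]] i(2) j(3) adjacent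
        less[THEN spectral_neq_if_label_less]] by simp
qed

lemma falls_descent_left:
  assumes "falls (Suc i) u" "descent i u" "fst (label u (Suc i)) < fst (label u i)"
  shows "edge_image (Suc i) u = 0"
proof -
  note j = fallsD[OF assms(1)] and i = descentD[OF assms(2)]
  let ?z = "label u i" and ?x = "label u (Suc i)" and ?y = "label u (Suc (Suc i))"
  have less: "?y \<sqsubset> ?z" "?x \<sqsubset> ?z"
    using assms(3) j(4) by (auto simp: label_less_def label_adjacent_def)
  have adjacent: "spectral ?y \<noteq> spectral ?x"
    using spectral_diff_label_adjacent[OF j(4)] j(4) by (auto simp: label_adjacent_def)
  let ?w = "step (Suc i) (step i u)"
  have down: "descent (Suc i) (step i u)"
    using j less is_vertex_step[of i u] assms(2)
    by (simp add: descent_def label_descent_step[OF assms(2)])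
  have label_w: "label ?w = label u \<circ> transpose i (Suc i) \<circ> transpose (Suc i) (Suc (Suc i))"
    using assms(2) down by (simp add: label_descent_step)
  have below: "?w \<prec> u" using down assms(2) by (blast intro: descent_step_less vertex_less_trans)
  have falls: "falls i ?w"
    using j(4) i(2,3) is_vertex_if_less[OF below] by (simp add: falls_def label_w)
  have "intertwiner i (spectral ?y) (spectral ?x) (Jack lam ?w) = 0"
    using falls_below[OF below falls] by (simp add: label_w)
  moreover have "Jack lam u = intertwiner i (spectral ?z) (spectral ?x)
      (intertwiner (Suc i) (spectral ?z) (spectral ?y) (Jack lam ?w))"
    using Jack_descent[OF assms(2)] Jack_descent[OF down]
    by (simp add: label_descent_step[OF assms(2)])
  ultimately show ?thesis
    using yang_baxter[OF Jack_rst_module[OF is_vertex_if_less[OF below]] i(2) j(3)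
        less(1)[THEN spectral_neq_if_label_less] adjacent
        less(2)[THEN spectral_neq_if_label_less], symmetric]
    by simp
qed

lemma falls_entry_descent:
  assumes "falls i u" "1 \<le> j" "j < N" "entry (snd u) (Suc j) < entry (snd u) j"
  shows "edge_image i u = 0"
proof -
  note i = fallsD[OF assms(1)]
  have descent: "descent j u" by (rule descent_if_entry_less[OF i(1) assms(2-4)])
  have less: "fst (label u (Suc j)) < fst (label u j)"
    using i(1) assms(2-4) by (simp add: label_nth)
  then have "j \<noteq> i" using i(4) by (auto simp: label_adjacent_def)
  then consider "Suc (Suc i) \<le> j \<or> Suc (Suc j) \<le> i" | "j = Suc i" | "i = Suc j" by linarith
  then show ?thesis
    using falls_descent_far[OF assms(1) descent] falls_descent_right[of i] falls_descent_left[of j]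
      assms(1) descent less by cases auto
qed

end

lemma Jack_falls:
  assumes "falls i u"
  shows "edge_image i u = 0"
proof -
  have "\<forall>i. falls i u \<longrightarrow> edge_image i u = 0" if "is_vertex u" for u
    using that
  proof (induction u rule: vertex_induct)
    case (vertex u)
    have below: "\<And>w i. w \<prec> u \<Longrightarrow> falls i w \<Longrightarrow> edge_image i w = 0"
      using vertex(2) by blast
    show ?case
    proof (intro allI impI)
      fix i assume falls: "falls i u"
      from vertex(1) show "edge_image i u = 0"
      proof (cases rule: vertex_entry_cases)
        case zero
        then show ?thesis using falls_zero_vector[of i "fst u"] falls by (cases u) simp
      next
        case affine
        show ?thesis
        proof (cases "Suc i < N")
          case False
          then have "i = N - 1" using fallsD(3)[OF falls] by simp
          then show ?thesis using falls_affine_last[OF below] falls affine by simp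
        qed (rule falls_affine[OF below falls affine])
      next
        case (entry j)
        show ?thesis by (rule falls_entry_descent[OF below falls entry])
      qed
    qed
  qed
  then show ?thesis using assms fallsD(1) by blast
qed

end

section \<open>Coefficients of monomials\<close>

definition monomial_coeff :: "(nat \<Rightarrow>\<^sub>0 nat) \<Rightarrow> tabpol \<Rightarrow> tabpol" where
  "monomial_coeff m P = Poly_Mapping.map (\<lambda>f. pconst (lookup f m)) P"

lemma lookup_monomial_coeff [simp]: "lookup (monomial_coeff m P) \<tau> = pconst (lookup (lookup P \<tau>) m)"
  by (simp add: monomial_coeff_def map.rep_eq when_def)

interpretation monomial_coeff: module_hom smul smul "monomial_coeff m" for m
  by unfold_locales (auto intro!: poly_mapping_eqI simp: lookup_add pconst_add pconst_mult)

lemma monomial_coeff_single: "monomial_coeff m (single \<tau> f) = single \<tau> (pconst (lookup f m))"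
  by (rule poly_mapping_eqI) (simp add: lookup_single when_def)

lemma monomial_coeff_diag_s:
  "monomial_coeff m (diag_s i P) = diag_s i (monomial_coeff (swap_exponents i m) P)"
  by (rule additive_eqI_keys[where F = "\<lambda>P. monomial_coeff m (diag_s i P)"
        and G = "\<lambda>P. diag_s i (monomial_coeff (swap_exponents i m) P)"])
    (auto simp: additive_def diag_s.add monomial_coeff.add diag_s_single monomial_coeff.scale
      monomial_coeff_single)

lemma monomial_coeff_intertwiner:
  "monomial_coeff m (intertwiner i x y P)
    = diag_s i (monomial_coeff (swap_exponents i m) P) + smul (1 / (x - y)) (monomial_coeff m P)"
  by (simp add: intertwiner_def monomial_coeff.add monomial_coeff.scale monomial_coeff_diag_s)

definition perm_exponents :: "nat list \<Rightarrow> (nat \<Rightarrow>\<^sub>0 nat) \<Rightarrow> (nat \<Rightarrow>\<^sub>0 nat)" where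
  "perm_exponents ws m = Poly_Mapping.map_key (word_perm ws) m"

lemma lookup_perm_exponents [simp]: "lookup (perm_exponents ws m) k = lookup m (word_perm ws k)"
  by (simp add: perm_exponents_def map_key.rep_eq inj_word_perm)

lemma monomial_coeff_diag_word:
  "monomial_coeff m (diag_word ws P) = diag_word ws (monomial_coeff (perm_exponents ws m) P)"
proof (induction ws arbitrary: P)
  case Nil
  have "perm_exponents [] m = m" by (rule poly_mapping_eqI) simp
  then show ?case by (simp add: diag_word_def)
next
  case (Cons i ws)
  have "swap_exponents i (perm_exponents ws m) = perm_exponents (i # ws) m"
    by (rule poly_mapping_eqI) (simp add: word_perm_Cons)
  then show ?case using Cons[of "diag_s i P"] by (simp add: diag_word_def monomial_coeff_diag_s)
qed

lemma single_add_eq_iff: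
  fixes m m' :: "'a \<Rightarrow>\<^sub>0 nat"
  shows "single k 1 + m' = m \<longleftrightarrow> 0 < lookup m k \<and> m' = m - single k 1"
proof
  assume subtract: "0 < lookup m k \<and> m' = m - single k 1"
  show "single k 1 + m' = m"
  proof (rule poly_mapping_eqI)
    fix l show "lookup (single k 1 + m') l = lookup m l"
      using subtract by (cases "l = k") (auto simp: lookup_add lookup_minus lookup_single)
  qed
qed (auto simp: lookup_add)

lemma lookup_pvar_mult:
  "lookup (pvar k * f) m = (if 0 < lookup m k then lookup f (m - single k 1) else 0)"
proof (rule additive_eqI_keys[where F = "\<lambda>f. lookup (pvar k * f) m"
      and G = "\<lambda>f. if 0 < lookup m k then lookup f (m - single k 1) else 0"])
  fix m' :: "nat \<Rightarrow>\<^sub>0 nat" and c :: qalpha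
  show "lookup (pvar k * single m' c) m
      = (if 0 < lookup m k then lookup (single m' c) (m - single k 1) else 0)"
    using single_add_eq_iff[of k m' m] by (auto simp: pvar_def mult_single lookup_single when_def)
qed (auto simp: additive_def algebra_simps lookup_add)

lemma monomial_coeff_Psi:
  "monomial_coeff m (Psi n P) = (if 0 < lookup m n
    then diag_word [1..<n] (monomial_coeff (perm_exponents [1..<n] (m - single n 1)) P) else 0)"
proof -
  have "monomial_coeff m (pmul (pvar k) P)
      = (if 0 < lookup m k then monomial_coeff (m - single k 1) P else 0)" for k P
    by (rule poly_mapping_eqI) (simp add: lookup_pvar_mult)
  then show ?thesis by (simp add: Psi_def monomial_coeff_diag_word)
qed

definition exponent :: "nat list \<Rightarrow> (nat \<Rightarrow>\<^sub>0 nat)" where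
  "exponent v = (\<Sum>k\<in>{1..length v}. single k (entry v k))"

lemma lookup_exponent: "lookup (exponent v) k = (if 1 \<le> k \<and> k \<le> length v then entry v k else 0)"
proof -
  have "lookup (exponent v) k = (\<Sum>j\<in>{1..length v}. if j = k then entry v k else 0)"
    unfolding exponent_def lookup_sum by (rule sum.cong) (auto simp: lookup_single when_def)
  then show ?thesis by (auto simp: sum.delta)
qed

section \<open>The order on exponents\<close>

text \<open>\<open>level n f t r\<close> is the number of integers \<open>k + n (j - f k) \<le> r - n t\<close> with
  \<open>1 \<le> k \<le> n\<close>, \<open>j \<ge> 0\<close>. On such sets of integers \<open>\<Psi>\<close> is a shift and the affine symmetric
  group acts naturally; comparing the counts is containment of the associated core partitions,
  hence compatible with both actions.\<close>

definition level :: "nat \<Rightarrow> (nat \<Rightarrow> nat) \<Rightarrow> nat \<Rightarrow> nat \<Rightarrow> nat" where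
  "level n f t r = (\<Sum>k\<in>{1..n}. f k + of_bool (k \<le> r) - t)"

definition level_le :: "nat \<Rightarrow> (nat \<Rightarrow> nat) \<Rightarrow> (nat \<Rightarrow> nat) \<Rightarrow> bool" where
  "level_le n f g \<longleftrightarrow> (\<forall>t r. r \<le> n \<longrightarrow> level n f t r \<le> level n g t r)"

lemma level_cong: "(\<And>k. 1 \<le> k \<Longrightarrow> k \<le> n \<Longrightarrow> f k = g k) \<Longrightarrow> level n f = level n g"
  unfolding level_def by (intro ext sum.cong) auto

lemma level_le_cong:
  assumes "\<And>k. 1 \<le> k \<Longrightarrow> k \<le> n \<Longrightarrow> f k = f' k" "\<And>k. 1 \<le> k \<Longrightarrow> k \<le> n \<Longrightarrow> g k = g' k"
  shows "level_le n f g \<longleftrightarrow> level_le n f' g'"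
  unfolding level_le_def using level_cong[of n f f'] level_cong[of n g g'] assms by simp

lemma level_le_refl [simp]: "level_le n f f"
  by (simp add: level_le_def)

lemma level_le_trans: "level_le n f g \<Longrightarrow> level_le n g h \<Longrightarrow> level_le n f h"
  unfolding level_le_def by (meson order_trans)

lemma level_Suc:
  assumes "r < n"
  shows "level n f t (Suc r) = level n f t r + of_bool (t \<le> f (Suc r))"
proof -
  have "Suc r \<in> {1..n}" using assms by auto
  moreover have "(\<Sum>k\<in>{1..n} - {Suc r}. f k + of_bool (k \<le> Suc r) - t)
      = (\<Sum>k\<in>{1..n} - {Suc r}. f k + of_bool (k \<le> r) - t)"
    by (rule sum.cong) auto
  ultimately show ?thesis unfolding level_def by (subst (1 2) sum.remove[of _ "Suc r"]) auto
qed

lemma level_pred: "1 \<le> i \<Longrightarrow> i < n \<Longrightarrow> level n f t i = level n f t (i - 1) + of_bool (t \<le> f i)"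
  using level_Suc[of "i - 1" n f t] by simp

lemma level_eq_card: "r \<le> n \<Longrightarrow> level n f t r = level n f t 0 + card {k \<in> {1..r}. t \<le> f k}"
proof (induction r)
  case (Suc r)
  have "{k \<in> {1..Suc r}. t \<le> f k} = {k \<in> {1..r}. t \<le> f k} \<union> (if t \<le> f (Suc r) then {Suc r} else {})"
    by (auto simp: le_Suc_eq)
  then have "card {k \<in> {1..Suc r}. t \<le> f k} = card {k \<in> {1..r}. t \<le> f k} + of_bool (t \<le> f (Suc r))"
    by (auto simp: card_insert_if)
  then show ?case using Suc level_Suc[of r n f t] by simp
qed simp

lemma level_0_0: "level n f 0 0 = (\<Sum>k\<in>{1..n}. f k)"
  unfolding level_def by (rule sum.cong) auto

lemma level_transpose_other:
  assumes "1 \<le> i" "i < n" "r \<noteq> i"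
  shows "level n (f \<circ> transpose i (Suc i)) t r = level n f t r"
proof -
  let ?t = "transpose i (Suc i)"
  have "?t permutes {1..n}" using assms by (intro permutes_swap_id) auto
  moreover have "level n (f \<circ> ?t) t r = (\<Sum>k\<in>{1..n}. ((\<lambda>k. f k + of_bool (k \<le> r) - t) \<circ> ?t) k)"
    unfolding level_def using assms by (intro sum.cong) (auto simp: transpose_def)
  ultimately show ?thesis unfolding level_def by (simp only: sum.permute[symmetric])
qed

lemma level_transpose_same:
  assumes "1 \<le> i" "i < n"
  shows "level n (f \<circ> transpose i (Suc i)) t i = level n f t (i - 1) + of_bool (t \<le> f (Suc i))"
  using assms level_pred[OF assms, of "f \<circ> transpose i (Suc i)"]
    level_transpose_other[of i n "i - 1"] by simp

lemma level_le_transpose: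
  assumes i: "1 \<le> i" "i < n" and g_le: "g i \<le> g (Suc i)" and f_le_g: "level_le n f g"
  shows "level_le n (f \<circ> transpose i (Suc i)) (g \<circ> transpose i (Suc i))"
  unfolding level_le_def
proof (intro allI impI)
  fix t r assume r_le: "r \<le> n"
  show "level n (f \<circ> transpose i (Suc i)) t r \<le> level n (g \<circ> transpose i (Suc i)) t r"
  proof (cases "r = i")
    case True
    have two_steps: "level n h t (Suc i) = level n h t (i - 1) + of_bool (t \<le> h i)
        + of_bool (t \<le> h (Suc i))" for h
      using level_Suc[of i n h t] level_pred[OF i, of h t] i by simp
    have "level n f t (i - 1) \<le> level n g t (i - 1)" "level n f t (Suc i) \<le> level n g t (Suc i)"
      using f_le_g i by (auto simp: level_le_def)
    then show ?thesis
      unfolding True level_transpose_same[OF i] using two_steps[of f] two_steps[of g] g_le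
      by (auto simp: of_bool_def split: if_splits)
  next
    case False
    then show ?thesis using level_transpose_other[OF i] f_le_g r_le by (simp add: level_le_def)
  qed
qed

lemma level_le_transpose_if_le:
  assumes "1 \<le> i" "i < n" "g i \<le> g (Suc i)"
  shows "level_le n g (g \<circ> transpose i (Suc i))"
  unfolding level_le_def
proof (intro allI impI)
  fix t r assume "r \<le> n"
  show "level n g t r \<le> level n (g \<circ> transpose i (Suc i)) t r"
    using level_transpose_same[OF assms(1,2), of g t] level_pred[OF assms(1,2), of g t]
      level_transpose_other[OF assms(1,2), of r g t] assms(3) by (cases "r = i") auto
qed

lemma not_level_le_transpose:
  assumes "1 \<le> i" "i < n" "g i < g (Suc i)"
  shows "\<not> level_le n (g \<circ> transpose i (Suc i)) g"
proof
  assume "level_le n (g \<circ> transpose i (Suc i)) g"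
  then have "level n (g \<circ> transpose i (Suc i)) (g (Suc i)) i \<le> level n g (g (Suc i)) i"
    using assms by (simp add: level_le_def)
  then show False
    using level_transpose_same[OF assms(1,2), of g "g (Suc i)"]
      level_pred[OF assms(1,2), of g "g (Suc i)"] assms(3)
    by simp
qed

definition affine_rotation :: "nat \<Rightarrow> (nat \<Rightarrow> nat) \<Rightarrow> nat \<Rightarrow> nat" where
  "affine_rotation n g k = (if k = n then Suc (g 1) else g (Suc k))"

lemma sum_shift_first:
  fixes F :: "nat \<Rightarrow> 'a::comm_monoid_add"
  shows "(\<Sum>k\<in>{1..Suc n}. F k) = F 1 + (\<Sum>k\<in>{1..n}. F (Suc k))"
proof -
  have "(\<Sum>k\<in>{1..Suc n}. F k) = F 1 + (\<Sum>k\<in>{Suc 1..Suc n}. F k)"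
    by (rule sum.atLeast_Suc_atMost) simp
  then show ?thesis by (simp only: sum.shift_bounds_cl_Suc_ivl)
qed

lemma level_affine_rotation:
  assumes "r < n"
  shows "level n (affine_rotation n g) t r = level n g t (Suc r)"
proof -
  obtain m where n_eq: "n = Suc m" using assms by (cases n) auto
  have "level n (affine_rotation n g) t r
      = (\<Sum>k\<in>{1..m}. g (Suc k) + of_bool (k \<le> r) - t) + (Suc (g 1) - t)"
    unfolding level_def n_eq using assms n_eq by (auto simp: affine_rotation_def intro!: sum.cong)
  moreover have "level n g t (Suc r) = (Suc (g 1) - t)
      + (\<Sum>k\<in>{1..m}. g (Suc k) + of_bool (k \<le> r) - t)"
    unfolding level_def n_eq sum_shift_first by simp
  ultimately show ?thesis by simp
qed

lemma level_affine_rotation_top: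
  assumes "0 < n"
  shows "level n (affine_rotation n g) t n
      = (if t = 0 then level n g 0 0 + n + 1 else level n g (t - 1) 1)"
proof -
  obtain m where n_eq: "n = Suc m" using assms by (cases n) auto
  have "level n (affine_rotation n g) t n
      = (\<Sum>k\<in>{1..m}. Suc (g (Suc k)) - t) + (Suc (Suc (g 1)) - t)"
    unfolding level_def n_eq by (auto simp: affine_rotation_def intro!: sum.cong)
  moreover have "level n g (s - 1) 1
      = (Suc (Suc (g 1)) - s) + (\<Sum>k\<in>{1..m}. Suc (g (Suc k)) - s)" if "s \<noteq> 0" for s
  proof -
    have "g (Suc k) - (s - 1) = Suc (g (Suc k)) - s" for k using that by simp
    then show ?thesis unfolding level_def n_eq sum_shift_first using that by simp
  qed
  moreover have "level n g 0 0 = g 1 + (\<Sum>k\<in>{1..m}. g (Suc k))"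
    unfolding level_0_0 n_eq sum_shift_first ..
  ultimately show ?thesis by (auto simp: n_eq sum.distrib sum_Suc)
qed

lemma level_le_affine_rotation:
  assumes "0 < n" "level_le n f g"
  shows "level_le n (affine_rotation n f) (affine_rotation n g)"
  unfolding level_le_def
proof (intro allI impI)
  fix t r assume r_le: "r \<le> n"
  have f_le_g: "level n f t s \<le> level n g t s" if "s \<le> n" for t s
    using assms(2) that by (simp add: level_le_def)
  show "level n (affine_rotation n f) t r \<le> level n (affine_rotation n g) t r"
  proof (cases "r < n")
    case True
    then show ?thesis using level_affine_rotation[OF True] f_le_g[of "Suc r" t] by simp
  next
    case False
    then have "r = n" using r_le by simp
    then show ?thesis
      using level_affine_rotation_top[OF assms(1)] f_le_g[of 0 0] f_le_g[of 1 "t - 1"] assms(1)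
      by simp
  qed
qed

lemma level_le_antimono_imp_eq:
  assumes antimono: "\<And>j k. 1 \<le> j \<Longrightarrow> j \<le> k \<Longrightarrow> k \<le> n \<Longrightarrow> f k \<le> f j"
    and level_0: "\<And>t. level n f t 0 = level n g t 0"
    and f_le_g: "level_le n f g" and k_range: "1 \<le> k" "k \<le> n"
  shows "f k = g k"
proof (rule ccontr)
  have pointwise_le: "f k \<le> g k" if "1 \<le> k" "k \<le> n" for k
  proof -
    have "level n f (f k) k \<le> level n g (f k) k" using f_le_g that by (simp add: level_le_def)
    then have "card {j \<in> {1..k}. f k \<le> f j} \<le> card {j \<in> {1..k}. f k \<le> g j}"
      using level_eq_card[of k n f "f k"] level_eq_card[of k n g "f k"] level_0 that by simp
    moreover have "{j \<in> {1..k}. f k \<le> f j} = {1..k}" using antimono that by auto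
    ultimately have "card {1..k} \<le> card {j \<in> {1..k}. f k \<le> g j}" by simp
    then have "{j \<in> {1..k}. f k \<le> g j} = {1..k}" by (intro card_seteq) auto
    then have "k \<in> {j \<in> {1..k}. f k \<le> g j}" using that by simp
    then show ?thesis by simp
  qed
  assume "f k \<noteq> g k"
  then have "f k < g k" using pointwise_le[OF k_range] by simp
  then have "(\<Sum>j\<in>{1..n}. f j) < (\<Sum>j\<in>{1..n}. g j)"
    using k_range pointwise_le by (intro sum_strict_mono_ex1) auto
  then show False using level_0[of 0] by (simp add: level_0_0)
qed

section \<open>Leading monomials\<close>

context shape
begin

definition leading_word :: "nat list \<Rightarrow> nat list \<Rightarrow> bool" where
  "leading_word v ws \<longleftrightarrow> (\<forall>\<tau>. rst \<tau> \<longrightarrow>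
    monomial_coeff (exponent v) (Jack lam (\<tau>, v)) = diag_word ws (single \<tau> 1) \<and>
    (\<forall>m. monomial_coeff m (Jack lam (\<tau>, v)) \<noteq> 0 \<longrightarrow> level_le N (lookup m) (entry v)))"

lemma leading_wordD:
  assumes "leading_word v ws" "rst \<tau>"
  shows "monomial_coeff (exponent v) (Jack lam (\<tau>, v)) = diag_word ws (single \<tau> 1)"
    and "monomial_coeff m (Jack lam (\<tau>, v)) \<noteq> 0 \<Longrightarrow> level_le N (lookup m) (entry v)"
  using assms by (auto simp: leading_word_def)

lemma leading_word_zero_vector: "leading_word (replicate N 0) []"
  unfolding leading_word_def
proof (intro allI impI conjI)
  fix \<tau> assume \<tau>: "rst \<tau>"
  have "exponent (replicate N 0) = 0"
    by (rule poly_mapping_eqI) (simp add: lookup_exponent)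
  then show "monomial_coeff (exponent (replicate N 0)) (Jack lam (\<tau>, replicate N 0))
      = diag_word [] (single \<tau> 1)"
    by (simp add: Jack_zero_vector[OF \<tau>] monomial_coeff_single diag_word_def)
  fix m assume "monomial_coeff m (Jack lam (\<tau>, replicate N 0)) \<noteq> 0"
  then have "m = 0"
    by (cases "m = 0") (simp_all add: Jack_zero_vector[OF \<tau>] monomial_coeff_single lookup_one)
  then show "level_le N (lookup m) (entry (replicate N 0))"
    using level_le_cong[of N "lookup m" "\<lambda>_. 0" "entry (replicate N 0)" "\<lambda>_. 0"] by simp
qed

lemma entry_vpsi_eq_rotation:
  assumes "length v = N" "1 \<le> k" "k \<le> N"
  shows "entry (vpsi v) k = affine_rotation N (entry v) k"
proof -
  have "v \<noteq> []" using assms by auto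
  then show ?thesis using assms entry_vpsi[of v k] by (simp add: affine_rotation_def)
qed

lemma unrotate_exponent_vpsi:
  assumes "length v = N" "0 < N"
  shows "perm_exponents [1..<N] (exponent (vpsi v) - single N 1) = exponent v"
proof (rule poly_mapping_eqI)
  fix k
  have length_vpsi_v: "length (vpsi v) = N" using assms by (simp add: vpsi_def)
  note entry_rotation = entry_vpsi_eq_rotation[OF assms(1)]
  consider (first) "k = 1" | (later) "1 < k" "k \<le> N" | (outside) "k = 0 \<or> N < k" by linarith
  then show "lookup (perm_exponents [1..<N] (exponent (vpsi v) - single N 1)) k
      = lookup (exponent v) k"
  proof cases
    case first
    then show ?thesis
      using assms length_vpsi_v entry_rotation[of N]
      by (simp add: word_perm_cycle lookup_minus lookup_exponent affine_rotation_def)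
  next
    case later
    then show ?thesis
      using assms length_vpsi_v entry_rotation[of "k - 1"]
      by (auto simp: word_perm_cycle lookup_minus lookup_exponent affine_rotation_def lookup_single
        when_def)
  next
    case outside
    then show ?thesis
      using assms length_vpsi_v by (auto simp: word_perm_cycle lookup_minus lookup_exponent)
  qed
qed

lemma leading_word_vpsi:
  assumes v: "length v = N" "0 < N" and ws: "leading_word v ws"
  shows "leading_word (vpsi v) (ws @ [1..<N])"
  unfolding leading_word_def
proof (intro allI impI conjI)
  fix \<tau> assume \<tau>: "rst \<tau>"
  have vertex: "is_vertex (\<tau>, v)" using \<tau> v by (simp add: is_vertex_def)
  have Jack_vpsi: "Jack lam (\<tau>, vpsi v) = Psi N (Jack lam (\<tau>, v))"
    using Jack_affine_descent[OF affine_descent_psi[OF vertex v(2)]] unpsi_psi[OF vertex v(2)]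
    by (simp add: psi_def)
  have "0 < lookup (exponent (vpsi v)) N"
    using v entry_vpsi_eq_rotation[OF v(1), of N]
    by (simp add: lookup_exponent affine_rotation_def vpsi_def)
  then show "monomial_coeff (exponent (vpsi v)) (Jack lam (\<tau>, vpsi v))
      = diag_word (ws @ [1..<N]) (single \<tau> 1)"
    using leading_wordD(1)[OF ws \<tau>] unrotate_exponent_vpsi[OF v]
    by (simp add: Jack_vpsi monomial_coeff_Psi diag_word_append)
  fix m assume nonzero: "monomial_coeff m (Jack lam (\<tau>, vpsi v)) \<noteq> 0"
  let ?m = "perm_exponents [1..<N] (m - single N 1)"
  have positive: "0 < lookup m N" and "monomial_coeff ?m (Jack lam (\<tau>, v)) \<noteq> 0"
    using nonzero by (auto simp: Jack_vpsi monomial_coeff_Psi split: if_splits)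
  then have "level_le N (affine_rotation N (lookup ?m)) (affine_rotation N (entry v))"
    using leading_wordD(2)[OF ws \<tau>] v(2) by (intro level_le_affine_rotation)
  moreover have "lookup m k = affine_rotation N (lookup ?m) k" if "1 \<le> k" "k \<le> N" for k
    using positive that
    by (auto simp: affine_rotation_def word_perm_cycle lookup_minus lookup_single when_def)
  ultimately show "level_le N (lookup m) (entry (vpsi v))"
    using level_le_cong[of N "lookup m" "affine_rotation N (lookup ?m)" "entry (vpsi v)"
      "affine_rotation N (entry v)"]
      entry_vpsi_eq_rotation[OF v(1)] by blast
qed

lemma swap_exponent_vswap:
  assumes "1 \<le> i" "i < length v"
  shows "swap_exponents i (exponent v) = exponent (vswap i v)"
proof (rule poly_mapping_eqI)
  fix k
  show "lookup (swap_exponents i (exponent v)) k = lookup (exponent (vswap i v)) k"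
    using transpose_Suc_in_range_iff[OF assms, of k] entry_vswap[OF assms, of k]
    by (simp add: lookup_exponent)
qed

lemma level_le_vswap_iff:
  assumes "1 \<le> i" "i < N" "length v = N"
  shows "level_le N f (entry v) \<longleftrightarrow> level_le N f (entry (vswap i v) \<circ> transpose i (Suc i))"
    and "level_le N (lookup (exponent v)) g
        \<longleftrightarrow> level_le N (entry (vswap i v) \<circ> transpose i (Suc i)) g"
proof -
  let ?w = "entry (vswap i v) \<circ> transpose i (Suc i)"
  have entry_v: "entry v k = ?w k" if "1 \<le> k" "k \<le> N" for k
    using entry_vswap[of i v "transpose i (Suc i) k"]
      transpose_Suc_in_range_iff[OF assms(1,2), of k] assms that
    by simp
  then show "level_le N f (entry v) \<longleftrightarrow> level_le N f ?w"
    using level_le_cong[of N f f "entry v" ?w] by blast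
  show "level_le N (lookup (exponent v)) g \<longleftrightarrow> level_le N ?w g"
    using level_le_cong[of N "lookup (exponent v)" ?w g g] entry_v assms(3)
    by (simp add: lookup_exponent)
qed

lemma entry_vswap_less:
  assumes "1 \<le> i" "i < length v" "entry v (Suc i) < entry v i"
  shows "entry (vswap i v) i < entry (vswap i v) (Suc i)"
  using entry_vswap[of i v i] entry_vswap[of i v "Suc i"] assms by simp

lemma monomial_coeff_exponent_vswap:
  assumes v: "length v = N" and i: "1 \<le> i" "i < N" "entry v (Suc i) < entry v i"
    and ws: "leading_word (vswap i v) ws" and \<tau>: "rst \<tau>"
  shows "monomial_coeff (exponent v) (Jack lam (\<tau>, vswap i v)) = 0"
proof (rule ccontr)
  assume "monomial_coeff (exponent v) (Jack lam (\<tau>, vswap i v)) \<noteq> 0"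
  then have "level_le N (lookup (exponent v)) (entry (vswap i v))"
    by (rule leading_wordD(2)[OF ws \<tau>])
  then have "level_le N (entry (vswap i v) \<circ> transpose i (Suc i)) (entry (vswap i v))"
    by (simp only: level_le_vswap_iff(2)[OF i(1,2) v])
  then show False using not_level_le_transpose[OF i(1,2)] entry_vswap_less[of i v] v i by simp
qed

lemma leading_word_vswap:
  assumes v: "length v = N" and i: "1 \<le> i" "i < N" "entry v (Suc i) < entry v i"
    and ws: "leading_word (vswap i v) ws"
  shows "leading_word v (ws @ [i])"
  unfolding leading_word_def
proof (intro allI impI conjI)
  fix \<tau> assume \<tau>: "rst \<tau>"
  let ?w = "vswap i v"
  have w_increases: "entry ?w i \<le> entry ?w (Suc i)"
    using entry_vswap_less[of i v] v i by simp
  have "descent i (\<tau>, v)" using \<tau> v i by (intro descent_if_entry_less) (simp_all add: is_vertex_def)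
  then obtain x y where Jack_v: "Jack lam (\<tau>, v) = intertwiner i x y (Jack lam (\<tau>, ?w))"
    using Jack_descent i(3) by (fastforce simp: step_def)
  show "monomial_coeff (exponent v) (Jack lam (\<tau>, v)) = diag_word (ws @ [i]) (single \<tau> 1)"
    using leading_wordD(1)[OF ws \<tau>] monomial_coeff_exponent_vswap[OF v i ws \<tau>]
      swap_exponent_vswap[of i v] v i
    by (simp add: Jack_v monomial_coeff_intertwiner diag_word_append) (simp add: diag_word_def)
  fix m assume "monomial_coeff m (Jack lam (\<tau>, v)) \<noteq> 0"
  then have "monomial_coeff (swap_exponents i m) (Jack lam (\<tau>, ?w)) \<noteq> 0
      \<or> monomial_coeff m (Jack lam (\<tau>, ?w)) \<noteq> 0"
    unfolding Jack_v monomial_coeff_intertwiner by auto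
  then show "level_le N (lookup m) (entry v)"
  proof
    assume "monomial_coeff (swap_exponents i m) (Jack lam (\<tau>, ?w)) \<noteq> 0"
    then have "level_le N (lookup (swap_exponents i m)) (entry ?w)"
      by (rule leading_wordD(2)[OF ws \<tau>])
    from level_le_transpose[OF i(1,2) w_increases this]
    have "level_le N (lookup (swap_exponents i m) \<circ> transpose i (Suc i)) (entry v)"
      by (simp only: level_le_vswap_iff(1)[OF i(1,2) v])
    moreover have "lookup (swap_exponents i m) \<circ> transpose i (Suc i) = lookup m"
      by (simp add: fun_eq_iff)
    ultimately show ?thesis by simp
  next
    assume "monomial_coeff m (Jack lam (\<tau>, ?w)) \<noteq> 0"
    then have "level_le N (lookup m) (entry ?w)" by (rule leading_wordD(2)[OF ws \<tau>])
    then show ?thesis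
      unfolding level_le_vswap_iff(1)[OF i(1,2) v]
      by (rule level_le_trans[OF _ level_le_transpose_if_le[OF i(1,2) w_increases]])
  qed
qed

lemma leading_word_exists:
  assumes "length v = N"
  obtains ws where "leading_word v ws"
proof -
  have "\<exists>ws. leading_word (snd u) ws" if "is_vertex u" for u
    using that
  proof (induction u rule: vertex_induct)
    case (vertex u)
    note length_u = is_vertexD(2)[OF vertex(1)]
    from vertex(1) show ?case
    proof (cases rule: vertex_entry_cases)
      case zero
      then show ?thesis using leading_word_zero_vector by auto
    next
      case affine
      have "snd u = vpsi (snd (unpsi u))" using psi_unpsi[OF affine] by (metis psi_def snd_conv)
      then show ?thesis
        using vertex(2)[OF unpsi_less[OF affine]] leading_word_vpsi
          is_vertexD(2)[OF is_vertex_unpsi[OF affine]]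
          affine_descentD(3)[OF affine] by metis
    next
      case (entry i)
      have "snd (step i u) = vswap i (snd u)" using entry(3) by (simp add: step_def)
      then show ?thesis
        using vertex(2)[OF descent_step_less[OF descent_if_entry_less[OF vertex(1) entry]]]
          leading_word_vswap[OF length_u entry] by auto
    qed
  qed
  from this[of "(tau_shape lam, v)"] show ?thesis
    using assms rst_tau_shape that by (auto simp: is_vertex_def)
qed

lemma dominant_monomial_coeff_eq_0:
  assumes "is_vertex (\<tau>, v)" "mset v' = mset v" "sorted (rev v')" "v \<noteq> v'"
  shows "monomial_coeff (exponent v') (Jack lam (\<tau>, v)) = 0"
proof (rule ccontr)
  assume nonzero: "monomial_coeff (exponent v') (Jack lam (\<tau>, v)) \<noteq> 0"
  have lengths: "length v = N" "length v' = N" and \<tau>: "rst \<tau>"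
    using assms(1) mset_eq_length[OF assms(2)] by (auto simp: is_vertex_def)
  obtain ws where "leading_word v ws" using leading_word_exists[OF lengths(1)] .
  then have "level_le N (lookup (exponent v')) (entry v)" using \<tau> nonzero by (rule leading_wordD(2))
  then have v'_le_v: "level_le N (entry v') (entry v)"
    using level_le_cong[of N "lookup (exponent v')" "entry v'" "entry v" "entry v"] lengths
    by (simp add: lookup_exponent)
  have level_at_0: "level N (entry w) t 0 = sum_mset (image_mset (\<lambda>x. x - t) (mset w))"
    if "length w = N" for w t
  proof -
    have "level N (entry w) t 0 = (\<Sum>k\<in>{1..length w}. entry w k - t)"
      unfolding level_def that by (rule sum.cong) auto
    also have "\<dots>
        = sum_mset (image_mset (\<lambda>x. x - t) (image_mset (entry w) (mset_set {1..length w})))"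
      by (simp add: sum_unfold_sum_mset multiset.map_comp o_def)
    finally show ?thesis by (simp add: image_mset_entry)
  qed
  have "entry v' k = entry v k" if "1 \<le> k" "k \<le> N" for k
  proof (rule level_le_antimono_imp_eq[OF _ _ v'_le_v that])
    show "level N (entry v') t 0 = level N (entry v) t 0" for t
      using level_at_0 assms(2) lengths by simp
    show "entry v' k \<le> entry v' j" if "1 \<le> j" "j \<le> k" "k \<le> N" for j k
      using sorted_rev_nth_mono[OF assms(3), of "j - 1" "k - 1"] that lengths by simp
  qed
  from this[of "Suc _"] have "v' ! k = v ! k" if "k < N" for k using that by simp
  then show False using assms(4) lengths by (metis nth_equalityI)
qed

end

section \<open>The symmetrizer\<close>

interpretation Sym: module_hom smul smul "Sym n" for n
  by unfold_locales
    (simp_all add: Sym_def diag_perm_def diag_word.add diag_word.scale sum.distrib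
      smul.scale_sum_right)

lemma diag_perm_eq_diag_word:
  assumes "w permutes {1..n}"
  obtains ws where "set ws \<subseteq> {1..<n}" "word_perm ws = w" "\<And>P. diag_perm n w P = diag_word ws P"
proof -
  define ws where "ws = (SOME ws. set ws \<subseteq> {1..<n} \<and> word_perm ws = w)"
  have "set ws \<subseteq> {1..<n} \<and> word_perm ws = w"
    unfolding ws_def by (rule someI_ex) (rule word_perm_surj[OF assms])
  then show ?thesis using that[of ws] by (simp add: diag_perm_def ws_def)
qed

lemma Sym_invariant:
  assumes "\<And>i. 1 \<le> i \<Longrightarrow> i < n \<Longrightarrow> diag_s i P = P"
  shows "Sym n P = smul (of_nat (fact n)) P"
proof -
  have "diag_word ws P = P" if "set ws \<subseteq> {1..<n}" for ws
    using that by (induction ws) (auto simp: diag_word_def assms)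
  then have "diag_perm n w P = P" if "w permutes {1..n}" for w
    using diag_perm_eq_diag_word[OF that] by metis
  then have "Sym n P = (\<Sum>w | w permutes {1..n}. P)" by (simp add: Sym_def)
  then show ?thesis by (simp add: smul.sum_constant_scale card_permutations)
qed

context shape
begin

lemma Sym_diag_s:
  assumes "P \<in> rst_module" "1 \<le> i" "i < N"
  shows "Sym N (diag_s i P) = Sym N P"
proof -
  let ?t = "transpose i (Suc i)"
  have transposition: "?t permutes {1..N}" using assms by (intro permutes_swap_id) auto
  have "diag_perm N w (diag_s i P) = diag_perm N (w \<circ> ?t) P" if w: "w permutes {1..N}" for w
  proof -
    obtain ws where ws: "set ws \<subseteq> {1..<N}" "word_perm ws = w" "\<And>P. diag_perm N w P = diag_word ws P"
      using diag_perm_eq_diag_word[OF w] by metis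
    obtain us where us: "set us \<subseteq> {1..<N}" "word_perm us = w \<circ> ?t"
      "\<And>P. diag_perm N (w \<circ> ?t) P = diag_word us P"
      using diag_perm_eq_diag_word[OF permutes_compose[OF transposition w]] by metis
    have "diag_word (i # ws) P = diag_word us P"
      using assms ws(1,2) us(1,2) by (intro diag_word_cong) (auto simp: word_perm_Cons)
    then show ?thesis using ws(3) us(3) by (simp add: diag_word_def)
  qed
  then have "Sym N (diag_s i P) = (\<Sum>w | w permutes {1..N}. diag_perm N (w \<circ> ?t) P)"
    unfolding Sym_def by (intro sum.cong) auto
  also have "\<dots> = Sym N P"
    unfolding Sym_def
    by (rule sum.reindex_bij_witness[of _ "\<lambda>w. w \<circ> ?t" "\<lambda>w. w \<circ> ?t"])
      (simp_all add: permutes_compose[OF transposition] comp_assoc)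
  finally show ?thesis .
qed

lemma Sym_intertwiner:
  assumes "P \<in> rst_module" "1 \<le> i" "i < N"
  shows "Sym N (intertwiner i x y P) = smul (1 + 1 / (x - y)) (Sym N P)"
  by (simp add: intertwiner_def Sym.add Sym.scale Sym_diag_s[OF assms] smul.scale_left_distrib)

section \<open>Products over inversions\<close>

definition inversion_factor :: "vertex \<Rightarrow> nat \<times> nat \<Rightarrow> qalpha" where
  "inversion_factor u p =
    (spec u (snd p) - spec u (fst p)) / (spec u (snd p) - spec u (fst p) + 1)"

definition inversion_product :: "vertex \<Rightarrow> qalpha" where
  "inversion_product u = (\<Prod>p\<in>inversions u. inversion_factor u p)"

lemma inversion_product_nonzero: "inversion_product u \<noteq> 0"
proof -
  have "inversion_factor u p \<noteq> 0" if "p \<in> inversions u" for p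
  proof -
    have "spec u (fst p) - spec u (snd p) \<notin> {-1, 0, 1}"
      using that by (intro spectral_diff_label_less) (auto simp: inversions_def)
    then show ?thesis by (auto simp: inversion_factor_def algebra_simps)
  qed
  then show ?thesis by (simp add: inversion_product_def prod_zero_iff)
qed

lemma inversion_product_ascent_step:
  assumes "ascent i u"
  shows "inversion_product (step i u) = inversion_factor u (Suc i, i) * inversion_product u"
proof -
  let ?swap = "map_prod (transpose i (Suc i)) (transpose i (Suc i))"
  note inversions = inversions_descent_step[OF descent_ascent_step[OF assms]]
  have step: "step i (step i u) = u" using step_step assms by blast
  have factor: "inversion_factor (step i u) (?swap p) = inversion_factor u p" for p
    by (simp add: inversion_factor_def label_ascent_step[OF assms])
  have "inversion_product (step i u)
      = inversion_factor (step i u) (i, Suc i) *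
        (\<Prod>p\<in>?swap ` inversions u. inversion_factor (step i u) p)"
    unfolding inversion_product_def using inversions(1,2) by (simp add: step)
  also have "inversion_factor (step i u) (i, Suc i) = inversion_factor u (Suc i, i)"
    using factor[of "(Suc i, i)"] by simp
  also have "(\<Prod>p\<in>?swap ` inversions u. inversion_factor (step i u) p) = inversion_product u"
    unfolding inversion_product_def
    using inj_on_subset[OF inversions(3) subset_UNIV] by (subst prod.reindex) (auto simp: factor)
  finally show ?thesis .
qed

lemma std_eq_rank:
  assumes "p \<in> cells lam"
  shows "std lam T p = N - card {q \<in> cells lam. row_order T q p}"
proof -
  obtain r c where p: "p = (r, c)" by fastforce
  define B where "B = {(r', c') \<in> cells lam. T (r', c') = T (r, c) \<and> (r' < r \<or> (r' = r \<and> c' < c))}"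
  have "{q \<in> cells lam. row_order T q p} = {q \<in> cells lam. T q < T p} \<union> B"
    by (auto simp: p B_def block_order_def)
  moreover have "finite B" "{q \<in> cells lam. T q < T p} \<inter> B = {}"
    by (auto simp: B_def p intro: finite_subset[OF _ finite_cells])
  ultimately have "card {q \<in> cells lam. row_order T q p} = card {q \<in> cells lam. T q < T p} + card B"
    by (simp add: card_Un_disjoint)
  then show ?thesis
    using assms by (simp add: std_def p sum_list_lam card_less_eq_sum_card_eq B_def)
qed

end

section \<open>Components\<close>

locale component = shape +
  fixes C :: "vertex set" and T :: tab
  assumes component: "C \<in> H_components lam"
    and T_of_component: "T_of lam ` C = {T}"
begin

lemma component_eq_reachable:
  obtains u where "is_vertex u" "C = (H_adj lam)\<^sup>* `` {u}"
  using component H_verts_iff by (auto simp: H_components_def)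

lemma component_nonempty: "C \<noteq> {}"
  using T_of_component by auto

lemma T_of_vertex: "u \<in> C \<Longrightarrow> T_of lam u = T"
  using T_of_component by auto

lemma component_is_vertex:
  assumes "u \<in> C"
  shows "is_vertex u"
proof -
  obtain u0 where u0: "is_vertex u0" "C = (H_adj lam)\<^sup>* `` {u0}" by (rule component_eq_reachable)
  then have "(u0, u) \<in> (H_adj lam)\<^sup>*" using assms by simp
  then show ?thesis
  proof induction
    case base
    then show ?case by (rule u0(1))
  next
    case (step y z)
    then obtain i where "H_edge lam y i z \<or> H_edge lam z i y" by (auto simp: H_adj_def)
    then show ?case using is_vertex_step[of i y] by (auto simp: H_edge_iff ascent_def)
  qed
qed

lemma component_step:
  assumes "u \<in> C" "ascent i u \<or> descent i u"
  shows "step i u \<in> C"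
proof -
  have "(u, step i u) \<in> H_adj lam"
    using assms(2) H_edge_from_step[of i u] by (auto simp: H_adj_def H_edge_iff)
  moreover obtain u0 where "C = (H_adj lam)\<^sup>* `` {u0}" by (rule component_eq_reachable)
  ultimately show ?thesis using assms(1) by (auto intro: rtrancl_into_rtrancl)
qed

lemma component_descent_induct [consumes 1, case_names vertex]:
  assumes "u \<in> C"
    and "\<And>u. u \<in> C \<Longrightarrow> (\<And>i. descent i u \<Longrightarrow> step i u \<in> C \<Longrightarrow> Q (step i u)) \<Longrightarrow> Q u"
  shows "Q u"
proof -
  have "u \<in> C \<longrightarrow> Q u" if "is_vertex u" for u
    using that by (induction u rule: vertex_induct) (use assms(2) descent_step_less in blast)
  then show ?thesis using assms(1) component_is_vertex by blast
qed

lemma component_ascent_induct [consumes 1, case_names vertex]: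
  assumes "u \<in> C"
    and "\<And>u. u \<in> C \<Longrightarrow> (\<And>i. ascent i u \<Longrightarrow> step i u \<in> C \<Longrightarrow> Q (step i u)) \<Longrightarrow> Q u"
  shows "Q u"
proof -
  have "u \<in> C \<longrightarrow> Q u" if "is_vertex u" for u
    using that by (induction u rule: ascent_induct) (use assms(2) in blast)
  then show ?thesis using assms(1) component_is_vertex by blast
qed

lemma mset_component:
  assumes "u \<in> C"
  shows "mset (snd u) = image_mset T (mset_set (cells lam))"
proof -
  have u: "rst (fst u)" "length (snd u) = N"
    using component_is_vertex[OF assms] by (auto simp: is_vertex_def)
  have "image_mset T (mset_set (cells lam))
      = image_mset (entry (vplus (snd u))) (image_mset (fst u) (mset_set (cells lam)))"
    unfolding multiset.map_comp using T_of_vertex[OF assms] T_of_cell[of _ u]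
    by (intro image_mset_cong) simp
  also have "image_mset (fst u) (mset_set (cells lam)) = mset_set {1..length (vplus (snd u))}"
    using rst_bij[OF u(1)] u(2) by (subst image_mset_mset_set) (auto simp: bij_betw_def vplus_def)
  finally show ?thesis unfolding image_mset_entry by (simp add: vplus_def)
qed

lemma finite_component: "finite C"
proof (rule finite_subset)
  let ?A = "set_mset (image_mset T (mset_set (cells lam)))"
  show "C \<subseteq> {\<tau>. rst \<tau>} \<times> {v. set v \<subseteq> ?A \<and> length v = N}"
  proof
    fix u assume u: "u \<in> C"
    have "set (snd u) = ?A" using mset_component[OF u] by (metis set_mset_mset)
    then show "u \<in> {\<tau>. rst \<tau>} \<times> {v. set v \<subseteq> ?A \<and> length v = N}"
      using component_is_vertex[OF u] by (cases u) (auto simp: is_vertex_def)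
  qed
  show "finite ({\<tau>. rst \<tau>} \<times> {v. set v \<subseteq> ?A \<and> length v = N})"
    by (intro finite_cartesian_product finite_rst finite_lists_length_eq) auto
qed

abbreviation sink :: vertex where
  "sink \<equiv> (std lam T, lambda_T lam T)"

lemma sink_if_no_ascent:
  assumes "u \<in> C" "\<And>i. \<not> ascent i u"
  shows "u = sink"
proof (rule prod_eqI)
  note u = component_is_vertex[OF assms(1)]
  note order = no_ascent_structure[OF u assms(2), unfolded T_of_vertex[OF assms(1)]]
  have "lambda_T lam T = rev (sort (rev (snd u)))"
    unfolding lambda_T_def mset_component[OF assms(1), symmetric]
    by (metis mset_rev sorted_list_of_multiset_mset)
  then show "snd u = snd sink" using order(1) by (simp add: sorted_sort_id)
  have \<tau>: "rst (fst u)" using u by (simp add: is_vertex_def)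
  show "fst u = fst sink"
  proof
    fix p
    show "fst u p = fst sink p"
    proof (cases "p \<in> cells lam")
      case True
      then have "{q \<in> cells lam. fst u p < fst u q} = {q \<in> cells lam. row_order T q p}"
        using order(2)[OF _ True] by (intro Collect_cong) blast
      then show ?thesis using rst_eq_card_greater[OF \<tau> True] std_eq_rank[OF True] by simp
    next
      case False
      then show ?thesis using rst_outside[OF \<tau>] by (cases p) (simp add: std_def)
    qed
  qed
qed

definition is_source :: "vertex \<Rightarrow> bool" where
  "is_source s \<longleftrightarrow> s \<in> C \<and> (\<forall>i. \<not> descent i s)"

lemma source_structure:
  assumes "is_source s"
  shows "s \<in> C" "sorted (snd s)"
    and "p \<in> cells lam \<Longrightarrow> q \<in> cells lam \<Longrightarrow> fst s q < fst s p \<longleftrightarrow> column_order T p q"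
proof -
  show s: "s \<in> C" using assms by (simp add: is_source_def)
  note order = no_descent_structure[OF component_is_vertex[OF s], unfolded T_of_vertex[OF s]]
  show "sorted (snd s)" using order(1) assms by (simp add: is_source_def)
  show "p \<in> cells lam \<Longrightarrow> q \<in> cells lam \<Longrightarrow> fst s q < fst s p \<longleftrightarrow> column_order T p q"
    using order(2) assms by (simp add: is_source_def)
qed

lemma source_unique:
  assumes "is_source u" "is_source w"
  shows "u = w"
proof (rule prod_eqI)
  note u = source_structure[OF assms(1)] and w = source_structure[OF assms(2)]
  have "mset (snd u) = mset (snd w)" using mset_component[OF u(1)] mset_component[OF w(1)] by simp
  then show "snd u = snd w" using u(2) w(2) by (metis sorted_sort_id sorted_list_of_multiset_mset)
  show "fst u = fst w"
    using component_is_vertex[OF u(1)] component_is_vertex[OF w(1)] u(3) w(3)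
    by (intro rst_eqI_order) (auto simp: is_vertex_def)
qed

lemma source_exists:
  obtains s where "is_source s"
proof -
  have "\<exists>s. is_source s" if "u \<in> C" for u
    using that
  proof (induction u rule: component_descent_induct)
    case (vertex u)
    show ?case
    proof (cases "\<exists>i. descent i u")
      case True
      then show ?thesis using vertex component_step by blast
    next
      case False
      then have "is_source u" using vertex(1) by (simp add: is_source_def)
      then show ?thesis ..
    qed
  qed
  then show ?thesis using that component_nonempty by blast
qed

section \<open>Coefficients on a component\<close>

lemma is_source_iff_no_incoming:
  assumes "u \<in> C"
  shows "is_source u \<longleftrightarrow> \<not> (\<exists>w\<in>C. \<exists>i. H_edge lam w i u)"
proof -
  have "descent i u \<Longrightarrow> H_edge lam (step i u) i u \<and> step i u \<in> C" for i
    using H_edge_from_step component_step[OF assms] by blast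
  moreover have "H_edge lam w i u \<Longrightarrow> descent i u" for w i
    using descent_ascent_step by (auto simp: H_edge_iff)
  ultimately show ?thesis using assms unfolding is_source_def by blast
qed

lemma E_rel_imp_eq:
  assumes "is_source s" "E_rel lam C u e"
  shows "e = inversion_product u / inversion_product s"
  using assms(2)
proof induction
  case (source u)
  then have "u = s" using is_source_iff_no_incoming source_unique[OF _ assms(1)] by blast
  then show ?case using inversion_product_nonzero[of s] by simp
next
  case (step \<tau>' v' e w i)
  then have ascent: "ascent i (\<tau>', v')" "w = step i (\<tau>', v')" by (simp_all add: H_edge_iff)
  note w = ascentD[OF ascent(1)]
  show ?case
    using inversion_product_ascent_step[OF ascent(1)] step.IH w
    by (simp add: ascent(2) inversion_factor_def zeta_eq_spectral is_vertex_def)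
qed

lemma E_rel_exists: "u \<in> C \<Longrightarrow> \<exists>e. E_rel lam C u e"
proof (induction u rule: component_descent_induct)
  case (vertex u)
  show ?case
  proof (cases "\<exists>i. descent i u")
    case True
    then obtain i where i: "descent i u" ..
    then obtain e where "E_rel lam C (step i u) e"
      using vertex(2) component_step[OF vertex(1)] by blast
    then show ?thesis
      using E_rel.step[of lam C "fst (step i u)" "snd (step i u)" e u i] vertex(1)
        H_edge_from_step[OF i] by auto
  next
    case False
    then show ?thesis
      using E_rel.source[OF vertex(1)] is_source_iff_no_incoming[OF vertex(1)] vertex(1)
      by (auto simp: is_source_def)
  qed
qed

lemma E_coeff_eq:
  assumes "is_source s" "u \<in> C"
  shows "E_coeff lam C u = inversion_product u / inversion_product s"
  unfolding E_coeff_def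
  using E_rel_exists[OF assms(2)] E_rel_imp_eq[OF assms(1)] by (metis the_equality)

lemma E_coeff_nonzero: "u \<in> C \<Longrightarrow> E_coeff lam C u \<noteq> 0"
  using source_exists E_coeff_eq inversion_product_nonzero by (metis divide_eq_0_iff)

lemma E_coeff_step:
  assumes "u \<in> C" "ascent i u"
  shows "E_coeff lam C (step i u) = inversion_factor u (Suc i, i) * E_coeff lam C u"
proof -
  obtain s where s: "is_source s" by (rule source_exists)
  have "step i u \<in> C" using component_step assms by blast
  then show ?thesis
    using E_coeff_eq[OF s] assms(1) inversion_product_ascent_step[OF assms(2)] by simp
qed

section \<open>Symmetrization on a component\<close>

lemma Sym_ascent:
  assumes "ascent i u"
  obtains c where "c \<noteq> 0" "Sym N (Jack lam (step i u)) = smul c (Sym N (Jack lam u))"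
proof
  let ?d = "spec u (Suc i) - spec u i"
  note u = ascentD[OF assms]
  have spec_diff: "?d \<notin> {-1, 0, 1}" by (rule spectral_diff_label_less[OF u(4)])
  then have "1 + 1 / ?d = (?d + 1) / ?d" by (simp add: add_divide_distrib)
  then show "1 + 1 / ?d \<noteq> 0" using spec_diff by (simp add: add_eq_0_iff)
  show "Sym N (Jack lam (step i u)) = smul (1 + 1 / ?d) (Sym N (Jack lam u))"
    unfolding Jack_ascent[OF assms] by (rule Sym_intertwiner[OF Jack_rst_module[OF u(1)] u(2,3)])
qed

lemma sink_in_component: "sink \<in> C"
proof -
  have "sink \<in> C" if "u \<in> C" for u
    using that
    by (induction u rule: component_ascent_induct) (metis component_step sink_if_no_ascent)
  then show ?thesis using component_nonempty by blast
qed

lemma Sym_sink: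
  assumes "u \<in> C"
  shows "\<exists>c. c \<noteq> 0 \<and> Sym N (Jack lam sink) = smul c (Sym N (Jack lam u))"
  using assms
proof (induction u rule: component_ascent_induct)
  case (vertex u)
  show ?case
  proof (cases "\<exists>i. ascent i u")
    case True
    then obtain i where i: "ascent i u" ..
    obtain c where "c \<noteq> 0" "Sym N (Jack lam (step i u)) = smul c (Sym N (Jack lam u))"
      by (rule Sym_ascent[OF i])
    moreover obtain d where "d \<noteq> 0" "Sym N (Jack lam sink) = smul d (Sym N (Jack lam (step i u)))"
      using vertex(2)[OF i] component_step[OF vertex(1)] i by blast
    ultimately show ?thesis by (intro exI[of _ "d * c"]) simp
  next
    case False
    then have "u = sink" using sink_if_no_ascent[OF vertex(1)] by blast
    then show ?thesis by (intro exI[of _ 1]) simp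
  qed
qed

lemma Sym_multiple:
  assumes "u \<in> C"
  shows "\<exists>c. Sym N (Jack lam u) = smul c (Sym N (Jack lam sink))"
proof -
  obtain c where "c \<noteq> 0" "Sym N (Jack lam sink) = smul c (Sym N (Jack lam u))"
    using Sym_sink[OF assms] by blast
  then have "Sym N (Jack lam u) = smul (1 / c) (Sym N (Jack lam sink))" by simp
  then show ?thesis ..
qed

section \<open>Components that are not compatible\<close>

lemma column_repetition:
  assumes "\<not> one_compatible lam T"
  obtains r c where "(r, c) \<in> cells lam" "(Suc r, c) \<in> cells lam" "T (Suc r, c) = T (r, c)"
proof -
  obtain r r' c where not_increasing: "(r, c) \<in> cells lam" "(r', c) \<in> cells lam" "r < r'"
    "\<not> T (r, c) < T (r', c)"
    using assms unfolding one_compatible_def by blast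
  have above: "(Suc r, c) \<in> cells lam"
    by (rule cells_down_closed[OF not_increasing(2)]) (use not_increasing in \<open>auto simp: cells_def\<close>)
  obtain u where u: "u \<in> C" using component_nonempty by auto
  have \<tau>: "rst (fst u)" using component_is_vertex[OF u] by (simp add: is_vertex_def)
  have up_column: "T (x, c) \<le> T (y, c)" if "x \<le> y" "(x, c) \<in> cells lam" "(y, c) \<in> cells lam" for x y
    using T_of_antimono[OF component_is_vertex[OF u] that(2,3)]
      rst_strict_antimono[OF \<tau> that(2,3,1)] T_of_vertex[OF u]
    by (cases "x = y") auto
  have "T (r, c) \<le> T (Suc r, c)" "T (Suc r, c) \<le> T (r', c)"
    using not_increasing above by (auto intro: up_column)
  then show ?thesis using that[OF not_increasing(1) above] not_increasing(4) by simp
qed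

lemma source_falls:
  assumes s: "is_source s" and repetition: "(r, c) \<in> cells lam" "(Suc r, c) \<in> cells lam"
    "T (Suc r, c) = T (r, c)"
  obtains i where "falls i s" "spec s (Suc i) - spec s i = 1"
proof -
  let ?p = "(Suc r, c)" and ?q = "(r, c)"
  note order = source_structure[OF s]
  note u = component_is_vertex[OF order(1)]
  have \<tau>: "rst (fst s)" using u by (simp add: is_vertex_def)
  have less: "fst s ?p < fst s ?q"
    using order(3)[OF repetition(1,2)] repetition(3) by (simp add: block_order_def)
  have consecutive: "fst s ?q = Suc (fst s ?p)"
  proof (rule ccontr)
    assume "fst s ?q \<noteq> Suc (fst s ?p)"
    then have "Suc (fst s ?p) < fst s ?q" "Suc (fst s ?p) \<le> N"
      using less rst_range[OF \<tau> repetition(1)] by auto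
    then obtain x where x: "x \<in> cells lam" "fst s x = Suc (fst s ?p)" "fst s x < fst s ?q"
      using rst_cell[OF \<tau>, of "Suc (fst s ?p)"] by (metis le_add1 plus_1_eq_Suc)
    have "column_order T ?q x" "column_order T x ?p"
      using order(3)[OF repetition(1) x(1)] order(3)[OF x(1) repetition(2)] x by auto
    then show False using repetition(3) unfolding block_order_def fst_conv snd_conv by linarith
  qed
  obtain i where i: "1 \<le> i" "i < N" "sigma (snd s) i = fst s ?p"
    "entry (snd s) i = entry (snd s) (Suc i)"
    using consecutive_in_block[OF u _ repetition(2,1) consecutive] order(2) repetition(3)
      T_of_vertex[OF order(1)] by auto
  note equal = label_equal_entries[OF u i(1,2,4)]
  have "axial_distance (fst s ?p) (fst s) = -1"
    using axial_distance_cells[OF \<tau> repetition(2,1) consecutive] by simp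
  then have difference: "snd (label s (Suc i)) - snd (label s i) = 1" using equal(2) i(3) by simp
  then have adjacent: "label_adjacent (label s i) (label s (Suc i))"
    using equal(1) by (simp add: label_adjacent_def)
  show ?thesis
  proof (rule that)
    show "falls i s" using u i adjacent by (simp add: falls_def)
    show "spec s (Suc i) - spec s i = 1"
      using spectral_diff_label_adjacent[OF adjacent] difference by simp
  qed
qed

lemma Sym_sink_zero:
  assumes "\<not> one_compatible lam T"
  shows "Sym N (Jack lam sink) = 0"
proof -
  obtain s where s: "is_source s" by (rule source_exists)
  obtain r c where "(r, c) \<in> cells lam" "(Suc r, c) \<in> cells lam" "T (Suc r, c) = T (r, c)"
    by (rule column_repetition[OF assms])
  then obtain i where i: "falls i s" "spec s (Suc i) - spec s i = 1" by (rule source_falls[OF s])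
  note u = fallsD[OF i(1)]
  have "smul 2 (Sym N (Jack lam s)) = Sym N (edge_image i s)"
    using Sym_intertwiner[OF Jack_rst_module[OF u(1)] u(2,3), of "spec s (Suc i)" "spec s i"] i(2)
    by simp
  then have "Sym N (Jack lam s) = 0" unfolding Jack_falls[OF i(1)] by simp
  then show ?thesis using Sym_sink[OF source_structure(1)[OF s]] by auto
qed

section \<open>Components that are compatible\<close>

lemma compatible_falls:
  assumes compatible: "one_compatible lam T" and u: "u \<in> C" and falls: "falls i u"
  shows "diag_s i (Jack lam u) = Jack lam u"
proof -
  note i = fallsD[OF falls]
  have \<tau>: "rst (fst u)" and length_u: "length (snd u) = N" using i(1) by (auto simp: is_vertex_def)
  have equal_entries: "entry (snd u) i = entry (snd u) (Suc i)"
    using i by (simp add: label_adjacent_def label_nth)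
  let ?a = "sigma (snd u) i"
  note equal = label_equal_entries[OF i(1-3) equal_entries]
  obtain r c where p: "(r, c) \<in> cells lam" "fst u (r, c) = ?a"
    using rst_cell[OF \<tau>, of ?a] equal(3,4) by auto
  obtain r' c' where q: "(r', c') \<in> cells lam" "fst u (r', c') = Suc ?a"
    using rst_cell[OF \<tau>, of "Suc ?a"] equal(4) by auto
  have "T (r, c) = T (r', c')"
    using T_of_vertex[OF u] T_of_cell[OF p(1), of u] T_of_cell[OF q(1), of u] p q equal(5)
      equal_entries vplus_sigma[of i "snd u"] vplus_sigma[of "Suc i" "snd u"] length_u i by simp
  then have "\<not> (c' = c \<and> r' < r)" using compatible p q unfolding one_compatible_def by force
  then have "axial_distance ?a (fst u) \<noteq> -1"
    using p q by (cases rule: axial_distance_cases[OF \<tau> p(1) q(1)]) auto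
  then have "snd (label u (Suc i)) - snd (label u i) = -1"
    using i(4) equal(2) by (auto simp: label_adjacent_def)
  then have "spec u (Suc i) - spec u i = -1" using spectral_diff_label_adjacent[OF i(4)] by simp
  then show ?thesis using Jack_falls[OF falls] by (simp add: intertwiner_def)
qed

definition summand :: "vertex \<Rightarrow> tabpol" where
  "summand u = smul (E_coeff lam C u) (Jack lam u)"

lemma Jack_T_eq_sum: "Jack_T lam C = (\<Sum>u\<in>C. summand u)"
  by (simp add: Jack_T_def summand_def)

lemma summand_ascent_invariant:
  assumes "u \<in> C" "ascent i u"
  shows "diag_s i (summand u + summand (step i u)) = summand u + summand (step i u)"
proof -
  let ?d = "spec u (Suc i) - spec u i" and ?J = "Jack lam u" and ?E = "E_coeff lam C u"
  define g where "g = ?d / (?d - 1)"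
  have spec_diff: "?d \<noteq> 0" "?d - 1 \<noteq> 0"
    using spectral_diff_label_less[OF ascentD(4)[OF assms(2)]] by auto
  have "inversion_factor u (Suc i, i) = (- ?d) / (- (?d - 1))"
    by (simp add: inversion_factor_def algebra_simps)
  then have factor: "inversion_factor u (Suc i, i) = g"
    unfolding g_def by (simp only: minus_divide_divide)
  have g_eq: "1 + g * (1 / ?d) = g" using spec_diff by (simp add: g_def field_simps)
  have "summand u + summand (step i u)
      = smul (?E * (1 + g * (1 / ?d))) ?J + smul (?E * g) (diag_s i ?J)"
    unfolding summand_def E_coeff_step[OF assms] factor Jack_ascent[OF assms(2)] intertwiner_def
    by (simp add: smul.scale_right_distrib smul.scale_left_distrib algebra_simps)
  then have "summand u + summand (step i u) = smul (?E * g) (?J + diag_s i ?J)"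
    unfolding g_eq by (simp add: smul.scale_right_distrib)
  then show ?thesis by (simp add: diag_s.scale diag_s.add add.commute)
qed

definition partner :: "nat \<Rightarrow> vertex \<Rightarrow> vertex" where
  "partner i u = (if ascent i u \<or> descent i u then step i u else u)"

lemma partner_in_component: "u \<in> C \<Longrightarrow> partner i u \<in> C"
  by (simp add: partner_def component_step)

lemma partner_partner: "partner i (partner i u) = u"
  using step_step[of i u] ascent_descent_step[of i u] descent_ascent_step[of i u]
  by (auto simp: partner_def)

lemma summand_partner_invariant:
  assumes "one_compatible lam T" "u \<in> C" "1 \<le> i" "i < N"
  shows "diag_s i (summand u + summand (partner i u)) = summand u + summand (partner i u)"
proof -
  consider (ascent) "ascent i u" | (descent) "descent i u"
    | (falls) "falls i u" "\<not> ascent i u" "\<not> descent i u"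
    using vertex_trichotomy[OF component_is_vertex[OF assms(2)] assms(3,4)] by blast
  then show ?thesis
  proof cases
    case ascent
    then show ?thesis using summand_ascent_invariant[OF assms(2)] by (simp add: partner_def)
  next
    case descent
    then have "step i u \<in> C" "ascent i (step i u)" "step i (step i u) = u"
      using component_step[OF assms(2)] ascent_descent_step step_step by auto
    then show ?thesis
      using summand_ascent_invariant[of "step i u" i] descent by (simp add: partner_def add.commute)
  next
    case falls
    then show ?thesis
      using compatible_falls[OF assms(1,2)]
      by (simp add: partner_def summand_def diag_s.add diag_s.scale)
  qed
qed

lemma Jack_T_symmetric:
  assumes "one_compatible lam T" "1 \<le> i" "i < N"
  shows "diag_s i (Jack_T lam C) = Jack_T lam C"
proof -
  let ?J = "Jack_T lam C"
  have double: "smul 2 P = P + P" for P using smul.scale_left_distrib[of 1 1 P] by simp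
  have "(\<Sum>u\<in>C. summand (partner i u)) = (\<Sum>u\<in>C. summand u)"
    by (rule sum.reindex_bij_witness[of _ "partner i" "partner i"])
      (simp_all add: partner_in_component partner_partner)
  then have pairs: "smul 2 ?J = (\<Sum>u\<in>C. summand u + summand (partner i u))"
    by (simp add: double Jack_T_eq_sum sum.distrib)
  then have "diag_s i (smul 2 ?J) = (\<Sum>u\<in>C. diag_s i (summand u + summand (partner i u)))"
    by (simp only: diag_s.sum)
  also have "\<dots> = smul 2 ?J"
    unfolding pairs
    by (rule sum.cong) (auto simp: summand_partner_invariant[OF assms(1) _ assms(2,3)])
  finally show ?thesis by (simp add: diag_s.scale)
qed

lemma monomial_coeff_summand:
  assumes "leading_word (lambda_T lam T) ws" "u \<in> C"
  shows "monomial_coeff (exponent (lambda_T lam T)) (summand u)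
    = diag_word ws
        (if snd u = lambda_T lam T then single (fst u) (pconst (E_coeff lam C u)) else 0)"
proof (cases "snd u = lambda_T lam T")
  case True
  have "rst (fst u)" using component_is_vertex[OF assms(2)] by (simp add: is_vertex_def)
  then have "monomial_coeff (exponent (lambda_T lam T)) (Jack lam u)
      = diag_word ws (single (fst u) 1)"
    using leading_wordD(1)[OF assms(1)] True by (metis prod.collapse)
  then show ?thesis
    using True diag_word.scale[of ws "E_coeff lam C u" "single (fst u) 1"]
    by (simp add: summand_def monomial_coeff.scale smul_single)
next
  case False
  have "mset (lambda_T lam T) = mset (snd u)"
    using mset_component[OF sink_in_component] mset_component[OF assms(2)] by simp
  then have "monomial_coeff (exponent (lambda_T lam T)) (Jack lam (fst u, snd u)) = 0"
    using component_is_vertex[OF assms(2)] False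
    by (intro dominant_monomial_coeff_eq_0) (auto simp: lambda_T_def)
  then show ?thesis using False by (simp add: summand_def monomial_coeff.scale)
qed

lemma Jack_T_nonzero: "Jack_T lam C \<noteq> 0"
proof
  assume zero: "Jack_T lam C = 0"
  let ?l = "lambda_T lam T"
  have "length ?l = N" using component_is_vertex[OF sink_in_component] by (simp add: is_vertex_def)
  then obtain ws where ws: "leading_word ?l ws" by (rule leading_word_exists)
  define X where "X = (\<Sum>u\<in>C. if snd u = ?l then single (fst u) (pconst (E_coeff lam C u)) else 0)"
  have "diag_word ws X = monomial_coeff (exponent ?l) (Jack_T lam C)"
    unfolding X_def Jack_T_eq_sum monomial_coeff.sum diag_word.sum
    by (rule sum.cong) (simp_all add: monomial_coeff_summand[OF ws])
  then have "X = 0" using zero diag_word_rev[of ws X] by simp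
  have "lookup X (std lam T) = (\<Sum>u\<in>C. if u = sink then pconst (E_coeff lam C sink) else 0)"
    unfolding X_def lookup_sum by (rule sum.cong) (auto simp: lookup_single when_def)
  also have "\<dots> = pconst (E_coeff lam C sink)"
    using finite_component sink_in_component by (simp add: sum.delta)
  finally have "lookup (pconst (E_coeff lam C sink)) 0 = 0" using \<open>X = 0\<close> by simp
  then show False using E_coeff_nonzero[OF sink_in_component] by (simp add: pconst_def)
qed

lemma Sym_sink_nonzero:
  assumes "one_compatible lam T"
  shows "Sym N (Jack lam sink) \<noteq> 0"
proof
  assume "Sym N (Jack lam sink) = 0"
  then have "Sym N (Jack lam u) = 0" if "u \<in> C" for u
    using Sym_multiple[OF that] by auto
  then have "Sym N (Jack_T lam C) = 0"
    by (simp add: Jack_T_def Sym.sum Sym.scale)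
  moreover have "Sym N (Jack_T lam C) = smul (of_nat (fact N)) (Jack_T lam C)"
    by (rule Sym_invariant) (rule Jack_T_symmetric[OF assms])
  ultimately show False using Jack_T_nonzero by simp
qed

end

theorem theorem5p9:
  fixes lam :: "nat list" and N :: nat and HT :: "vertex set" and T :: tab
  assumes "partition_of lam N"
    and "HT \<in> H_components lam"
    and "T_of lam ` HT = {T}"
  shows "(\<forall>u\<in>HT. \<exists>c. Sym N (Jack lam u) = smul c (Sym N (Jack lam (std lam T, lambda_T lam T))))
    \<and> (Sym N (Jack lam (std lam T, lambda_T lam T)) \<noteq> 0 \<longleftrightarrow> one_compatible lam T)
    \<and> (one_compatible lam T \<longrightarrow> (\<forall>i. 1 \<le> i \<and> i < N \<longrightarrow> diag_s i (Jack_T lam HT) = Jack_T lam HT))"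
proof -
  interpret component lam N HT T
    using assms by unfold_locales
  show ?thesis
    using Sym_multiple Sym_sink_zero Sym_sink_nonzero Jack_T_symmetric by blast
qed

end
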